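(* Let $\Omega\subset\mathbb R^n$ be a bounded open set with $C^2$ boundary, let $L,F,G$ satisfy the assumptions below and $H$ be as below. Let $(u,m)$ be a mild solution of the constrained MFG problem in $\overline\Omega$ and let $(t,x)\in Q_m$. Then $$-p_1+H(x,p_2)=F(x,m(t))\qquad\forall(p_1,p_2)\in D^+u(t,x).$$
   Context: $T>0$; $U\supset\overline\Omega$ open; $\mathcal P(\overline\Omega)$ with the Kantorovich–Rubinstein distance $d_1$. Assumptions: (D1) $|F(x,m_1)-F(x,m_2)|+|G(x,m_1)-G(x,m_2)|\le\kappa d_1(m_1,m_2)$; (D2) $F(\cdot,m),G(\cdot,m)\in C^1_b(U)$, $|D_xF|+|D_xG|\le\kappa$; (D3) $x\mapsto F(x,m)$ semiconcave with linear modulus uniformly in $m$; (L0) $L\in C^1(U\times\mathbb R^n)$, $|L(x,0)|+|D_xL(x,0)|+|D_vL(x,0)|\le M$; (L1) $D_vL$ differentiable, $I/\mu\le D^2_{vv}L\le\mu I$, $\|D^2_{vx}L(x,v)\|\le\mu(1+|v|)$; (L2) $|D_xL(x,v)-D_xL(x,w)|\le C(R)|v-w|$ for $v,w\in B_R$; (L3) $x\mapsto L(x,v)$ semiconcave with linear modulus uniformly in $v\in B_R$. $H(x,p)=\sup_v\{-\langle p,v\rangle-L(x,v)\}$ (so that $H$ is $C^1$, strictly convex in $p$ with $I/\mu\le D_{pp}H\le\mu I$, and semiconvex in $x$ with linear modulus locally uniformly in $p$). $\Gamma$: absolutely continuous curves $[0,T]\to\overline\Omega$; $\Gamma_t[x]=\{\gamma:\gamma(t)=x\}$;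 $e_t(\gamma)=\gamma(t)$; $m^\eta(t)=e_t\sharp\eta$; $J_\eta[\gamma]=\int_0^T[L(\gamma,\dot\gamma)+F(\gamma,m^\eta(t))]dt+G(\gamma(T),m^\eta(T))$; $\Gamma^\eta[x]$ minimizers of $J_\eta$ over $\Gamma_0[x]$. Constrained MFG equilibrium for $m_0$: Borel probability $\eta$ on $\Gamma$ with $e_0\sharp\eta=m_0$ and $\mathrm{supp}\,\eta\subset\bigcup_x\Gamma^\eta[x]$. Mild solution: $(u,m)\in C([0,T]\times\overline\Omega)\times C([0,T];\mathcal P(\overline\Omega))$ with, for some equilibrium $\eta$, $m(t)=e_t\sharp\eta$ and $u(t,x)=\inf_{\gamma\in\Gamma_t[x]}\{\int_t^T[L(\gamma,\dot\gamma)+F(\gamma(s),m(s))]ds+G(\gamma(T),m(T))\}$. $Q_m=\{(t,x)\in(0,T)\times\Omega:x\in\mathrm{supp}(m(t))\}$. $D^+u(t,x)$ is the set of $(p_1,p_2)\in\mathbb R\times\mathbb R^n$ with $\limsup_{(s,y)\to(t,x),(s,y)\in(0,T)\times\overline\Omega}\frac{u(s,y)-u(t,x)-p_1(s-t)-\langle p_2,y-x\rangle}{|s-t|+|y-x|}\le0$. *)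

theory Defs
  imports "HOL-Probability.Probability"
begin

text \<open>C^2 on an open set S: differentiable with gradient g, the gradient is
  differentiable with derivative Dg, and Dg is continuous (tested on every direction,
  which in finite dimension is continuity in operator norm).\<close>
definition C2_on :: "'a::euclidean_space set \<Rightarrow> ('a \<Rightarrow> real) \<Rightarrow> bool" where
  "C2_on S f \<longleftrightarrow> (\<exists>g Dg. (\<forall>y\<in>S. (f has_derivative (\<lambda>h. g y \<bullet> h)) (at y)) \<and>
       (\<forall>y\<in>S. (g has_derivative Dg y) (at y)) \<and>
       (\<forall>h. continuous_on S (\<lambda>y. Dg y h)))"

definition C2_boundary :: "'a::euclidean_space set \<Rightarrow> bool" where
  "C2_boundary \<Omega> \<longleftrightarrow> (\<forall>x0\<in>frontier \<Omega>. \<exists>r>0. \<exists>\<psi> g.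
      C2_on (ball x0 r) \<psi> \<and>
      (\<forall>y\<in>ball x0 r. (\<psi> has_derivative (\<lambda>h. g y \<bullet> h)) (at y) \<and> g y \<noteq> 0) \<and>
      (\<forall>y\<in>ball x0 r. (y \<in> \<Omega> \<longleftrightarrow> \<psi> y < 0) \<and> (y \<in> frontier \<Omega> \<longleftrightarrow> \<psi> y = 0)))"

definition Prob_cl :: "'a::euclidean_space set \<Rightarrow> 'a measure set" where
  "Prob_cl \<Omega> = {m. prob_space m \<and> sets m = sets borel \<and> emeasure m (- closure \<Omega>) = 0}"

definition d1 :: "'a::euclidean_space measure \<Rightarrow> 'a measure \<Rightarrow> real" where
  "d1 m1 m2 = (SUP f\<in>{f::'a\<Rightarrow>real. 1-lipschitz_on UNIV f}.
                 integral\<^sup>L m1 f - integral\<^sup>L m2 f)"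

definition supp :: "'a::metric_space measure \<Rightarrow> 'a set" where
  "supp m = {x. \<forall>e>0. emeasure m (ball x e) > 0}"

definition abs_cont_on :: "real \<Rightarrow> real \<Rightarrow> (real \<Rightarrow> 'a::real_normed_vector) \<Rightarrow> bool" where
  "abs_cont_on a b \<gamma> \<longleftrightarrow> (\<forall>e>0. \<exists>d>0. \<forall>(n::nat) (s::nat\<Rightarrow>real) t.
      (\<forall>i<n. a \<le> s i \<and> s i \<le> t i \<and> t i \<le> b) \<and> (\<forall>i<n. \<forall>j<n. i < j \<longrightarrow> t i \<le> s j) \<and>
      (\<Sum>i<n. t i - s i) < d \<longrightarrow> (\<Sum>i<n. norm (\<gamma> (t i) - \<gamma> (s i))) < e)"

text \<open>Gamma: absolutely continuous curves [0,T] -> closure Omega; each curve is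
  represented by its constant extension outside [0,T].\<close>
definition Curves :: "real \<Rightarrow> 'a::euclidean_space set \<Rightarrow> (real \<Rightarrow> 'a) set" where
  "Curves T \<Omega> = {\<gamma>. abs_cont_on 0 T \<gamma> \<and> (\<forall>t\<in>{0..T}. \<gamma> t \<in> closure \<Omega>) \<and>
                     (\<forall>t. \<gamma> t = \<gamma> (min T (max 0 t)))}"

text \<open>Borel sigma-algebra of Gamma (uniform topology); Gamma is separable, so this is
  the trace of the sigma-algebra generated by the evaluation maps.\<close>
definition Curves_sets :: "real \<Rightarrow> 'a::euclidean_space set \<Rightarrow> (real \<Rightarrow> 'a) set set" where
  "Curves_sets T \<Omega> = sets (restrict_space (Pi\<^sub>M UNIV (\<lambda>_. borel)) (Curves T \<Omega>))"

definition supp_curves :: "real \<Rightarrow> 'a::euclidean_space set \<Rightarrow> (real \<Rightarrow> 'a) measure \<Rightarrow> (real \<Rightarrow> 'a) set" where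
  "supp_curves T \<Omega> \<eta> = {\<gamma>\<in>Curves T \<Omega>. \<forall>e>0.
      emeasure \<eta> {\<gamma>'\<in>Curves T \<Omega>. (SUP s\<in>{0..T}. norm (\<gamma>' s - \<gamma> s)) < e} > 0}"

definition flow :: "(real \<Rightarrow> 'a::euclidean_space) measure \<Rightarrow> real \<Rightarrow> 'a measure" where
  "flow \<eta> t = distr \<eta> borel (\<lambda>\<gamma>. \<gamma> t)"

text \<open>Running cost from time t0 to T along gamma, with flow of measures m;
  +infinity if the integrand is not integrable (it is bounded below).\<close>
definition run_cost :: "('a::euclidean_space \<Rightarrow> 'a \<Rightarrow> real) \<Rightarrow> ('a \<Rightarrow> 'a measure \<Rightarrow> real)
     \<Rightarrow> real \<Rightarrow> (real \<Rightarrow> 'a measure) \<Rightarrow> real \<Rightarrow> (real \<Rightarrow> 'a) \<Rightarrow> ereal" where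
  "run_cost L F T m t0 \<gamma> =
     (let f = (\<lambda>s. L (\<gamma> s) (vector_derivative \<gamma> (at s)) + F (\<gamma> s) (m s)) in
      if integrable (lebesgue_on {t0..T}) f then ereal (integral\<^sup>L (lebesgue_on {t0..T}) f)
      else \<infinity>)"

definition total_cost :: "('a::euclidean_space \<Rightarrow> 'a \<Rightarrow> real) \<Rightarrow> ('a \<Rightarrow> 'a measure \<Rightarrow> real)
     \<Rightarrow> ('a \<Rightarrow> 'a measure \<Rightarrow> real) \<Rightarrow> real \<Rightarrow> (real \<Rightarrow> 'a measure) \<Rightarrow> real \<Rightarrow> (real \<Rightarrow> 'a) \<Rightarrow> ereal" where
  "total_cost L F G T m t0 \<gamma> = run_cost L F T m t0 \<gamma> + ereal (G (\<gamma> T) (m T))"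

definition optimal_curves where
  "optimal_curves L F G T \<Omega> \<eta> x = {\<gamma>\<in>Curves T \<Omega>. \<gamma> 0 = x \<and>
      (\<forall>\<gamma>'\<in>Curves T \<Omega>. \<gamma>' 0 = x \<longrightarrow>
         total_cost L F G T (flow \<eta>) 0 \<gamma> \<le> total_cost L F G T (flow \<eta>) 0 \<gamma>')}"

definition constrained_equilibrium where
  "constrained_equilibrium L F G T \<Omega> m0 \<eta> \<longleftrightarrow>
     prob_space \<eta> \<and> space \<eta> = Curves T \<Omega> \<and> sets \<eta> = Curves_sets T \<Omega> \<and>
     flow \<eta> 0 = m0 \<and>
     supp_curves T \<Omega> \<eta> \<subseteq> (\<Union>x\<in>closure \<Omega>. optimal_curves L F G T \<Omega> \<eta> x)"

definition mild_solution where
  "mild_solution L F G T \<Omega> m0 u m \<longleftrightarrow>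
     continuous_on ({0..T} \<times> closure \<Omega>) (\<lambda>z. u (fst z) (snd z)) \<and>
     (\<forall>t\<in>{0..T}. m t \<in> Prob_cl \<Omega>) \<and>
     (\<forall>t\<in>{0..T}. \<forall>e>0. \<exists>d>0. \<forall>s\<in>{0..T}. \<bar>s - t\<bar> < d \<longrightarrow> d1 (m s) (m t) < e) \<and>
     (\<exists>\<eta>. constrained_equilibrium L F G T \<Omega> m0 \<eta> \<and>
        (\<forall>t\<in>{0..T}. m t = flow \<eta> t) \<and>
        (\<forall>t\<in>{0..T}. \<forall>x\<in>closure \<Omega>.
           ereal (u t x) = (INF \<gamma>\<in>{\<gamma>\<in>Curves T \<Omega>. \<gamma> t = x}. total_cost L F G T m t \<gamma>)))"

definition Ham :: "('a::euclidean_space \<Rightarrow> 'a \<Rightarrow> real) \<Rightarrow> 'a \<Rightarrow> 'a \<Rightarrow> real" where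
  "Ham L x p = (SUP v. - (p \<bullet> v) - L x v)"

definition Qset where
  "Qset T \<Omega> m = {(t, x). t \<in> {0<..<T} \<and> x \<in> \<Omega> \<and> x \<in> supp (m t)}"

definition superdiff where
  "superdiff T \<Omega> u t x = {(p1::real, p2). \<forall>e>0. \<exists>d>0. \<forall>s y.
      s \<in> {0<..<T} \<and> y \<in> closure \<Omega> \<and> (s, y) \<noteq> (t, x) \<and> \<bar>s - t\<bar> + norm (y - x) < d \<longrightarrow>
      u s y - u t x - p1 * (s - t) - p2 \<bullet> (y - x) \<le> e * (\<bar>s - t\<bar> + norm (y - x))}"

definition semiconcave_lin :: "real \<Rightarrow> 'a::euclidean_space set \<Rightarrow> ('a \<Rightarrow> real) \<Rightarrow> bool" where
  "semiconcave_lin C S f \<longleftrightarrow> (\<forall>x h. closed_segment (x - h) (x + h) \<subseteq> S \<longrightarrow>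
      f (x + h) + f (x - h) - 2 * f x \<le> C * (norm h)^2)"

end

theory Submission
  imports Defs
begin

text \<open>
  Let (p1, p2) be a superdifferential of u at (t, x). Following the straight line with velocity v
  for a short time and then an almost optimal curve, dynamic programming gives
  - p1 - p2 . v - L(x, v) <= F(x, m(t)), hence one inequality.

  For the converse, x is a limit of points g(t) with g in the support of the equilibrium, because
  the space of curves is separable. Such g is optimal, so u decreases along it exactly by the running
  cost. No regularity of g is needed: for s < t close to t and every q near p2,
  \<integral> L(g, g') >= - q . (g(t) - g(s)) - (t - s) (H(x, p2) + o(1)) by the upper semicontinuity of H,
  where coercivity of L keeps g close to x on [s, t], uniformly over all optimal g with g(t) near x.
  Choosing q = p2 + e w with w the unit vector along g(s) - g(t) absorbs the error e |g(s) - g(t)|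
  of the superdifferential inequality. Letting g(t) tend to x with s fixed, and then s tend to t,
  gives F(x, m(t)) <= - p1 + H(x, p2).

  The only analytic input is Lebesgue's theorem for absolutely continuous curves: they are
  differentiable almost everywhere and are the integral of their derivative.
\<close>

section \<open>Absolutely continuous functions\<close>

text \<open>Nothing is known about the speed of an optimal curve: its displacement over a time
  interval of length h is shown to be small, but not of order h. An error e times that displacement
  could therefore not be divided by h and has to cancel exactly; this is why q is tilted along the
  displacement. The distance of the curve from x at time t is harmless, because the curve is
  selected after h, within a distance that may depend on h.

  Confinement near x rests on the same integrated affine bound as the sharp estimate. With a slope K
  so steep that moving by a fixed distance costs more than the bounded function u can pay for, no
  optimal curve travels that far in a short time, and K does not depend on the curve.

  Differentiability almost everywhere comes from absolute continuity alone: where it fails,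
  difference quotients are unbounded or oscillate across a rational gap, and Vitali coverings show
  both sets to be null.\<close>

lemma abs_cont_onE:
  assumes "abs_cont_on a b \<gamma>" and "e > 0"
  obtains d where "d > 0" "\<And>(n::nat) s t.
      (\<forall>i<n. a \<le> s i \<and> s i \<le> t i \<and> t i \<le> b) \<Longrightarrow> (\<forall>i<n. \<forall>j<n. i < j \<longrightarrow> t i \<le> s j) \<Longrightarrow>
      (\<Sum>i<n. t i - s i) < d \<Longrightarrow> (\<Sum>i<n. norm (\<gamma> (t i) - \<gamma> (s i))) < e"
proof -
  from assms(1)[unfolded abs_cont_on_def, rule_format, OF assms(2)]
  obtain d where "d > 0" and d: "\<forall>(n::nat) (s::nat\<Rightarrow>real) t.
      (\<forall>i<n. a \<le> s i \<and> s i \<le> t i \<and> t i \<le> b) \<and> (\<forall>i<n. \<forall>j<n. i < j \<longrightarrow> t i \<le> s j) \<and>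
      (\<Sum>i<n. t i - s i) < d \<longrightarrow> (\<Sum>i<n. norm (\<gamma> (t i) - \<gamma> (s i))) < e"
    by (elim exE conjE)
  show thesis
    by (rule that[OF \<open>d > 0\<close>], rule d[THEN spec, THEN spec, THEN spec, THEN mp]) (intro conjI)
qed

text \<open>Bridges the ordered sequences in \<open>abs_cont_on_def\<close> and the unordered
  families produced by coverings and divisions. Sorting by left endpoints does it once degenerate
  intervals are dropped: such an interval may sit inside another one, since its open interval is
  empty, but it contributes nothing to either sum. Disjointness is asked of open intervals only, so
  that adjacent cells of a division qualify.\<close>

lemma abs_cont_on_family:
  fixes \<gamma> :: "real \<Rightarrow> 'a::real_normed_vector"
  assumes ac: "abs_cont_on a b \<gamma>" and "e > 0"
  obtains d where "d > 0"
    "\<forall>(I::'i set) \<alpha> \<beta>. finite I \<and> (\<forall>i\<in>I. a \<le> \<alpha> i \<and> \<alpha> i \<le> \<beta> i \<and> \<beta> i \<le> b) \<and>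
       (\<forall>i\<in>I. \<forall>j\<in>I. i \<noteq> j \<longrightarrow> {\<alpha> i<..<\<beta> i} \<inter> {\<alpha> j<..<\<beta> j} = {}) \<and>
       (\<Sum>i\<in>I. \<beta> i - \<alpha> i) < d \<longrightarrow> (\<Sum>i\<in>I. norm (\<gamma> (\<beta> i) - \<gamma> (\<alpha> i))) < e"
proof -
  obtain d where "d > 0" and d: "\<And>(n::nat) s t.
      (\<forall>i<n. a \<le> s i \<and> s i \<le> t i \<and> t i \<le> b) \<Longrightarrow> (\<forall>i<n. \<forall>j<n. i < j \<longrightarrow> t i \<le> s j) \<Longrightarrow>
      (\<Sum>i<n. t i - s i) < d \<Longrightarrow> (\<Sum>i<n. norm (\<gamma> (t i) - \<gamma> (s i))) < e"
    by (rule abs_cont_onE[OF ac \<open>e > 0\<close>]) (rule that)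
  have "(\<Sum>i\<in>I. norm (\<gamma> (\<beta> i) - \<gamma> (\<alpha> i))) < e"
    if fin: "finite I" and ab: "\<And>i. i \<in> I \<Longrightarrow> a \<le> \<alpha> i \<and> \<alpha> i \<le> \<beta> i \<and> \<beta> i \<le> b"
      and dj: "\<And>i j. i \<in> I \<Longrightarrow> j \<in> I \<Longrightarrow> i \<noteq> j \<Longrightarrow> {\<alpha> i<..<\<beta> i} \<inter> {\<alpha> j<..<\<beta> j} = {}"
      and less: "(\<Sum>i\<in>I. \<beta> i - \<alpha> i) < d" for I :: "'i set" and \<alpha> \<beta>
  proof -
    define I' where "I' = {i\<in>I. \<alpha> i < \<beta> i}"
    have finI': "finite I'" using fin by (auto simp: I'_def)
    have order: "\<beta> i \<le> \<alpha> j" if ij: "i \<in> I'" "j \<in> I'" "\<alpha> i \<le> \<alpha> j" "i \<noteq> j" for i j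
    proof (rule ccontr)
      assume "\<not> \<beta> i \<le> \<alpha> j"
      then obtain z where "\<alpha> j < z" "z < min (\<beta> i) (\<beta> j)"
        using ij dense[of "\<alpha> j" "min (\<beta> i) (\<beta> j)"] by (auto simp: I'_def)
      then have "z \<in> {\<alpha> i<..<\<beta> i} \<inter> {\<alpha> j<..<\<beta> j}" using that by auto
      then show False using dj[of i j] that by (auto simp: I'_def)
    qed
    have inj: "inj_on \<alpha> I'"
    proof (rule inj_onI, rule ccontr)
      fix i j assume "i \<in> I'" "j \<in> I'" "\<alpha> i = \<alpha> j" "i \<noteq> j"
      with order[of i j] show False by (auto simp: I'_def)
    qed
    define xs where "xs = sorted_list_of_set (\<alpha> ` I')"
    define g where "g = inv_into I' \<alpha>"
    have xs: "set xs = \<alpha> ` I'" "sorted xs" "distinct xs"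
      using finI' by (auto simp: xs_def)
    have "bij_betw g (\<alpha> ` I') I'"
      unfolding g_def by (intro bij_betw_inv_into inj_on_imp_bij_betw inj)
    then have bij: "bij_betw (\<lambda>k. g (xs ! k)) {..<length xs} I'"
      using bij_betw_trans[OF bij_betw_nth[OF xs(3) refl refl], of g I'] xs(1)
      by (simp add: comp_def)
    have \<alpha>g: "\<alpha> (g (xs ! k)) = xs ! k" if "k < length xs" for k
      unfolding g_def using that xs(1) by (metis f_inv_into_f nth_mem)
    have gI: "g (xs ! k) \<in> I'" if "k < length xs" for k
      using bij that by (auto simp: bij_betw_def)
    have sum_eq: "(\<Sum>i\<in>I. h i) = (\<Sum>k<length xs. h (g (xs ! k)))" if "\<And>i. i \<in> I \<Longrightarrow> \<alpha> i = \<beta> i \<Longrightarrow> h i = 0" for h :: "'i \<Rightarrow> real"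
    proof -
      have "(\<Sum>i\<in>I. h i) = (\<Sum>i\<in>I'. h i)"
        using ab that fin by (intro sum.mono_neutral_right) (auto simp: I'_def order.order_iff_strict)
      also have "\<dots> = (\<Sum>k<length xs. h (g (xs ! k)))"
        using sum.reindex_bij_betw[OF bij, of h] by simp
      finally show ?thesis .
    qed
    have "(\<Sum>k<length xs. norm (\<gamma> (\<beta> (g (xs ! k))) - \<gamma> (xs ! k))) < e"
    proof (rule d)
      show "\<forall>i<length xs. a \<le> xs ! i \<and> xs ! i \<le> \<beta> (g (xs ! i)) \<and> \<beta> (g (xs ! i)) \<le> b"
        using gI ab \<alpha>g by (metis (mono_tags, lifting) I'_def mem_Collect_eq)
      show "\<forall>i<length xs. \<forall>j<length xs. i < j \<longrightarrow> \<beta> (g (xs ! i)) \<le> xs ! j"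
      proof (intro allI impI)
        fix i j assume ij: "i < length xs" "j < length xs" "i < j"
        then have "xs ! i \<le> xs ! j" "xs ! i \<noteq> xs ! j"
          using xs by (auto simp: sorted_iff_nth_mono nth_eq_iff_index_eq)
        then show "\<beta> (g (xs ! i)) \<le> xs ! j"
          using order[of "g (xs ! i)" "g (xs ! j)"] gI ij \<alpha>g by metis
      qed
      show "(\<Sum>i<length xs. \<beta> (g (xs ! i)) - xs ! i) < d"
        using less sum_eq[of "\<lambda>i. \<beta> i - \<alpha> i"] \<alpha>g by simp
    qed
    then show ?thesis
      using sum_eq[of "\<lambda>i. norm (\<gamma> (\<beta> i) - \<gamma> (\<alpha> i))"] \<alpha>g by simp
  qed
  then show thesis using that[OF \<open>d > 0\<close>] by simp
qed

lemma abs_cont_on_lipschitz: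
  fixes \<gamma> :: "real \<Rightarrow> 'a::real_normed_vector"
  assumes "\<And>s t. a \<le> s \<Longrightarrow> s \<le> t \<Longrightarrow> t \<le> b \<Longrightarrow> norm (\<gamma> t - \<gamma> s) \<le> C * (t - s)"
  shows "abs_cont_on a b \<gamma>"
  unfolding abs_cont_on_def
proof (intro allI impI)
  fix e :: real assume "e > 0"
  show "\<exists>d>0. \<forall>(n::nat) (s::nat\<Rightarrow>real) t.
      (\<forall>i<n. a \<le> s i \<and> s i \<le> t i \<and> t i \<le> b) \<and> (\<forall>i<n. \<forall>j<n. i < j \<longrightarrow> t i \<le> s j) \<and>
      (\<Sum>i<n. t i - s i) < d \<longrightarrow> (\<Sum>i<n. norm (\<gamma> (t i) - \<gamma> (s i))) < e"
  proof (intro exI[of _ "e / (\<bar>C\<bar> + 1)"] conjI allI impI)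
    show "e / (\<bar>C\<bar> + 1) > 0" using \<open>e > 0\<close> by simp
    fix n :: nat and s t :: "nat \<Rightarrow> real"
    assume A: "(\<forall>i<n. a \<le> s i \<and> s i \<le> t i \<and> t i \<le> b) \<and> (\<forall>i<n. \<forall>j<n. i < j \<longrightarrow> t i \<le> s j) \<and>
      (\<Sum>i<n. t i - s i) < e / (\<bar>C\<bar> + 1)"
    have "(\<Sum>i<n. norm (\<gamma> (t i) - \<gamma> (s i))) \<le> (\<Sum>i<n. (\<bar>C\<bar> + 1) * (t i - s i))"
    proof (rule sum_mono)
      fix i assume "i \<in> {..<n}"
      then have "a \<le> s i" "s i \<le> t i" "t i \<le> b" using A by auto
      then have "norm (\<gamma> (t i) - \<gamma> (s i)) \<le> C * (t i - s i)" by (rule assms)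
      also have "\<dots> \<le> (\<bar>C\<bar> + 1) * (t i - s i)"
        using \<open>s i \<le> t i\<close> by (intro mult_right_mono) auto
      finally show "norm (\<gamma> (t i) - \<gamma> (s i)) \<le> (\<bar>C\<bar> + 1) * (t i - s i)" .
    qed
    also have "\<dots> = (\<bar>C\<bar> + 1) * (\<Sum>i<n. t i - s i)" by (simp add: sum_distrib_left)
    also have "\<dots> < e" using A by (simp add: field_simps)
    finally show "(\<Sum>i<n. norm (\<gamma> (t i) - \<gamma> (s i))) < e" .
  qed
qed

lemma abs_cont_on_add:
  fixes f g :: "real \<Rightarrow> 'a::real_normed_vector"
  assumes "abs_cont_on a b f" "abs_cont_on a b g"
  shows "abs_cont_on a b (\<lambda>s. f s + g s)"
  unfolding abs_cont_on_def
proof (intro allI impI)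
  fix e :: real assume "e > 0"
  then have "e/2 > 0" by simp
  obtain d1 where d1: "d1 > 0" "\<And>(n::nat) s t.
      (\<forall>i<n. a \<le> s i \<and> s i \<le> t i \<and> t i \<le> b) \<Longrightarrow> (\<forall>i<n. \<forall>j<n. i < j \<longrightarrow> t i \<le> s j) \<Longrightarrow>
      (\<Sum>i<n. t i - s i) < d1 \<Longrightarrow> (\<Sum>i<n. norm (f (t i) - f (s i))) < e/2"
    by (rule abs_cont_onE[OF assms(1) \<open>e/2 > 0\<close>]) (rule that)
  obtain d2 where d2: "d2 > 0" "\<And>(n::nat) s t.
      (\<forall>i<n. a \<le> s i \<and> s i \<le> t i \<and> t i \<le> b) \<Longrightarrow> (\<forall>i<n. \<forall>j<n. i < j \<longrightarrow> t i \<le> s j) \<Longrightarrow>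
      (\<Sum>i<n. t i - s i) < d2 \<Longrightarrow> (\<Sum>i<n. norm (g (t i) - g (s i))) < e/2"
    by (rule abs_cont_onE[OF assms(2) \<open>e/2 > 0\<close>]) (rule that)
  show "\<exists>d>0. \<forall>(n::nat) (s::nat\<Rightarrow>real) t.
      (\<forall>i<n. a \<le> s i \<and> s i \<le> t i \<and> t i \<le> b) \<and> (\<forall>i<n. \<forall>j<n. i < j \<longrightarrow> t i \<le> s j) \<and>
      (\<Sum>i<n. t i - s i) < d \<longrightarrow> (\<Sum>i<n. norm ((f (t i) + g (t i)) - (f (s i) + g (s i)))) < e"
  proof (intro exI[of _ "min d1 d2"] conjI allI impI)
    show "min d1 d2 > 0" using d1 d2 by simp
    fix n :: nat and s t :: "nat \<Rightarrow> real"
    assume A: "(\<forall>i<n. a \<le> s i \<and> s i \<le> t i \<and> t i \<le> b) \<and> (\<forall>i<n. \<forall>j<n. i < j \<longrightarrow> t i \<le> s j) \<and>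
      (\<Sum>i<n. t i - s i) < min d1 d2"
    have "(\<Sum>i<n. norm ((f (t i) + g (t i)) - (f (s i) + g (s i))))
        \<le> (\<Sum>i<n. norm (f (t i) - f (s i)) + norm (g (t i) - g (s i)))"
      by (intro sum_mono) (simp add: add_diff_add norm_triangle_ineq)
    also have "\<dots> = (\<Sum>i<n. norm (f (t i) - f (s i))) + (\<Sum>i<n. norm (g (t i) - g (s i)))"
      by (rule sum.distrib)
    also have "\<dots> < e" using d1(2)[of n s t] d2(2)[of n s t] A by auto
    finally show "(\<Sum>i<n. norm ((f (t i) + g (t i)) - (f (s i) + g (s i)))) < e" .
  qed
qed

text \<open>A monotone \<phi> with increments at most those of the identity sends ordered families
  to ordered families of no larger total length. The uses are restriction to a subinterval (\<phi>
  the identity) and stopping or delaying a curve at a given time (\<phi> a minimum or maximum with a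
  constant).\<close>

lemma abs_cont_on_compose:
  fixes f :: "real \<Rightarrow> 'a::real_normed_vector" and \<phi> :: "real \<Rightarrow> real"
  assumes "abs_cont_on a b f"
    and \<phi>: "\<And>s t. a' \<le> s \<Longrightarrow> s \<le> t \<Longrightarrow> t \<le> b' \<Longrightarrow> a \<le> \<phi> s \<and> \<phi> s \<le> \<phi> t \<and> \<phi> t \<le> b \<and> \<phi> t - \<phi> s \<le> t - s"
  shows "abs_cont_on a' b' (\<lambda>s. f (\<phi> s))"
  unfolding abs_cont_on_def
proof (intro allI impI)
  fix e :: real assume "e > 0"
  obtain d where d: "d > 0" "\<And>(n::nat) s t.
      (\<forall>i<n. a \<le> s i \<and> s i \<le> t i \<and> t i \<le> b) \<Longrightarrow> (\<forall>i<n. \<forall>j<n. i < j \<longrightarrow> t i \<le> s j) \<Longrightarrow>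
      (\<Sum>i<n. t i - s i) < d \<Longrightarrow> (\<Sum>i<n. norm (f (t i) - f (s i))) < e"
    by (rule abs_cont_onE[OF assms(1) \<open>e > 0\<close>]) (rule that)
  show "\<exists>d>0. \<forall>(n::nat) (s::nat\<Rightarrow>real) t.
      (\<forall>i<n. a' \<le> s i \<and> s i \<le> t i \<and> t i \<le> b') \<and> (\<forall>i<n. \<forall>j<n. i < j \<longrightarrow> t i \<le> s j) \<and>
      (\<Sum>i<n. t i - s i) < d \<longrightarrow> (\<Sum>i<n. norm (f (\<phi> (t i)) - f (\<phi> (s i)))) < e"
  proof (intro exI[of _ d] conjI allI impI d(1) d(2))
    fix n :: nat and s t :: "nat \<Rightarrow> real" and i j
    assume A: "(\<forall>i<n. a' \<le> s i \<and> s i \<le> t i \<and> t i \<le> b') \<and> (\<forall>i<n. \<forall>j<n. i < j \<longrightarrow> t i \<le> s j) \<and>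
      (\<Sum>i<n. t i - s i) < d"
    show "a \<le> \<phi> (s i)" "\<phi> (s i) \<le> \<phi> (t i)" "\<phi> (t i) \<le> b" if "i < n"
      using \<phi>[of "s i" "t i"] A that by auto
    have "(\<Sum>i<n. \<phi> (t i) - \<phi> (s i)) \<le> (\<Sum>i<n. t i - s i)"
      using \<phi> A by (intro sum_mono) auto
    then show "(\<Sum>i<n. \<phi> (t i) - \<phi> (s i)) < d" using A by simp
    show "\<phi> (t i) \<le> \<phi> (s j)" if "i < n" "j < n" "i < j"
    proof -
      have "a' \<le> t i" "t i \<le> s j" "s j \<le> b'" using A that by (meson order_trans)+
      then show ?thesis using \<phi> by blast
    qed
  qed
qed

lemma abs_cont_on_imp_continuous_on:
  fixes f :: "real \<Rightarrow> 'a::real_normed_vector"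
  assumes "abs_cont_on a b f"
  shows "continuous_on {a..b} f"
  unfolding continuous_on_iff
proof (intro ballI allI impI)
  fix x e :: real assume x: "x \<in> {a..b}" and "e > 0"
  obtain d where d: "d > 0" "\<And>(n::nat) s t.
      (\<forall>i<n. a \<le> s i \<and> s i \<le> t i \<and> t i \<le> b) \<Longrightarrow> (\<forall>i<n. \<forall>j<n. i < j \<longrightarrow> t i \<le> s j) \<Longrightarrow>
      (\<Sum>i<n. t i - s i) < d \<Longrightarrow> (\<Sum>i<n. norm (f (t i) - f (s i))) < e"
    by (rule abs_cont_onE[OF assms(1) \<open>e > 0\<close>]) (rule that)
  have "dist (f y) (f x) < e" if "y \<in> {a..b}" "dist y x < d" for y
    using d(2)[of 1 "\<lambda>_. min x y" "\<lambda>_. max x y"] x that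
    by (cases "x \<le> y") (auto simp: dist_norm norm_minus_commute)
  then show "\<exists>d>0. \<forall>x'\<in>{a..b}. dist x' x < d \<longrightarrow> dist (f x') (f x) < e"
    using d(1) by blast
qed

lemma abs_cont_on_inner:
  fixes f :: "real \<Rightarrow> 'a::real_inner"
  assumes "abs_cont_on a b f"
  shows "abs_cont_on a b (\<lambda>s. q \<bullet> f s)"
  unfolding abs_cont_on_def
proof (intro allI impI)
  fix e :: real assume "e > 0"
  then have e': "e / (norm q + 1) > 0" by (simp add: add_nonneg_pos)
  obtain d where d: "d > 0" "\<And>(n::nat) s t.
      (\<forall>i<n. a \<le> s i \<and> s i \<le> t i \<and> t i \<le> b) \<Longrightarrow> (\<forall>i<n. \<forall>j<n. i < j \<longrightarrow> t i \<le> s j) \<Longrightarrow>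
      (\<Sum>i<n. t i - s i) < d \<Longrightarrow> (\<Sum>i<n. norm (f (t i) - f (s i))) < e / (norm q + 1)"
    by (rule abs_cont_onE[OF assms(1) e']) (rule that)
  show "\<exists>d>0. \<forall>(n::nat) (s::nat\<Rightarrow>real) t.
      (\<forall>i<n. a \<le> s i \<and> s i \<le> t i \<and> t i \<le> b) \<and> (\<forall>i<n. \<forall>j<n. i < j \<longrightarrow> t i \<le> s j) \<and>
      (\<Sum>i<n. t i - s i) < d \<longrightarrow> (\<Sum>i<n. norm (q \<bullet> f (t i) - q \<bullet> f (s i))) < e"
  proof (intro exI[of _ d] conjI allI impI d(1))
    fix n :: nat and s t :: "nat \<Rightarrow> real"
    assume A: "(\<forall>i<n. a \<le> s i \<and> s i \<le> t i \<and> t i \<le> b) \<and> (\<forall>i<n. \<forall>j<n. i < j \<longrightarrow> t i \<le> s j) \<and>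
      (\<Sum>i<n. t i - s i) < d"
    have "(\<Sum>i<n. norm (q \<bullet> f (t i) - q \<bullet> f (s i))) \<le> (\<Sum>i<n. (norm q + 1) * norm (f (t i) - f (s i)))"
    proof (rule sum_mono)
      fix i
      have "norm (q \<bullet> f (t i) - q \<bullet> f (s i)) \<le> norm q * norm (f (t i) - f (s i))"
        by (metis Cauchy_Schwarz_ineq2 inner_diff_right real_norm_def)
      also have "\<dots> \<le> (norm q + 1) * norm (f (t i) - f (s i))" by (intro mult_right_mono) auto
      finally show "norm (q \<bullet> f (t i) - q \<bullet> f (s i)) \<le> (norm q + 1) * norm (f (t i) - f (s i))" .
    qed
    also have "\<dots> = (norm q + 1) * (\<Sum>i<n. norm (f (t i) - f (s i)))" by (simp add: sum_distrib_left)
    also have "\<dots> < (norm q + 1) * (e / (norm q + 1))"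
      using d(2)[of n s t] A by (intro mult_strict_left_mono) (auto simp: add_nonneg_pos)
    also have "\<dots> = e" using norm_ge_zero[of q] by (simp add: add_nonneg_eq_0_iff)
    finally show "(\<Sum>i<n. norm (q \<bullet> f (t i) - q \<bullet> f (s i))) < e" .
  qed
qed

lemma division_sum_telescope:
  fixes f :: "real \<Rightarrow> 'a::real_normed_vector"
  assumes "a \<le> b" "q division_of {a..b}"
  shows "(\<Sum>K\<in>q. f (Sup K) - f (Inf K)) = f b - f a"
proof -
  \<comment> \<open>Each cell is tagged with its own left endpoint, because telescoping is available
    for tagged divisions.\<close>
  let ?p = "(\<lambda>K. (Inf K, K)) ` q"
  have K: "\<exists>u v. K = cbox u v" "K \<noteq> {}" if "K \<in> q" for K
    using division_ofD(3,4)[OF assms(2) that] by blast+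
  have InfK: "Inf K \<in> K" if "K \<in> q" for K
    using K[OF that] by auto
  have "?p tagged_division_of {a..b}"
    unfolding tagged_division_of
  proof (intro conjI allI impI)
    show "finite ?p" using assms(2) by blast
    show "x \<in> K" "K \<subseteq> {a..b}" "\<exists>u v. K = cbox u v" if "(x, K) \<in> ?p" for x K
      using that InfK division_ofD(2,4)[OF assms(2)] by auto
    show "interior K1 \<inter> interior K2 = {}" if "(x1, K1) \<in> ?p \<and> (x2, K2) \<in> ?p \<and> (x1, K1) \<noteq> (x2, K2)" for x1 K1 x2 K2
      using that division_ofD(5)[OF assms(2), of K1 K2] by blast
    have "{K. \<exists>x. (x, K) \<in> ?p} = q" by auto
    then show "\<Union>{K. \<exists>x. (x, K) \<in> ?p} = {a..b}" using division_ofD(6)[OF assms(2)] by simp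
  qed
  then have "(\<Sum>(x,K)\<in>?p. f (Sup K) - f (Inf K)) = f b - f a"
    using additive_tagged_division_1[OF assms(1)] by blast
  moreover have "(\<Sum>(x,K)\<in>?p. f (Sup K) - f (Inf K)) = (\<Sum>K\<in>q. f (Sup K) - f (Inf K))"
    by (subst sum.reindex) (auto simp: inj_on_def)
  ultimately show ?thesis by simp
qed

section \<open>Finite disjoint families of intervals and the Vitali covering theorem\<close>

lemma measure_disjoint_intervals:
  fixes D :: "(real \<times> real) set"
  assumes "finite D" "\<And>i. i \<in> D \<Longrightarrow> fst i \<le> snd i"
    "\<And>i j. i \<in> D \<Longrightarrow> j \<in> D \<Longrightarrow> i \<noteq> j \<Longrightarrow> {fst i..snd i} \<inter> {fst j..snd j} = {}"
  shows "(\<Union>i\<in>D. {fst i..snd i}) \<in> lmeasurable"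
    "measure lebesgue (\<Union>i\<in>D. {fst i..snd i}) = (\<Sum>i\<in>D. snd i - fst i)"
proof -
  show "(\<Union>i\<in>D. {fst i..snd i}) \<in> lmeasurable"
    using assms(1) by (intro fmeasurable.finite_UN) auto
  have "measure lebesgue (\<Union>i\<in>D. {fst i..snd i}) = (\<Sum>i\<in>D. measure lebesgue {fst i..snd i})"
    using assms by (intro measure_UNION') (auto simp: pairwise_def disjnt_def)
  also have "\<dots> = (\<Sum>i\<in>D. snd i - fst i)"
    using assms(2) by (intro sum.cong) auto
  finally show "measure lebesgue (\<Union>i\<in>D. {fst i..snd i}) = (\<Sum>i\<in>D. snd i - fst i)" .
qed

text \<open>The Vitali theorem yields countably many disjoint intervals that miss only a null part
  of E; continuity of the measure along the decreasing tails leaves finitely many, at the price of a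
  set of measure below e. Both losses go into B, so that E itself, whose measurability is not given,
  is covered exactly. The set W keeps the total length of the selected intervals under
  control.\<close>

lemma Vitali_finite_intervals:
  fixes E W :: "real set"
  assumes W: "open W" "bounded W" "E \<subseteq> W"
    and fine: "\<And>x d. x \<in> E \<Longrightarrow> d > 0 \<Longrightarrow> \<exists>\<alpha> \<beta>. \<alpha> < \<beta> \<and> \<beta> - \<alpha> < d \<and> x \<in> {\<alpha>..\<beta>} \<and> P \<alpha> \<beta>"
    and "e > 0"
  obtains D B where "finite D"
    "\<forall>i\<in>D. fst i < snd i \<and> {fst i..snd i} \<subseteq> W \<and> P (fst i) (snd i)"
    "\<forall>i\<in>D. \<forall>j\<in>D. i \<noteq> j \<longrightarrow> {fst i..snd i} \<inter> {fst j..snd j} = {}"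
    "B \<in> lmeasurable" "measure lebesgue B < e" "E \<subseteq> B \<union> (\<Union>i\<in>D. {fst i..snd i})"
proof -
  define K where "K = {i::real \<times> real. fst i < snd i \<and> {fst i..snd i} \<subseteq> W \<and> P (fst i) (snd i)}"
  define c where "c = (\<lambda>i::real \<times> real. (fst i + snd i) / 2)"
  define r where "r = (\<lambda>i::real \<times> real. (snd i - fst i) / 2)"
  have cb: "cball (c i) (r i) = {fst i..snd i}" for i
    unfolding cball_eq_atLeastAtMost c_def r_def by (simp add: field_simps)
  have Kfine: "\<exists>i. i \<in> K \<and> x \<in> cball (c i) (r i) \<and> r i < d" if x: "x \<in> E" and "d > 0" for x d
  proof -
    obtain \<rho> where "\<rho> > 0" "ball x \<rho> \<subseteq> W" using openE[OF W(1), of x] W(3) x by blast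
    obtain \<alpha> \<beta> where ab: "\<alpha> < \<beta>" "\<beta> - \<alpha> < min d \<rho>" "x \<in> {\<alpha>..\<beta>}" "P \<alpha> \<beta>"
      using fine[OF x, of "min d \<rho>"] \<open>\<rho> > 0\<close> \<open>d > 0\<close> by auto
    then have "{\<alpha>..\<beta>} \<subseteq> ball x \<rho>" by (auto simp: dist_real_def)
    then have "(\<alpha>, \<beta>) \<in> K" using ab \<open>ball x \<rho> \<subseteq> W\<close> by (auto simp: K_def)
    moreover have "x \<in> cball (c (\<alpha>, \<beta>)) (r (\<alpha>, \<beta>))" using ab unfolding cb by simp
    moreover have "r (\<alpha>, \<beta>) < d" using ab by (simp add: r_def)
    ultimately show ?thesis by blast
  qed
  obtain C where C: "countable C" "C \<subseteq> K"
    "pairwise (\<lambda>i j. disjnt (cball (c i) (r i)) (cball (c j) (r j))) C"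
    "negligible (E - (\<Union>i\<in>C. cball (c i) (r i)))"
    by (rule Vitali_covering_theorem_cballs[of K r E c]) (use Kfine in \<open>auto simp: K_def r_def\<close>)
  note C = C[unfolded cb]
  let ?A = "\<lambda>i::real \<times> real. {fst i..snd i}"
  have "W \<in> lmeasurable" using W by (simp add: lmeasurable_open)
  have "(\<Union>i\<in>C. ?A i) \<subseteq> W" using C(2) by (auto simp: K_def)
  have UCs: "(\<Union>i\<in>C. ?A i) \<in> sets lebesgue" using C(1) by (intro sets.countable_UN') auto
  have UC: "(\<Union>i\<in>C. ?A i) \<in> lmeasurable"
    using fmeasurableI2[OF \<open>W \<in> lmeasurable\<close> \<open>(\<Union>i\<in>C. ?A i) \<subseteq> W\<close> UCs] .
  have "\<exists>D. finite D \<and> D \<subseteq> C \<and> measure lebesgue ((\<Union>i\<in>C. ?A i) - (\<Union>i\<in>D. ?A i)) < e"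
  proof (cases "C = {}")
    case True
    then show ?thesis using \<open>e > 0\<close> by (intro exI[of _ "{}"]) auto
  next
    case False
    define g where "g = from_nat_into C"
    have rg: "range g = C" using C(1) False by (simp add: g_def range_from_nat_into)
    define T where "T n = (\<Union>i\<in>C. ?A i) - (\<Union>i\<in>g ` {..<n}. ?A i)" for n :: nat
    have sT: "T n \<in> sets lebesgue" for n
      unfolding T_def by (intro sets.Diff[OF UCs] sets.countable_UN') auto
    have "(\<lambda>n. measure lebesgue (T n)) \<longlonglongrightarrow> measure lebesgue (\<Inter>n. T n)"
    proof (rule Lim_measure_decseq)
      show "range T \<subseteq> sets lebesgue" using sT by auto
      show "decseq T" by (auto simp: T_def decseq_def)
      show "emeasure lebesgue (T i) \<noteq> \<infinity>" for i
      proof -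
        have "T i \<in> lmeasurable" by (rule fmeasurableI2[OF UC _ sT]) (auto simp: T_def)
        then show ?thesis by (auto simp: fmeasurable_def)
      qed
    qed
    moreover have "(\<Inter>n. T n) = {}"
    proof -
      have False if x: "x \<in> (\<Inter>n. T n)" for x
      proof -
        obtain i where "i \<in> C" "x \<in> ?A i" using x unfolding T_def by blast
        moreover obtain k where "i = g k" using \<open>i \<in> C\<close> rg by blast
        ultimately have "x \<notin> T (Suc k)" unfolding T_def by auto
        then show False using x by blast
      qed
      then show ?thesis by blast
    qed
    ultimately have "(\<lambda>n. measure lebesgue (T n)) \<longlonglongrightarrow> 0" by simp
    then have "eventually (\<lambda>n. measure lebesgue (T n) < e) sequentially"
      using \<open>e > 0\<close> by (auto dest: order_tendstoD)
    then obtain n where "measure lebesgue (T n) < e" by (auto simp: eventually_sequentially)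
    then show ?thesis using rg by (intro exI[of _ "g ` {..<n}"]) (auto simp: T_def)
  qed
  then obtain D where D: "finite D" "D \<subseteq> C" "measure lebesgue ((\<Union>i\<in>C. ?A i) - (\<Union>i\<in>D. ?A i)) < e" by blast
  define B where "B = (E - (\<Union>i\<in>C. ?A i)) \<union> ((\<Union>i\<in>C. ?A i) - (\<Union>i\<in>D. ?A i))"
  have UD: "(\<Union>i\<in>C. ?A i) - (\<Union>i\<in>D. ?A i) \<in> lmeasurable"
    using D(1) by (intro fmeasurable.Diff[OF UC] fmeasurable.finite_UN) auto
  show thesis
  proof (rule that)
    show "finite D" by fact
    show "\<forall>i\<in>D. fst i < snd i \<and> ?A i \<subseteq> W \<and> P (fst i) (snd i)"
      using D(2) C(2) by (auto simp: K_def)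
    show "\<forall>i\<in>D. \<forall>j\<in>D. i \<noteq> j \<longrightarrow> ?A i \<inter> ?A j = {}"
      using C(3) D(2) unfolding pairwise_def disjnt_def by blast
    show "B \<in> lmeasurable" unfolding B_def
      by (intro fmeasurable.Un negligible_imp_measurable[OF C(4)] UD)
    have "measure lebesgue B \<le> measure lebesgue (E - (\<Union>i\<in>C. ?A i)) + measure lebesgue ((\<Union>i\<in>C. ?A i) - (\<Union>i\<in>D. ?A i))"
      unfolding B_def using C(4) UD by (intro measure_Un_le) (auto simp: negligible_imp_sets fmeasurableD)
    then show "measure lebesgue B < e" using C(4) D(3) by (simp add: negligible_imp_measure0)
    show "E \<subseteq> B \<union> (\<Union>i\<in>D. ?A i)" unfolding B_def by auto
  qed
qed

text \<open>If E had outer measure w > 0, disjoint intervals on which f falls with slope below - c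
  would fill E almost exactly, and disjoint intervals inside them on which f rises with slope above
  c would fill E almost exactly again. The gaps then have arbitrarily small total length, while f
  falls across them by a fixed multiple of c * w, against absolute continuity.\<close>

lemma abs_cont_on_oscillation_negligible:
  fixes f :: "real \<Rightarrow> real"
  assumes ac: "abs_cont_on a b f" and "c > 0" and E: "E \<subseteq> {a<..<b}"
    and lo: "\<And>x d. x \<in> E \<Longrightarrow> d > 0 \<Longrightarrow> \<exists>\<alpha> \<beta>. \<alpha> < \<beta> \<and> \<beta> - \<alpha> < d \<and> x \<in> {\<alpha>..\<beta>} \<and> f \<beta> - f \<alpha> < - c * (\<beta> - \<alpha>)"
    and hi: "\<And>x d. x \<in> E \<Longrightarrow> d > 0 \<Longrightarrow> \<exists>\<alpha> \<beta>. \<alpha> < \<beta> \<and> \<beta> - \<alpha> < d \<and> x \<in> {\<alpha>..\<beta>} \<and> f \<beta> - f \<alpha> > c * (\<beta> - \<alpha>)"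
  shows "negligible E"
proof -
  let ?A = "\<lambda>i::real \<times> real. {fst i..snd i}"
  let ?\<mu> = "measure lebesgue :: real set \<Rightarrow> real"
  \<comment> \<open>V collects the measures of measurable supersets, so its infimum w is the outer
    measure of E.\<close>
  define V where "V = ?\<mu> ` {B. B \<in> lmeasurable \<and> E \<subseteq> B}"
  define w where "w = Inf V"
  have "{a<..<b} \<in> lmeasurable" by (simp add: lmeasurable_open)
  then have "V \<noteq> {}" using E by (auto simp: V_def)
  have bdd: "bdd_below V" by (auto simp: V_def intro!: bdd_belowI2[of _ 0])
  have w_le: "w \<le> ?\<mu> B" if "B \<in> lmeasurable" "E \<subseteq> B" for B
    unfolding w_def by (rule cInf_lower[OF _ bdd]) (use that in \<open>auto simp: V_def\<close>)
  have "w = 0"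
  proof (rule ccontr)
    assume "w \<noteq> 0"
    moreover have "w \<ge> 0" unfolding w_def using \<open>V \<noteq> {}\<close> by (intro cInf_greatest) (auto simp: V_def)
    ultimately have "w > 0" by simp
    then have "c * w / 2 > 0" using \<open>c > 0\<close> by simp
    obtain d0 where "d0 > 0" and d0: "\<forall>(I::((real \<times> real) \<times> real set) set) \<alpha> \<beta>.
       finite I \<and> (\<forall>i\<in>I. a \<le> \<alpha> i \<and> \<alpha> i \<le> \<beta> i \<and> \<beta> i \<le> b) \<and>
       (\<forall>i\<in>I. \<forall>j\<in>I. i \<noteq> j \<longrightarrow> {\<alpha> i<..<\<beta> i} \<inter> {\<alpha> j<..<\<beta> j} = {}) \<and>
       (\<Sum>i\<in>I. \<beta> i - \<alpha> i) < d0 \<longrightarrow> (\<Sum>i\<in>I. norm (f (\<beta> i) - f (\<alpha> i))) < c * w / 2"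
      by (rule abs_cont_on_family[OF ac \<open>c * w / 2 > 0\<close>]) (rule that)
    \<comment> \<open>With \<delta> \<le> d0 / 4 the gaps, of total length below 3 * \<delta>, fall
      within the scale of absolute continuity; with \<delta> \<le> w / 8 the rising intervals keep a
      total length above w / 2.\<close>
    define \<delta> where "\<delta> = min (d0 / 4) (w / 8)"
    have "\<delta> > 0" "4 * \<delta> \<le> d0" "8 * \<delta> \<le> w" using \<open>d0 > 0\<close> \<open>w > 0\<close> by (auto simp: \<delta>_def)
    obtain B0 where B0: "B0 \<in> lmeasurable" "E \<subseteq> B0" "?\<mu> B0 < w + \<delta> / 2"
      using cInf_less_iff[OF \<open>V \<noteq> {}\<close> bdd, of "w + \<delta>/2"] \<open>\<delta> > 0\<close> by (auto simp: w_def V_def)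
    obtain W0 where W0: "open W0" "B0 \<subseteq> W0" "W0 - B0 \<in> lmeasurable" "emeasure lebesgue (W0 - B0) < ennreal (\<delta>/2)"
      using sets_lebesgue_outer_open[of B0 "\<delta>/2"] B0(1) \<open>\<delta> > 0\<close> by (auto simp: fmeasurableD)
    define W where "W = W0 \<inter> {a<..<b}"
    have W: "open W" "bounded W" "E \<subseteq> W"
      using W0 B0 E by (auto simp: W_def intro: bounded_subset[of "{a..b}"])
    have mW: "W \<in> lmeasurable" using W by (simp add: lmeasurable_open)
    have "?\<mu> (W0 - B0) < \<delta> / 2"
      using W0(3,4) \<open>\<delta> > 0\<close> by (simp add: emeasure_eq_measure2 ennreal_less_iff)
    have "?\<mu> W \<le> ?\<mu> (B0 \<union> (W0 - B0))"
      using B0 W0 mW by (intro measure_mono_fmeasurable fmeasurable.Un) (auto simp: W_def fmeasurableD)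
    also have "\<dots> \<le> ?\<mu> B0 + ?\<mu> (W0 - B0)" using B0 W0 by (intro measure_Un_le) (auto simp: fmeasurableD)
    finally have mW_less: "?\<mu> W < w + \<delta>" using \<open>?\<mu> (W0 - B0) < \<delta> / 2\<close> B0(3) by simp

    obtain D1 B1 where D1: "finite D1"
      "\<forall>i\<in>D1. fst i < snd i \<and> ?A i \<subseteq> W \<and> f (snd i) - f (fst i) < - c * (snd i - fst i)"
      "\<forall>i\<in>D1. \<forall>j\<in>D1. i \<noteq> j \<longrightarrow> ?A i \<inter> ?A j = {}"
      "B1 \<in> lmeasurable" "?\<mu> B1 < \<delta>" "E \<subseteq> B1 \<union> (\<Union>i\<in>D1. ?A i)"
      by (rule Vitali_finite_intervals[where E=E and W=W and e=\<delta> and P="\<lambda>\<alpha> \<beta>. f \<beta> - f \<alpha> < - c * (\<beta> - \<alpha>)"])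
        (rule W lo \<open>\<delta> > 0\<close> that | assumption)+
    note D1 = D1(1) D1(2,3)[rule_format] D1(4-6)
    \<comment> \<open>Interiors are taken so that a short rising interval around a point of E stays
      inside one falling interval. The endpoints lost in this way form the finite set
      \<open>F\<close> below, which is null.\<close>
    define W' where "W' = (\<Union>i\<in>D1. {fst i<..<snd i})"
    have W'W: "W' \<subseteq> W"
    proof
      fix y assume "y \<in> W'"
      then obtain i where "i \<in> D1" "y \<in> ?A i" by (auto simp: W'_def)
      then show "y \<in> W" using D1(2) by blast
    qed
    have W': "open W'" "bounded W'" using W'W W(2) by (auto simp: W'_def intro: bounded_subset)
    let ?P2 = "\<lambda>\<alpha> \<beta>. f \<beta> - f \<alpha> > c * (\<beta> - \<alpha>) \<and> (\<exists>i\<in>D1. {\<alpha>..\<beta>} \<subseteq> ?A i)"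
    have fine2: "\<exists>\<alpha> \<beta>. \<alpha> < \<beta> \<and> \<beta> - \<alpha> < d \<and> x \<in> {\<alpha>..\<beta>} \<and> ?P2 \<alpha> \<beta>" if x: "x \<in> E \<inter> W'" and "d > 0" for x d
    proof -
      obtain i where i: "i \<in> D1" "fst i < x" "x < snd i" using x by (auto simp: W'_def)
      then have "min d (min (x - fst i) (snd i - x)) > 0" using \<open>d > 0\<close> by simp
      then obtain \<alpha> \<beta> where *: "\<alpha> < \<beta>" "\<beta> - \<alpha> < min d (min (x - fst i) (snd i - x))" "x \<in> {\<alpha>..\<beta>}" "f \<beta> - f \<alpha> > c * (\<beta> - \<alpha>)"
        using hi[of x "min d (min (x - fst i) (snd i - x))"] x by blast
      moreover have "{\<alpha>..\<beta>} \<subseteq> ?A i" using * by auto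
      ultimately show ?thesis using i(1) by (intro exI[of _ \<alpha>] exI[of _ \<beta>] conjI bexI[of _ i]) auto
    qed
    obtain D2 B2 where D2: "finite D2"
      "\<forall>i\<in>D2. fst i < snd i \<and> ?A i \<subseteq> W' \<and> ?P2 (fst i) (snd i)"
      "\<forall>i\<in>D2. \<forall>j\<in>D2. i \<noteq> j \<longrightarrow> ?A i \<inter> ?A j = {}"
      "B2 \<in> lmeasurable" "?\<mu> B2 < \<delta>" "E \<inter> W' \<subseteq> B2 \<union> (\<Union>i\<in>D2. ?A i)"
      by (rule Vitali_finite_intervals[where E="E \<inter> W'" and W=W' and e=\<delta> and P="?P2"])
        (rule W' Int_lower2 fine2 \<open>\<delta> > 0\<close> that | assumption)+
    note D2 = D2(1) D2(2,3)[rule_format] D2(4-6)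
    have le1: "\<And>i. i \<in> D1 \<Longrightarrow> fst i \<le> snd i" and le2: "\<And>i. i \<in> D2 \<Longrightarrow> fst i \<le> snd i"
      using D1(2) D2(2) by (simp_all add: less_imp_le)
    have m1: "(\<Union>i\<in>D1. ?A i) \<in> lmeasurable" "?\<mu> (\<Union>i\<in>D1. ?A i) = (\<Sum>i\<in>D1. snd i - fst i)"
      by (rule measure_disjoint_intervals[OF D1(1)]; use le1 D1(3) in blast)+
    have m2: "(\<Union>i\<in>D2. ?A i) \<in> lmeasurable" "?\<mu> (\<Union>i\<in>D2. ?A i) = (\<Sum>i\<in>D2. snd i - fst i)"
      by (rule measure_disjoint_intervals[OF D2(1)]; use le2 D2(3) in blast)+
    have len1: "(\<Sum>i\<in>D1. snd i - fst i) < w + \<delta>"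
    proof -
      have "?\<mu> (\<Union>i\<in>D1. ?A i) \<le> ?\<mu> W"
        using m1(1) mW D1(2) by (intro measure_mono_fmeasurable) (auto simp: fmeasurableD)
      then show ?thesis using m1(2) mW_less by simp
    qed
    have len2: "w - 2 * \<delta> < (\<Sum>i\<in>D2. snd i - fst i)"
    proof -
      define F where "F = fst ` D1 \<union> snd ` D1"
      have "finite F" using D1(1) by (simp add: F_def)
      then have negF: "negligible F" by (rule negligible_finite)
      have "E \<subseteq> (B1 \<union> F) \<union> (B2 \<union> (\<Union>i\<in>D2. ?A i))"
      proof
        fix y assume y: "y \<in> E"
        show "y \<in> (B1 \<union> F) \<union> (B2 \<union> (\<Union>i\<in>D2. ?A i))"
        proof (cases "y \<in> B1 \<or> y \<in> W'")
          case False
          then obtain i where "i \<in> D1" "y \<in> ?A i" using y D1(6) by blast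
          then have "y = fst i \<or> y = snd i" using False by (force simp: W'_def)
          then show ?thesis using \<open>i \<in> D1\<close> by (auto simp: F_def)
        qed (use D2(6) y in blast)
      qed
      moreover have "(B1 \<union> F) \<union> (B2 \<union> (\<Union>i\<in>D2. ?A i)) \<in> lmeasurable"
        by (intro fmeasurable.Un D1(4) D2(4) m2(1) negligible_imp_measurable[OF negF])
      ultimately have "w \<le> ?\<mu> ((B1 \<union> F) \<union> (B2 \<union> (\<Union>i\<in>D2. ?A i)))" by (intro w_le)
      also have "\<dots> \<le> ?\<mu> (B1 \<union> F) + ?\<mu> (B2 \<union> (\<Union>i\<in>D2. ?A i))"
        by (intro measure_Un_le fmeasurableD fmeasurable.Un D1(4) D2(4) m2(1) negligible_imp_measurable[OF negF])
      also have "\<dots> \<le> (?\<mu> B1 + ?\<mu> F) + (?\<mu> B2 + ?\<mu> (\<Union>i\<in>D2. ?A i))"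
        by (intro add_mono measure_Un_le fmeasurableD D1(4) D2(4) m2(1) negligible_imp_measurable[OF negF])
      finally show ?thesis using D1(5) D2(5) m2(2) negligible_imp_measure0[OF negF] by simp
    qed

    define J where "J i = {j\<in>D2. ?A j \<subseteq> ?A i}" for i
    have J_disj: "J i \<inter> J i' = {}" if "i \<in> D1" "i' \<in> D1" "i \<noteq> i'" for i i'
    proof -
      have False if "j \<in> J i" "j \<in> J i'" for j
      proof -
        have "fst j \<in> ?A j" using that le2 by (auto simp: J_def)
        then show False using that D1(3)[OF \<open>i \<in> D1\<close> \<open>i' \<in> D1\<close> \<open>i \<noteq> i'\<close>] by (auto simp: J_def)
      qed
      then show ?thesis by blast
    qed
    have D2_eq: "D2 = (\<Union>i\<in>D1. J i)" using D2(2) by (fastforce simp: J_def)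
    have finJ: "finite (J i)" for i using D2(1) by (simp add: J_def)
    have sum_D2: "(\<Sum>j\<in>D2. h j) = (\<Sum>i\<in>D1. \<Sum>j\<in>J i. h j)" for h :: "real \<times> real \<Rightarrow> real"
      unfolding D2_eq using D1(1) finJ J_disj by (intro sum.UNION_disjoint) auto
    \<comment> \<open>The rising intervals inside a falling one are completed to a division of it;
      the added cells \<open>q i - p i\<close> are the gaps.\<close>
    define p where "p i = ?A ` J i" for i
    have inj: "inj_on ?A (J i)" for i
    proof (rule inj_onI)
      fix j k assume "j \<in> J i" "k \<in> J i" "?A j = ?A k"
      then have "fst j \<le> snd j" "fst k \<le> snd k" using le2 by (auto simp: J_def)
      with \<open>?A j = ?A k\<close> show "j = k" by (simp add: Icc_eq_Icc prod_eq_iff)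
    qed
    have "\<exists>q. p i \<subseteq> q \<and> q division_of ?A i" if "i \<in> D1" for i
    proof -
      have "p i division_of \<Union>(p i)"
      proof (rule division_ofI)
        show "finite (p i)" using finJ by (simp add: p_def)
        show "\<And>K. K \<in> p i \<Longrightarrow> K \<noteq> {}" using le2 by (auto simp: p_def J_def)
        show "\<exists>a b. K = cbox a b" if "K \<in> p i" for K using that by (auto simp: p_def)
        show "interior K1 \<inter> interior K2 = {}" if K: "K1 \<in> p i" "K2 \<in> p i" "K1 \<noteq> K2" for K1 K2
        proof -
          obtain j k where "j \<in> D2" "k \<in> D2" "K1 = ?A j" "K2 = ?A k" using K by (auto simp: p_def J_def)
          moreover have "j \<noteq> k" using calculation K(3) by blast
          ultimately have "K1 \<inter> K2 = {}" using D2(3) by blast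
          then show ?thesis using interior_subset by blast
        qed
      qed auto
      moreover have "\<Union>(p i) \<subseteq> cbox (fst i) (snd i)" by (auto simp: p_def J_def)
      ultimately obtain q where "p i \<subseteq> q" "q division_of cbox (fst i) (snd i)"
        by (rule partial_division_extend_interval)
      then show ?thesis by auto
    qed
    then obtain q where q: "\<And>i. i \<in> D1 \<Longrightarrow> p i \<subseteq> q i" "\<And>i. i \<in> D1 \<Longrightarrow> q i division_of ?A i" by metis
    \<comment> \<open>The gaps left between the intervals of D2 inside those of D1: their total length is tiny,
      yet f must drop by about 2 c w over them.\<close>
    have gap_sum: "(\<Sum>K\<in>q i - p i. h (Sup K) - h (Inf K)) = (h (snd i) - h (fst i)) - (\<Sum>j\<in>J i. h (snd j) - h (fst j))"
      if "i \<in> D1" for i and h :: "real \<Rightarrow> real"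
    proof -
      have "finite (q i)" using q(2)[OF that] by blast
      then have "(\<Sum>K\<in>q i - p i. h (Sup K) - h (Inf K)) = (\<Sum>K\<in>q i. h (Sup K) - h (Inf K)) - (\<Sum>K\<in>p i. h (Sup K) - h (Inf K))"
        using q(1)[OF that] by (intro sum_diff)
      moreover have "(\<Sum>K\<in>p i. h (Sup K) - h (Inf K)) = (\<Sum>j\<in>J i. h (snd j) - h (fst j))"
        unfolding p_def using le2 by (subst sum.reindex[OF inj]) (auto simp: J_def intro!: sum.cong)
      moreover have "(\<Sum>K\<in>q i. h (Sup K) - h (Inf K)) = h (snd i) - h (fst i)"
        using division_sum_telescope[OF le1[OF that] q(2)[OF that]] .
      ultimately show ?thesis by simp
    qed
    define G where "G = Sigma D1 (\<lambda>i. q i - p i)"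
    have finq: "\<forall>i\<in>D1. finite (q i - p i)" using q(2) by blast
    have G_sum: "(\<Sum>g\<in>G. h (Sup (snd g)) - h (Inf (snd g))) =
        (\<Sum>i\<in>D1. h (snd i) - h (fst i)) - (\<Sum>j\<in>D2. h (snd j) - h (fst j))" for h :: "real \<Rightarrow> real"
    proof -
      have "(\<Sum>g\<in>G. h (Sup (snd g)) - h (Inf (snd g))) = (\<Sum>i\<in>D1. \<Sum>K\<in>q i - p i. h (Sup K) - h (Inf K))"
        unfolding G_def using D1(1) finq by (subst sum.Sigma) (auto simp: case_prod_unfold)
      also have "\<dots> = (\<Sum>i\<in>D1. (h (snd i) - h (fst i)) - (\<Sum>j\<in>J i. h (snd j) - h (fst j)))"
        by (intro sum.cong gap_sum refl)
      also have "\<dots> = (\<Sum>i\<in>D1. h (snd i) - h (fst i)) - (\<Sum>j\<in>D2. h (snd j) - h (fst j))"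
        by (simp add: sum_subtractf sum_D2)
      finally show ?thesis .
    qed
    have cell: "\<exists>u v. snd g = {u..v} \<and> u \<le> v" "snd g \<subseteq> ?A (fst g)" if "g \<in> G" for g
    proof -
      have "fst g \<in> D1" "snd g \<in> q (fst g)" using that by (auto simp: G_def)
      then have K: "snd g \<subseteq> ?A (fst g)" "snd g \<noteq> {}" "\<exists>u v. snd g = cbox u v"
        using division_ofD(2-4)[OF q(2)] by blast+
      then show "\<exists>u v. snd g = {u..v} \<and> u \<le> v" "snd g \<subseteq> ?A (fst g)" by auto
    qed
    have "(\<Sum>g\<in>G. norm (f (Sup (snd g)) - f (Inf (snd g)))) < c * w / 2"
    proof (rule d0[rule_format], intro conjI ballI impI)
      show "finite G" unfolding G_def using D1(1) finq by blast
      show "a \<le> Inf (snd g)" "Inf (snd g) \<le> Sup (snd g)" "Sup (snd g) \<le> b" if g: "g \<in> G" for g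
      proof -
        obtain u v where uv: "snd g = {u..v}" "u \<le> v" using cell(1)[OF g] by blast
        have "fst g \<in> D1" using g by (auto simp: G_def)
        then have "?A (fst g) \<subseteq> W" using D1(2) by blast
        then have "{u..v} \<subseteq> {a<..<b}" using cell(2)[OF g] uv(1) by (auto simp: W_def)
        then show "a \<le> Inf (snd g)" "Inf (snd g) \<le> Sup (snd g)" "Sup (snd g) \<le> b" using uv by auto
      qed
      show "{Inf (snd g)<..<Sup (snd g)} \<inter> {Inf (snd k)<..<Sup (snd k)} = {}" if gk: "g \<in> G" "k \<in> G" "g \<noteq> k" for g k
      proof -
        obtain u v where uv: "snd g = {u..v}" "u \<le> v" using cell(1)[OF gk(1)] by blast
        obtain u' v' where uv': "snd k = {u'..v'}" "u' \<le> v'" using cell(1)[OF gk(2)] by blast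
        have "{u<..<v} \<inter> {u'<..<v'} = {}"
        proof (cases "fst g = fst k")
          case True
          then have "snd g \<in> q (fst g)" "snd k \<in> q (fst g)" "snd g \<noteq> snd k" "fst g \<in> D1"
            using gk by (auto simp: G_def prod_eq_iff)
          then have "interior (snd g) \<inter> interior (snd k) = {}"
            using division_ofD(5)[OF q(2)] by blast
          then show ?thesis using uv uv' by (simp add: interior_atLeastAtMost_real)
        next
          case False
          then have "?A (fst g) \<inter> ?A (fst k) = {}" using gk by (intro D1(3)) (auto simp: G_def)
          then have "snd g \<inter> snd k = {}" using cell(2) gk by blast
          moreover have "{u<..<v} \<subseteq> snd g" "{u'<..<v'} \<subseteq> snd k" unfolding uv uv' by auto
          ultimately show ?thesis by blast
        qed
        then show ?thesis using uv uv' by simp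
      qed
      show "(\<Sum>g\<in>G. Sup (snd g) - Inf (snd g)) < d0"
        using G_sum[of "\<lambda>x. x"] len1 len2 \<open>4 * \<delta> \<le> d0\<close> \<open>\<delta> > 0\<close> by simp
    qed
    moreover have "- (\<Sum>g\<in>G. f (Sup (snd g)) - f (Inf (snd g))) \<le> (\<Sum>g\<in>G. norm (f (Sup (snd g)) - f (Inf (snd g))))"
      unfolding sum_negf[symmetric] by (intro sum_mono) auto
    moreover have "(\<Sum>i\<in>D1. f (snd i) - f (fst i)) \<le> (\<Sum>i\<in>D1. - c * (snd i - fst i))"
      using D1(2) by (intro sum_mono) (simp add: less_imp_le)
    then have "(\<Sum>i\<in>D1. f (snd i) - f (fst i)) \<le> - c * (\<Sum>i\<in>D1. snd i - fst i)" by (simp add: sum_distrib_left)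
    \<comment> \<open>From the falling intervals only the sign is used: the rise over D2, at least c
      * w / 2, already contradicts the bound on the gaps.\<close>
    moreover have "- c * (\<Sum>i\<in>D1. snd i - fst i) \<le> 0"
      using \<open>c > 0\<close> le1 by (simp add: sum_nonneg)
    moreover have "(\<Sum>i\<in>D2. c * (snd i - fst i)) \<le> (\<Sum>i\<in>D2. f (snd i) - f (fst i))"
      using D2(2) by (intro sum_mono) (simp add: less_imp_le)
    then have "c * (\<Sum>i\<in>D2. snd i - fst i) \<le> (\<Sum>i\<in>D2. f (snd i) - f (fst i))" by (simp add: sum_distrib_left)
    moreover have "c * (w / 2) \<le> c * (\<Sum>i\<in>D2. snd i - fst i)"
      using len2 \<open>8 * \<delta> \<le> w\<close> \<open>c > 0\<close> \<open>w > 0\<close> by (intro mult_left_mono) auto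
    ultimately show False using G_sum[of f] by simp
  qed
  have "\<exists>B\<in>lmeasurable. E \<subseteq> B \<and> ?\<mu> B < e" if "e > 0" for e
    using cInf_less_iff[OF \<open>V \<noteq> {}\<close> bdd, of e] that \<open>w = 0\<close> by (auto simp: w_def V_def)
  then show ?thesis unfolding negligible_iff_null_sets completion.null_sets_outer by blast
qed

section \<open>Difference quotients and differentiability almost everywhere\<close>

definition quot :: "(real \<Rightarrow> real) \<Rightarrow> real \<Rightarrow> real \<Rightarrow> real" where
  "quot f x y = (f y - f x) / (y - x)"

text \<open>The quotient is symmetric in its two points, so an increment of either sign becomes an
  interval that has x as an endpoint, the form in which coverings are built.\<close>

lemma quot_interval:
  assumes "x \<noteq> y"
  obtains \<alpha> \<beta> where "\<alpha> < \<beta>" "\<beta> - \<alpha> = \<bar>y - x\<bar>" "x \<in> {\<alpha>..\<beta>}" "\<And>f. f \<beta> - f \<alpha> = quot f x y * (\<beta> - \<alpha>)"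
proof (cases "x < y")
  case True
  then show thesis by (intro that[of x y]) (auto simp: quot_def)
next
  case False
  then show thesis using assms by (intro that[of y x]) (auto simp: quot_def field_simps)
qed

text \<open>Absolute continuity with bound 1 fixes a length d. Disjoint intervals inside a ball of
  radius d / 4 have total length at most d / 2, hence total increment below 1; if each is steeper
  than 2 / e, their total length is below e / 2. Countably many such balls cover the line.\<close>

lemma abs_cont_on_unbounded_quot_negligible:
  fixes f :: "real \<Rightarrow> real"
  assumes ac: "abs_cont_on a b f"
  shows "negligible {x\<in>{a<..<b}. \<forall>K. \<forall>d>0. \<exists>y. y \<noteq> x \<and> \<bar>y - x\<bar> < d \<and> \<bar>quot f x y\<bar> > K}" (is "negligible ?E")
proof -
  let ?A = "\<lambda>i::real \<times> real. {fst i..snd i}"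
  let ?\<mu> = "measure lebesgue :: real set \<Rightarrow> real"
  obtain d where "d > 0" and d: "\<forall>(I::(real \<times> real) set) \<alpha> \<beta>.
       finite I \<and> (\<forall>i\<in>I. a \<le> \<alpha> i \<and> \<alpha> i \<le> \<beta> i \<and> \<beta> i \<le> b) \<and>
       (\<forall>i\<in>I. \<forall>j\<in>I. i \<noteq> j \<longrightarrow> {\<alpha> i<..<\<beta> i} \<inter> {\<alpha> j<..<\<beta> j} = {}) \<and>
       (\<Sum>i\<in>I. \<beta> i - \<alpha> i) < d \<longrightarrow> (\<Sum>i\<in>I. norm (f (\<beta> i) - f (\<alpha> i))) < 1"
    by (rule abs_cont_on_family[OF ac zero_less_one]) (rule that)
  have "negligible (?E \<inter> ball z (d/4))" for z
    unfolding negligible_iff_null_sets completion.null_sets_outer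
  proof (intro allI impI)
    fix e :: real assume "e > 0"
    define W where "W = {a<..<b} \<inter> ball z (d/4)"
    have W: "open W" "bounded W" "?E \<inter> ball z (d/4) \<subseteq> W"
      by (auto simp: W_def)
    have mW: "W \<in> lmeasurable" using W by (simp add: lmeasurable_open)
    let ?P = "\<lambda>\<alpha> \<beta>. \<bar>f \<beta> - f \<alpha>\<bar> > 2 / e * (\<beta> - \<alpha>)"
    have fine: "\<exists>\<alpha> \<beta>. \<alpha> < \<beta> \<and> \<beta> - \<alpha> < r \<and> x \<in> {\<alpha>..\<beta>} \<and> ?P \<alpha> \<beta>" if x: "x \<in> ?E \<inter> ball z (d/4)" and "r > 0" for x r
    proof -
      have "\<forall>K. \<forall>d>0. \<exists>y. y \<noteq> x \<and> \<bar>y - x\<bar> < d \<and> \<bar>quot f x y\<bar> > K" using x by simp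
      from this[rule_format, OF \<open>r > 0\<close>, of "2 / e"]
      obtain y where "y \<noteq> x" and y: "\<bar>y - x\<bar> < r" "\<bar>quot f x y\<bar> > 2 / e" by auto
      obtain \<alpha> \<beta> where *: "\<alpha> < \<beta>" "\<beta> - \<alpha> = \<bar>y - x\<bar>" "x \<in> {\<alpha>..\<beta>}" "\<And>f. f \<beta> - f \<alpha> = quot f x y * (\<beta> - \<alpha>)"
        using quot_interval[OF \<open>y \<noteq> x\<close>[symmetric]] by blast
      have "\<bar>f \<beta> - f \<alpha>\<bar> = \<bar>quot f x y\<bar> * (\<beta> - \<alpha>)" using * by (simp add: abs_mult)
      also have "\<dots> > 2 / e * (\<beta> - \<alpha>)" using y(2) *(1) by (intro mult_strict_right_mono) auto
      finally show ?thesis using *(1-3) y by (intro exI[of _ \<alpha>] exI[of _ \<beta>]) simp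
    qed
    have "e / 2 > 0" using \<open>e > 0\<close> by simp
    obtain D B where D: "finite D"
      "\<forall>i\<in>D. fst i < snd i \<and> ?A i \<subseteq> W \<and> ?P (fst i) (snd i)"
      "\<forall>i\<in>D. \<forall>j\<in>D. i \<noteq> j \<longrightarrow> ?A i \<inter> ?A j = {}"
      "B \<in> lmeasurable" "?\<mu> B < e / 2" "?E \<inter> ball z (d/4) \<subseteq> B \<union> (\<Union>i\<in>D. ?A i)"
      by (rule Vitali_finite_intervals[where E="?E \<inter> ball z (d/4)" and W=W and e="e/2" and P="?P"])
        (rule W fine \<open>e / 2 > 0\<close> that | assumption)+
    have m: "(\<Union>i\<in>D. ?A i) \<in> lmeasurable" "?\<mu> (\<Union>i\<in>D. ?A i) = (\<Sum>i\<in>D. snd i - fst i)"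
      using measure_disjoint_intervals[OF D(1)] D(2,3) less_imp_le by blast+
    have Dab: "\<forall>i\<in>D. a \<le> fst i \<and> fst i \<le> snd i \<and> snd i \<le> b"
    proof
      fix i assume "i \<in> D"
      then have "?A i \<subseteq> {a<..<b}" "fst i < snd i" using D(2) by (auto simp: W_def)
      then show "a \<le> fst i \<and> fst i \<le> snd i \<and> snd i \<le> b"
        by (meson atLeastAtMost_iff greaterThanLessThan_iff less_imp_le order_refl subsetD)
    qed
    have "?\<mu> (\<Union>i\<in>D. ?A i) \<le> ?\<mu> (ball z (d/4))"
      using m(1) D(2) by (intro measure_mono_fmeasurable) (auto simp: fmeasurableD W_def)
    also have "\<dots> = d / 2" using \<open>d > 0\<close> by (simp add: ball_eq_greaterThanLessThan)
    finally have "(\<Sum>i\<in>D. snd i - fst i) < d" using m(2) \<open>d > 0\<close> by simp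
    moreover have "\<forall>i\<in>D. \<forall>j\<in>D. i \<noteq> j \<longrightarrow> {fst i<..<snd i} \<inter> {fst j<..<snd j} = {}"
      using D(3) by (fastforce simp: disjoint_iff)
    ultimately have "(\<Sum>i\<in>D. norm (f (snd i) - f (fst i))) < 1"
      using d[rule_format, of D fst snd] D(1) Dab by blast
    moreover have "2 / e * (\<Sum>i\<in>D. snd i - fst i) \<le> (\<Sum>i\<in>D. norm (f (snd i) - f (fst i)))"
      unfolding sum_distrib_left using D(2) by (intro sum_mono) (simp add: less_imp_le)
    ultimately have "2 / e * (\<Sum>i\<in>D. snd i - fst i) < 1" by linarith
    then have "(\<Sum>i\<in>D. snd i - fst i) < e / 2" using \<open>e > 0\<close> by (simp add: field_simps)
    moreover have "?\<mu> (B \<union> (\<Union>i\<in>D. ?A i)) \<le> ?\<mu> B + ?\<mu> (\<Union>i\<in>D. ?A i)"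
      by (intro measure_Un_le fmeasurableD D m)
    ultimately have "?\<mu> (B \<union> (\<Union>i\<in>D. ?A i)) < e" using D(5) m(2) by simp
    then show "\<exists>T\<in>lmeasurable. ?E \<inter> ball z (d/4) \<subseteq> T \<and> ?\<mu> T < e"
      using D(4,6) m(1) by blast
  qed
  then have "negligible (\<Union>k::int. ?E \<inter> ball (of_int k * (d/4)) (d/4))"
    by (intro negligible_countable_Union) auto
  moreover have "?E \<subseteq> (\<Union>k::int. ?E \<inter> ball (of_int k * (d/4)) (d/4))"
  proof
    fix x assume x: "x \<in> ?E"
    define k where "k = \<lfloor>x / (d/4)\<rfloor>"
    have "of_int k \<le> x / (d/4)" "x / (d/4) < of_int k + 1" unfolding k_def by linarith+
    then have "of_int k * (d/4) \<le> x" "x < of_int k * (d/4) + d/4" using \<open>d > 0\<close> by (simp_all add: field_simps)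
    then have "x \<in> ball (of_int k * (d/4)) (d/4)" by (simp add: dist_real_def)
    then show "x \<in> (\<Union>k::int. ?E \<inter> ball (of_int k * (d/4)) (d/4))" using x by blast
  qed
  ultimately show ?thesis by (rule negligible_subset)
qed

text \<open>Subtracting the linear function of mean slope (p + q) / 2 makes the gap symmetric:
  quotients below p and above q become quotients below - c and above c, with c = (q - p) /
  2.\<close>

lemma abs_cont_on_quot_oscillation_negligible:
  fixes f :: "real \<Rightarrow> real"
  assumes ac: "abs_cont_on a b f" and "p < q"
  shows "negligible {x\<in>{a<..<b}. (\<forall>d>0. \<exists>y. y \<noteq> x \<and> \<bar>y - x\<bar> < d \<and> quot f x y < p) \<and>
     (\<forall>d>0. \<exists>y. y \<noteq> x \<and> \<bar>y - x\<bar> < d \<and> quot f x y > q)}" (is "negligible ?E")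
proof (rule abs_cont_on_oscillation_negligible)
  let ?g = "\<lambda>s. f s + - ((p + q) / 2) * s"
  have "\<bar>- ((p + q) / 2) * t - - ((p + q) / 2) * s\<bar> \<le> \<bar>(p + q) / 2\<bar> * (t - s)" if "s \<le> t" for s t :: real
    using that by (simp only: right_diff_distrib[symmetric] abs_mult abs_minus_cancel)
  then show "abs_cont_on a b ?g"
    by (intro abs_cont_on_add ac abs_cont_on_lipschitz[of _ _ _ "\<bar>(p + q) / 2\<bar>"]) simp
  show "(q - p) / 2 > 0" using \<open>p < q\<close> by simp
  show "?E \<subseteq> {a<..<b}" by blast
  fix x d assume x: "x \<in> ?E" and "d > (0::real)"
  show "\<exists>\<alpha> \<beta>. \<alpha> < \<beta> \<and> \<beta> - \<alpha> < d \<and> x \<in> {\<alpha>..\<beta>} \<and> ?g \<beta> - ?g \<alpha> < - ((q - p) / 2) * (\<beta> - \<alpha>)"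
  proof -
    obtain y where "y \<noteq> x" and y: "\<bar>y - x\<bar> < d" "quot f x y < p" using x \<open>d > 0\<close> by blast
    obtain \<alpha> \<beta> where *: "\<alpha> < \<beta>" "\<beta> - \<alpha> = \<bar>y - x\<bar>" "x \<in> {\<alpha>..\<beta>}" "\<And>f. f \<beta> - f \<alpha> = quot f x y * (\<beta> - \<alpha>)"
      using quot_interval[OF \<open>y \<noteq> x\<close>[symmetric]] by blast
    have "f \<beta> - f \<alpha> < p * (\<beta> - \<alpha>)" using *(1,4) y(2) by simp
    then have "?g \<beta> - ?g \<alpha> < - ((q - p) / 2) * (\<beta> - \<alpha>)" by (simp add: field_simps)
    then show ?thesis using *(1-3) y by (intro exI[of _ \<alpha>] exI[of _ \<beta>]) simp
  qed
  show "\<exists>\<alpha> \<beta>. \<alpha> < \<beta> \<and> \<beta> - \<alpha> < d \<and> x \<in> {\<alpha>..\<beta>} \<and> ?g \<beta> - ?g \<alpha> > (q - p) / 2 * (\<beta> - \<alpha>)"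
  proof -
    obtain y where "y \<noteq> x" and y: "\<bar>y - x\<bar> < d" "quot f x y > q" using x \<open>d > 0\<close> by blast
    obtain \<alpha> \<beta> where *: "\<alpha> < \<beta>" "\<beta> - \<alpha> = \<bar>y - x\<bar>" "x \<in> {\<alpha>..\<beta>}" "\<And>f. f \<beta> - f \<alpha> = quot f x y * (\<beta> - \<alpha>)"
      using quot_interval[OF \<open>y \<noteq> x\<close>[symmetric]] by blast
    have "f \<beta> - f \<alpha> > q * (\<beta> - \<alpha>)" using *(1,4) y(2) by simp
    then have "?g \<beta> - ?g \<alpha> > (q - p) / 2 * (\<beta> - \<alpha>)" by (simp add: field_simps)
    then show ?thesis using *(1-3) y by (intro exI[of _ \<alpha>] exI[of _ \<beta>]) simp
  qed
qed

text \<open>Outside the null sets the quotients are bounded near the point, so their lower and upper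
  limits are finite. If these limits differed, two rationals strictly between them would put the
  point into one of countably many oscillation sets.\<close>

theorem abs_cont_on_differentiable_ae_real:
  fixes f :: "real \<Rightarrow> real"
  assumes ac: "abs_cont_on a b f"
  shows "negligible {x\<in>{a<..<b}. \<not> f differentiable (at x)}"
proof -
  define E0 where "E0 = {x\<in>{a<..<b}. \<forall>K. \<forall>d>0. \<exists>y. y \<noteq> x \<and> \<bar>y - x\<bar> < d \<and> \<bar>quot f x y\<bar> > K}"
  define E1 where "E1 p q = {x\<in>{a<..<b}. (\<forall>d>0. \<exists>y. y \<noteq> x \<and> \<bar>y - x\<bar> < d \<and> quot f x y < p) \<and>
     (\<forall>d>0. \<exists>y. y \<noteq> x \<and> \<bar>y - x\<bar> < d \<and> quot f x y > q)}" for p q :: real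
  define S where "S = {z::rat \<times> rat. fst z < snd z}"
  have "negligible (\<Union>z\<in>S. E1 (of_rat (fst z)) (of_rat (snd z)))"
    unfolding E1_def by (intro negligible_countable_Union countable_image abs_cont_on_quot_oscillation_negligible[OF ac] | force simp: S_def of_rat_less intro!: abs_cont_on_quot_oscillation_negligible[OF ac])+
  then have "negligible (E0 \<union> (\<Union>z\<in>S. E1 (of_rat (fst z)) (of_rat (snd z))))"
    using abs_cont_on_unbounded_quot_negligible[OF ac] by (simp add: E0_def negligible_Un)
  moreover have "{x\<in>{a<..<b}. \<not> f differentiable (at x)} \<subseteq> E0 \<union> (\<Union>z\<in>S. E1 (of_rat (fst z)) (of_rat (snd z)))"
  proof (rule subsetI, rule ccontr)
    fix x assume x: "x \<in> {x\<in>{a<..<b}. \<not> f differentiable (at x)}"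
      and not: "x \<notin> E0 \<union> (\<Union>z\<in>S. E1 (of_rat (fst z)) (of_rat (snd z)))"
    \<comment> \<open>In the extended reals both limits exist before their finiteness is
      known.\<close>
    define Q where "Q y = ereal (quot f x y)" for y
    have freq: "\<forall>d>0. \<exists>y. y \<noteq> x \<and> \<bar>y - x\<bar> < d \<and> P y" if "\<exists>\<^sub>F y in at x. P y" for P
      using that by (force simp: frequently_def eventually_at dist_real_def)
    have "\<not> (\<forall>K. \<forall>d>0. \<exists>y. y \<noteq> x \<and> \<bar>y - x\<bar> < d \<and> \<bar>quot f x y\<bar> > K)"
      using not x unfolding E0_def by blast
    then obtain K d where Kd: "d > 0" "\<forall>y. \<not> (y \<noteq> x \<and> \<bar>y - x\<bar> < d \<and> \<bar>quot f x y\<bar> > K)"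
      by blast
    have evK: "\<forall>\<^sub>F y in at x. \<bar>quot f x y\<bar> \<le> K"
      unfolding eventually_at using Kd by (intro exI[of _ d]) (auto simp: dist_real_def not_less)
    have "Limsup (at x) Q \<le> ereal K"
      by (rule Limsup_bounded) (use evK in \<open>auto simp: Q_def elim!: eventually_mono\<close>)
    moreover have "ereal (- K) \<le> Liminf (at x) Q"
      by (rule Liminf_bounded) (use evK in \<open>auto simp: Q_def elim!: eventually_mono\<close>)
    moreover have le: "Liminf (at x) Q \<le> Limsup (at x) Q" by (rule Liminf_le_Limsup) simp
    ultimately obtain l1 l2 where l: "Liminf (at x) Q = ereal l1" "Limsup (at x) Q = ereal l2"
      by (cases "Liminf (at x) Q"; cases "Limsup (at x) Q") auto
    have "l1 = l2"
    proof (rule ccontr)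
      assume "l1 \<noteq> l2"
      then have "l1 < l2" using le l by simp
      then obtain p where p: "l1 < of_rat p" "of_rat p < l2" using of_rat_dense by blast
      then obtain q where q: "of_rat p < (of_rat q :: real)" "of_rat q < l2" using of_rat_dense by blast
      have "\<exists>\<^sub>F y in at x. quot f x y < of_rat p"
      proof (rule ccontr)
        assume "\<not> ?thesis"
        then have "\<forall>\<^sub>F y in at x. ereal (of_rat p) \<le> Q y" by (simp add: frequently_def Q_def not_less)
        then have "ereal (of_rat p) \<le> Liminf (at x) Q" by (rule Liminf_bounded)
        then show False using l p by simp
      qed
      moreover have "\<exists>\<^sub>F y in at x. quot f x y > of_rat q"
      proof (rule ccontr)
        assume "\<not> ?thesis"
        then have "\<forall>\<^sub>F y in at x. Q y \<le> ereal (of_rat q)" by (simp add: frequently_def Q_def not_less)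
        then have "Limsup (at x) Q \<le> ereal (of_rat q)" by (rule Limsup_bounded)
        then show False using l q by simp
      qed
      ultimately have "x \<in> E1 (of_rat p) (of_rat q)"
        using x freq unfolding E1_def by blast
      moreover have "(p, q) \<in> S" using q by (simp add: S_def of_rat_less)
      ultimately show False using not by force
    qed
    then have "(Q \<longlongrightarrow> ereal l1) (at x)" using l by (intro Liminf_eq_Limsup) auto
    then have "(quot f x \<longlongrightarrow> l1) (at x)" unfolding Q_def by simp
    then have "(f has_real_derivative l1) (at x)"
      by (simp add: has_field_derivative_iff quot_def[abs_def])
    then show False using x by (auto simp: real_differentiable_def)
  qed
  ultimately show ?thesis by (rule negligible_subset)
qed

theorem abs_cont_on_differentiable_ae:
  fixes \<gamma> :: "real \<Rightarrow> 'a::euclidean_space"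
  assumes ac: "abs_cont_on a b \<gamma>"
  shows "negligible {s\<in>{a<..<b}. \<not> \<gamma> differentiable (at s)}"
proof -
  have "negligible (\<Union>i\<in>Basis. {s\<in>{a<..<b}. \<not> (\<lambda>s. i \<bullet> \<gamma> s) differentiable (at s)})"
    using abs_cont_on_differentiable_ae_real[OF abs_cont_on_inner[OF ac]] by (intro negligible_Union) auto
  moreover have "{s\<in>{a<..<b}. \<not> \<gamma> differentiable (at s)} \<subseteq>
      (\<Union>i\<in>Basis. {s\<in>{a<..<b}. \<not> (\<lambda>s. i \<bullet> \<gamma> s) differentiable (at s)})"
    using differentiable_componentwise_within[of \<gamma> _ UNIV] by (auto simp: inner_commute)
  ultimately show ?thesis by (rule negligible_subset)
qed

text \<open>A gauge argument. Cells tagged off N are controlled by the derivative at the tag; cells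
  tagged in N lie in an open set of small measure, where absolute continuity bounds the sum of the
  increments of f. Integrability of the derivative is thus part of the conclusion and is not
  established beforehand.\<close>

theorem abs_cont_on_has_integral:
  fixes f :: "real \<Rightarrow> real"
  assumes ac: "abs_cont_on a b f" and "a \<le> b" and N: "negligible N"
    and deriv: "\<And>x. x \<in> {a..b} - N \<Longrightarrow> (f has_real_derivative f' x) (at x)"
  shows "(f' has_integral (f b - f a)) {a..b}"
proof -
  define g where "g x = (if x \<in> N then 0 else f' x)" for x
  have "(g has_integral (f b - f a)) (cbox a b)"
    unfolding has_integral
  proof (intro allI impI)
    fix e :: real assume "e > 0"
    then have e2: "e / 2 > 0" by simp
    \<comment> \<open>The summand 1 keeps the quotient meaningful when a = b.\<close>
    define e' where "e' = e / (2 * (b - a + 1))"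
    have "e' > 0" using \<open>e > 0\<close> \<open>a \<le> b\<close> by (simp add: e'_def)
    have e'le: "e' * (b - a) \<le> e / 2" using \<open>e > 0\<close> \<open>a \<le> b\<close> by (simp add: e'_def field_simps)
    obtain \<delta> where "\<delta> > 0" and \<delta>: "\<forall>(I::(real \<times> real set) set) \<alpha> \<beta>.
       finite I \<and> (\<forall>i\<in>I. a \<le> \<alpha> i \<and> \<alpha> i \<le> \<beta> i \<and> \<beta> i \<le> b) \<and>
       (\<forall>i\<in>I. \<forall>j\<in>I. i \<noteq> j \<longrightarrow> {\<alpha> i<..<\<beta> i} \<inter> {\<alpha> j<..<\<beta> j} = {}) \<and>
       (\<Sum>i\<in>I. \<beta> i - \<alpha> i) < \<delta> \<longrightarrow> (\<Sum>i\<in>I. norm (f (\<beta> i) - f (\<alpha> i))) < e / 2"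
      by (rule abs_cont_on_family[OF ac e2]) (rule that)
    obtain W where W: "open W" "N \<subseteq> W" "W - N \<in> lmeasurable" "emeasure lebesgue (W - N) < ennreal \<delta>"
      using sets_lebesgue_outer_open[of N \<delta>] negligible_imp_sets[OF N] \<open>\<delta> > 0\<close> by blast
    have mW: "W \<in> lmeasurable" "measure lebesgue W < \<delta>"
    proof -
      have W_eq: "W = N \<union> (W - N)" using W(2) by blast
      show "W \<in> lmeasurable"
        by (subst W_eq) (intro fmeasurable.Un W(3) negligible_imp_measurable[OF N])
      have "measure lebesgue W \<le> measure lebesgue N + measure lebesgue (W - N)"
        by (subst (1) W_eq) (intro measure_Un_le fmeasurableD W(3) negligible_imp_measurable[OF N])
      then show "measure lebesgue W < \<delta>"
        using W(3,4) \<open>\<delta> > 0\<close> negligible_imp_measure0[OF N] by (simp add: emeasure_eq_measure2 ennreal_less_iff)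
    qed
    have "\<exists>d>0. (x \<in> N \<longrightarrow> ball x d \<subseteq> W) \<and>
        (x \<in> {a..b} - N \<longrightarrow> (\<forall>y. \<bar>y - x\<bar> < d \<longrightarrow> \<bar>f y - f x - (y - x) * f' x\<bar> \<le> e' * \<bar>y - x\<bar>))" for x
    proof (cases "x \<in> {a..b} - N")
      case True
      have "(f has_derivative (\<lambda>h. h * f' x)) (at x)"
        using deriv[OF True] by (simp add: has_field_derivative_def mult_commute_abs)
      then show ?thesis using \<open>e' > 0\<close> True unfolding has_derivative_at_alt by auto
    next
      case False
      show ?thesis
      proof (cases "x \<in> N")
        case True
        then obtain d where "d > 0" "ball x d \<subseteq> W" using openE[OF W(1), of x] W(2) by blast
        then show ?thesis using False by blast
      qed (use False in \<open>auto intro: exI[of _ 1]\<close>)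
    qed
    then obtain d where d: "\<And>x. d x > 0" "\<And>x. x \<in> N \<Longrightarrow> ball x (d x) \<subseteq> W"
        "\<And>x y. x \<in> {a..b} - N \<Longrightarrow> \<bar>y - x\<bar> < d x \<Longrightarrow> \<bar>f y - f x - (y - x) * f' x\<bar> \<le> e' * \<bar>y - x\<bar>" by metis
    show "\<exists>D. gauge D \<and> (\<forall>\<D>. \<D> tagged_division_of cbox a b \<and> D fine \<D> \<longrightarrow>
        norm ((\<Sum>(x, k)\<in>\<D>. measure lborel k *\<^sub>R g x) - (f b - f a)) < e)"
    proof (intro exI[of _ "\<lambda>x. ball x (d x)"] conjI allI impI)
      show "gauge (\<lambda>x. ball x (d x))" using d(1) by (simp add: gauge_ball_dependent)
      fix p assume "p tagged_division_of cbox a b \<and> (\<lambda>x. ball x (d x)) fine p"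
      then have p: "p tagged_division_of cbox a b" and fine: "(\<lambda>x. ball x (d x)) fine p" by blast+
      have finp: "finite p" using p by blast
      have cell: "\<exists>u v. K = {u..v} \<and> u \<le> x \<and> x \<le> v \<and> a \<le> u \<and> v \<le> b \<and> {u..v} \<subseteq> ball x (d x)" if xK: "(x, K) \<in> p" for x K
      proof -
        have 1: "x \<in> K" "K \<subseteq> cbox a b" using tagged_division_ofD(2,3)[OF p xK] .
        obtain u v where 2: "K = cbox u v" using tagged_division_ofD(4)[OF p xK] by blast
        have 3: "K \<subseteq> ball x (d x)" using fine xK by (auto simp: fine_def)
        show ?thesis using 1 2 3 by (intro exI[of _ u] exI[of _ v]) auto
      qed
      define pN where "pN = {z\<in>p. fst z \<in> N}"
      define h where "h z = measure lborel (snd z) * g (fst z) - (f (Sup (snd z)) - f (Inf (snd z)))" for z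
      have tele: "(\<Sum>z\<in>p. f (Sup (snd z)) - f (Inf (snd z))) = f b - f a"
        using additive_tagged_division_1[OF \<open>a \<le> b\<close>, of p f] p by (simp add: case_prod_unfold)
      have tele': "(\<Sum>z\<in>p. Sup (snd z) - Inf (snd z)) = b - a"
        using additive_tagged_division_1[OF \<open>a \<le> b\<close>, of p "\<lambda>x. x"] p by (simp add: case_prod_unfold)
      have eq: "(\<Sum>(x, k)\<in>p. measure lborel k *\<^sub>R g x) - (f b - f a) = (\<Sum>z\<in>p. h z)"
        unfolding h_def by (subst sum_subtractf) (simp add: tele case_prod_unfold)
      have "(\<Sum>z\<in>p. h z) = (\<Sum>z\<in>p - pN. h z) + (\<Sum>z\<in>pN. h z)"
        using finp by (intro sum.subset_diff) (auto simp: pN_def)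
      moreover have "\<bar>\<Sum>z\<in>p - pN. h z\<bar> \<le> e / 2"
      proof -
        have "\<bar>\<Sum>z\<in>p - pN. h z\<bar> \<le> (\<Sum>z\<in>p - pN. e' * (Sup (snd z) - Inf (snd z)))"
        proof (rule order_trans[OF sum_abs sum_mono])
          fix z assume z: "z \<in> p - pN"
          obtain u v where uv: "snd z = {u..v}" "u \<le> fst z" "fst z \<le> v" "a \<le> u" "v \<le> b" "{u..v} \<subseteq> ball (fst z) (d (fst z))"
            using cell[of "fst z" "snd z"] z by auto
          have "fst z \<in> {a..b} - N" using z uv by (auto simp: pN_def)
          moreover have "u \<in> {u..v}" "v \<in> {u..v}" using uv(2,3) by auto
          then have "u \<in> ball (fst z) (d (fst z))" "v \<in> ball (fst z) (d (fst z))"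
            using uv(6) by blast+
          then have "\<bar>u - fst z\<bar> < d (fst z)" "\<bar>v - fst z\<bar> < d (fst z)"
            by (auto simp: dist_real_def)
          ultimately have "\<bar>f u - f (fst z) - (u - fst z) * f' (fst z)\<bar> \<le> e' * \<bar>u - fst z\<bar>"
            "\<bar>f v - f (fst z) - (v - fst z) * f' (fst z)\<bar> \<le> e' * \<bar>v - fst z\<bar>" using d(3) by blast+
          \<comment> \<open>Straddle estimate: both endpoints are compared with the tag, and since
            the tag lies between them the two errors add up to e' times the length of the
            cell.\<close>
          moreover have "h z = (f u - f (fst z) - (u - fst z) * f' (fst z)) - (f v - f (fst z) - (v - fst z) * f' (fst z))"
            using \<open>fst z \<in> {a..b} - N\<close> uv by (simp add: h_def g_def algebra_simps)
          ultimately have "\<bar>h z\<bar> \<le> e' * \<bar>u - fst z\<bar> + e' * \<bar>v - fst z\<bar>" by linarith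
          also have "\<dots> = e' * (v - u)" using uv by (simp add: algebra_simps)
          finally show "\<bar>h z\<bar> \<le> e' * (Sup (snd z) - Inf (snd z))" using uv by simp
        qed
        also have "\<dots> \<le> (\<Sum>z\<in>p. e' * (Sup (snd z) - Inf (snd z)))"
        proof (rule sum_mono2[OF finp])
          fix z assume "z \<in> p - (p - pN)"
          then obtain u v where "snd z = {u..v}" "u \<le> fst z" "fst z \<le> v" using cell[of "fst z" "snd z"] by auto
          then show "0 \<le> e' * (Sup (snd z) - Inf (snd z))" using \<open>e' > 0\<close> by simp
        qed auto
        also have "\<dots> = e' * (b - a)" unfolding tele'[symmetric] by (simp add: sum_distrib_left)
        also have "\<dots> \<le> e / 2" by (rule e'le)
        finally show ?thesis .
      qed
      moreover have "\<bar>\<Sum>z\<in>pN. h z\<bar> < e / 2"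
      proof -
        have finN: "finite pN" using finp by (simp add: pN_def)
        have disj: "{Inf (snd z)<..<Sup (snd z)} \<inter> {Inf (snd z')<..<Sup (snd z')} = {}"
          if "z \<in> pN" "z' \<in> pN" "z \<noteq> z'" for z z'
        proof -
          have zz: "z \<in> p" "z' \<in> p" using that by (auto simp: pN_def)
          obtain u v where 1: "snd z = {u..v}" "u \<le> v" using cell[of "fst z" "snd z"] zz by fastforce
          obtain u' v' where 2: "snd z' = {u'..v'}" "u' \<le> v'" using cell[of "fst z'" "snd z'"] zz by fastforce
          have "interior (snd z) \<inter> interior (snd z') = {}"
            using tagged_division_ofD(5)[OF p, of "fst z" "snd z" "fst z'" "snd z'"] zz that(3) by simp
          then show ?thesis using 1 2 by (simp add: interior_atLeastAtMost_real)
        qed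
        have bnd: "a \<le> Inf (snd z) \<and> Inf (snd z) \<le> Sup (snd z) \<and> Sup (snd z) \<le> b" if z: "z \<in> pN" for z
        proof -
          have "z \<in> p" using z by (auto simp: pN_def)
          then obtain u v where "snd z = {u..v}" "u \<le> v" "a \<le> u" "v \<le> b" using cell[of "fst z" "snd z"] by fastforce
          then show ?thesis by simp
        qed
        \<comment> \<open>The cells meet at most in endpoints, so their total length is the measure
          of the union of their interiors, which lies in W.\<close>
        have "(\<Sum>z\<in>pN. Sup (snd z) - Inf (snd z)) = (\<Sum>z\<in>pN. measure lebesgue {Inf (snd z)<..<Sup (snd z)})"
          using bnd by (intro sum.cong) auto
        also have "\<dots> = measure lebesgue (\<Union>z\<in>pN. {Inf (snd z)<..<Sup (snd z)})"
          using finN disj by (intro measure_UNION'[symmetric]) (auto simp: pairwise_def disjnt_def lmeasurable_open)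
        also have "\<dots> \<le> measure lebesgue W"
        proof (rule measure_mono_fmeasurable[OF _ _ mW(1)])
          show "(\<Union>z\<in>pN. {Inf (snd z)<..<Sup (snd z)}) \<subseteq> W"
          proof (rule UN_least)
            fix z assume z: "z \<in> pN"
            then have "z \<in> p" "fst z \<in> N" by (auto simp: pN_def)
            then obtain u v where uv: "snd z = {u..v}" "u \<le> v" "{u..v} \<subseteq> ball (fst z) (d (fst z))"
              using cell[of "fst z" "snd z"] by fastforce
            then have "{u..v} \<subseteq> W" using d(2)[OF \<open>fst z \<in> N\<close>] by blast
            then show "{Inf (snd z)<..<Sup (snd z)} \<subseteq> W" using uv by auto
          qed
          show "(\<Union>z\<in>pN. {Inf (snd z)<..<Sup (snd z)}) \<in> sets lebesgue"
            by (rule fmeasurableD, rule fmeasurable.finite_UN[OF finN]) (simp add: lmeasurable_open)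
        qed
        finally have "(\<Sum>z\<in>pN. Sup (snd z) - Inf (snd z)) < \<delta>" using mW(2) by simp
        then have "(\<Sum>z\<in>pN. norm (f (Sup (snd z)) - f (Inf (snd z)))) < e / 2"
          using \<delta>[rule_format, of pN "\<lambda>z. Inf (snd z)" "\<lambda>z. Sup (snd z)"] finN disj bnd by blast
        moreover have "\<bar>\<Sum>z\<in>pN. h z\<bar> \<le> (\<Sum>z\<in>pN. norm (f (Sup (snd z)) - f (Inf (snd z))))"
          by (rule order_trans[OF sum_abs sum_mono]) (auto simp: h_def g_def pN_def)
        ultimately show ?thesis by linarith
      qed
      ultimately have "\<bar>\<Sum>z\<in>p. h z\<bar> < e" by linarith
      then show "norm ((\<Sum>(x, k)\<in>p. measure lborel k *\<^sub>R g x) - (f b - f a)) < e" unfolding eq by simp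
    qed
  qed
  then show ?thesis
    using has_integral_spike_eq[OF N, of "{a..b}" g f'] by (simp add: g_def)
qed

section \<open>Costs and dynamic programming\<close>

abbreviation curve_cost where
  "curve_cost L F m \<gamma> \<equiv> \<lambda>s. L (\<gamma> s) (vector_derivative \<gamma> (at s)) + F (\<gamma> s) (m s)"

definition join_at :: "real \<Rightarrow> (real \<Rightarrow> 'a) \<Rightarrow> (real \<Rightarrow> 'a) \<Rightarrow> real \<Rightarrow> 'a" where
  "join_at s \<gamma>1 \<gamma>2 = (\<lambda>r. if r \<le> s then \<gamma>1 r else \<gamma>2 r)"

text \<open>The Lebesgue and the gauge integral agree on absolutely integrable functions. The second
  form fits the fundamental theorem above and can be split at an intermediate time.\<close>

lemma run_cost_altdef:
  "run_cost L F T m t0 \<gamma> = (if curve_cost L F m \<gamma> absolutely_integrable_on {t0..T}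
     then ereal (integral {t0..T} (curve_cost L F m \<gamma>)) else \<infinity>)"
proof -
  have "integrable (lebesgue_on {t0..T}) f \<longleftrightarrow> f absolutely_integrable_on {t0..T}" for f :: "real \<Rightarrow> real"
    by (simp add: integrable_restrict_space set_integrable_def)
  then show ?thesis
    unfolding run_cost_def Let_def by (auto simp: lebesgue_integral_eq_integral)
qed

section \<open>Concatenation of curves and dynamic programming\<close>

lemma Curves_join:
  fixes \<gamma>1 \<gamma>2 :: "real \<Rightarrow> 'a::euclidean_space"
  assumes "\<gamma>1 \<in> Curves T \<Omega>" "\<gamma>2 \<in> Curves T \<Omega>" "\<gamma>1 s = \<gamma>2 s" "0 \<le> s" "s \<le> T"
  shows "join_at s \<gamma>1 \<gamma>2 \<in> Curves T \<Omega>"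
proof -
  \<comment> \<open>The joined curve is a stopped copy of the first plus a delayed copy of the
    second, corrected by the common value at s. Absolute continuity then follows from sums and
    compositions, without cutting intervals that straddle s.\<close>
  have eq: "join_at s \<gamma>1 \<gamma>2 = (\<lambda>r. \<gamma>1 (min r s) + (\<gamma>2 (max r s) + (- \<gamma>2 s)))"
    using assms(3) by (auto simp: join_at_def fun_eq_iff)
  have "abs_cont_on 0 T (\<lambda>r. \<gamma>1 (min r s))" "abs_cont_on 0 T (\<lambda>r. \<gamma>2 (max r s))"
    using assms by (auto simp: Curves_def intro!: abs_cont_on_compose[of 0 T])
  moreover have "abs_cont_on 0 T (\<lambda>r. - \<gamma>2 s)" by (rule abs_cont_on_lipschitz[of _ _ _ 0]) auto
  ultimately have "abs_cont_on 0 T (join_at s \<gamma>1 \<gamma>2)"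
    unfolding eq by (intro abs_cont_on_add)
  moreover have "join_at s \<gamma>1 \<gamma>2 r = join_at s \<gamma>1 \<gamma>2 (min T (max 0 r))" for r
  proof -
    have clamp: "\<gamma>1 r = \<gamma>1 (min T (max 0 r))" "\<gamma>2 r = \<gamma>2 (min T (max 0 r))" 
      using assms(1,2) unfolding Curves_def by blast+
    show ?thesis
    proof (cases "r \<le> s")
      case True
      then have "min T (max 0 r) \<le> s" using assms by auto
      then show ?thesis using True clamp by (simp add: join_at_def)
    next
      case False
      show ?thesis
      proof (cases "min T (max 0 r) \<le> s")
        case True
        \<comment> \<open>Since r > s, the clamped time fails to exceed s only if s = T.\<close>
        then have "min T (max 0 r) = s" using False assms by auto
        then show ?thesis using False clamp assms(3) by (simp add: join_at_def)
      qed (use False clamp in \<open>simp add: join_at_def\<close>)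
    qed
  qed
  moreover have "\<forall>r\<in>{0..T}. join_at s \<gamma>1 \<gamma>2 r \<in> closure \<Omega>"
    using assms by (auto simp: Curves_def join_at_def)
  ultimately show ?thesis unfolding Curves_def by blast
qed

text \<open>The two-sided derivative sees a whole neighbourhood, hence the open set. For a joined
  curve this leaves out only the joining time, which is null.\<close>

lemma curve_cost_cong:
  fixes \<gamma>1 \<gamma>2 :: "real \<Rightarrow> 'a::real_normed_vector"
  assumes "open A" "s \<in> A" "\<And>r. r \<in> A \<Longrightarrow> \<gamma>1 r = \<gamma>2 r"
  shows "curve_cost L F m \<gamma>1 s = curve_cost L F m \<gamma>2 s"
proof -
  have "\<forall>\<^sub>F r in nhds s. r \<in> UNIV \<longrightarrow> \<gamma>1 r = \<gamma>2 r"
    using eventually_nhds_in_open[OF assms(1,2)] assms(3) by (auto elim: eventually_mono)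
  then have "vector_derivative \<gamma>1 (at s) = vector_derivative \<gamma>2 (at s)"
    by (rule vector_derivative_cong_eq) auto
  then show ?thesis using assms by simp
qed

text \<open>The inequality form absorbs the case of a second piece of infinite cost, in which
  nothing has to be known about the joined curve.\<close>

lemma total_cost_join_le:
  fixes \<gamma>1 \<gamma>2 :: "real \<Rightarrow> 'a::euclidean_space"
  assumes "\<gamma>1 s = \<gamma>2 s" "t0 \<le> s" "s \<le> T"
    and int1: "curve_cost L F m \<gamma>1 absolutely_integrable_on {t0..s}"
  shows "total_cost L F G T m t0 (join_at s \<gamma>1 \<gamma>2) \<le>
           ereal (integral {t0..s} (curve_cost L F m \<gamma>1)) + total_cost L F G T m s \<gamma>2"
proof (cases "curve_cost L F m \<gamma>2 absolutely_integrable_on {s..T}")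
  case True
  let ?c = "curve_cost L F m (join_at s \<gamma>1 \<gamma>2)"
  have eq1: "?c r = curve_cost L F m \<gamma>1 r" if "r \<in> {t0..s} - {s}" for r
    using that by (intro curve_cost_cong[of "{..<s}"]) (auto simp: join_at_def)
  have eq2: "?c r = curve_cost L F m \<gamma>2 r" if "r \<in> {s..T} - {s}" for r
    using that by (intro curve_cost_cong[of "{s<..}"]) (auto simp: join_at_def)
  have i1: "?c absolutely_integrable_on {t0..s}"
    by (rule absolutely_integrable_spike[OF int1 negligible_sing[of s]]) (rule eq1)
  have i2: "?c absolutely_integrable_on {s..T}"
    by (rule absolutely_integrable_spike[OF True negligible_sing[of s]]) (rule eq2)
  have "{t0..T} = {t0..s} \<union> {s..T}" using assms by auto
  then have i: "?c absolutely_integrable_on {t0..T}"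
    using absolutely_integrable_Un[OF i1 i2] by simp
  have "integral {t0..T} ?c = integral {t0..s} ?c + integral {s..T} ?c"
    using Henstock_Kurzweil_Integration.integral_combine[of t0 s T ?c] i assms
    by (simp add: absolutely_integrable_on_def)
  also have "integral {t0..s} ?c = integral {t0..s} (curve_cost L F m \<gamma>1)"
    by (rule integral_spike[OF negligible_sing[of s]]) (rule eq1[symmetric])
  also have "integral {s..T} ?c = integral {s..T} (curve_cost L F m \<gamma>2)"
    by (rule integral_spike[OF negligible_sing[of s]]) (rule eq2[symmetric])
  finally have "integral {t0..T} ?c = integral {t0..s} (curve_cost L F m \<gamma>1) + integral {s..T} (curve_cost L F m \<gamma>2)" .
  moreover have "join_at s \<gamma>1 \<gamma>2 T = \<gamma>2 T" using assms by (auto simp: join_at_def)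
  ultimately show ?thesis
    using i True by (simp add: total_cost_def run_cost_altdef)
next
  case False
  then show ?thesis by (simp add: total_cost_def run_cost_altdef)
qed

text \<open>Following \<gamma> up to time s and an arbitrary competitor afterwards is admissible
  from time t. The integral over [t, s] is finite, so it can be moved to the left before the infimum
  over competitors is taken.\<close>

lemma value_le_dynamic_programming:
  fixes \<gamma> :: "real \<Rightarrow> 'a::euclidean_space"
  assumes u: "\<And>t x. t \<in> {0..T} \<Longrightarrow> x \<in> closure \<Omega> \<Longrightarrow>
      ereal (u t x) = (INF \<gamma>\<in>{\<gamma>\<in>Curves T \<Omega>. \<gamma> t = x}. total_cost L F G T m t \<gamma>)"
    and \<gamma>: "\<gamma> \<in> Curves T \<Omega>" and st: "0 \<le> t" "t \<le> s" "s \<le> T"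
    and int: "curve_cost L F m \<gamma> absolutely_integrable_on {t..s}"
  shows "u t (\<gamma> t) \<le> integral {t..s} (curve_cost L F m \<gamma>) + u s (\<gamma> s)"
proof -
  let ?I = "integral {t..s} (curve_cost L F m \<gamma>)"
  have cl: "\<gamma> t \<in> closure \<Omega>" "\<gamma> s \<in> closure \<Omega>" using \<gamma> st by (auto simp: Curves_def)
  have "ereal (u t (\<gamma> t) - ?I) \<le> (INF \<gamma>\<in>{\<gamma>'\<in>Curves T \<Omega>. \<gamma>' s = \<gamma> s}. total_cost L F G T m s \<gamma>)"
  proof (rule INF_greatest)
    fix \<gamma>' assume "\<gamma>' \<in> {\<gamma>'\<in>Curves T \<Omega>. \<gamma>' s = \<gamma> s}"
    then have \<gamma>': "\<gamma>' \<in> Curves T \<Omega>" "\<gamma> s = \<gamma>' s" by auto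
    have "join_at s \<gamma> \<gamma>' \<in> Curves T \<Omega>" using \<gamma> \<gamma>' st by (intro Curves_join) auto
    moreover have "join_at s \<gamma> \<gamma>' t = \<gamma> t" using st by (simp add: join_at_def)
    ultimately have "ereal (u t (\<gamma> t)) \<le> total_cost L F G T m t (join_at s \<gamma> \<gamma>')"
      using u[of t "\<gamma> t"] cl st by (simp add: INF_lower)
    also have "\<dots> \<le> ereal ?I + total_cost L F G T m s \<gamma>'"
      by (rule total_cost_join_le) (use \<gamma>'(2) st int in auto)
    finally show "ereal (u t (\<gamma> t) - ?I) \<le> total_cost L F G T m s \<gamma>'"
      by (cases "total_cost L F G T m s \<gamma>'") (auto simp: algebra_simps)
  qed
  also have "\<dots> = ereal (u s (\<gamma> s))" using u[of s "\<gamma> s"] cl st by simp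
  finally show ?thesis by simp
qed

text \<open>A tail of an optimal curve is optimal: a cheaper competitor from time s, joined to
  \<gamma> on [0, s], would beat \<gamma>. Integrability holds because the optimal cost is at most
  the real number u 0 x.\<close>

lemma optimal_curve_value:
  fixes \<gamma> :: "real \<Rightarrow> 'a::euclidean_space"
  assumes u: "\<And>t x. t \<in> {0..T} \<Longrightarrow> x \<in> closure \<Omega> \<Longrightarrow>
      ereal (u t x) = (INF \<gamma>\<in>{\<gamma>\<in>Curves T \<Omega>. \<gamma> t = x}. total_cost L F G T m t \<gamma>)"
    and T: "T > 0" and m: "\<And>t. t \<in> {0..T} \<Longrightarrow> m t = flow \<eta> t"
    and opt: "\<gamma> \<in> optimal_curves L F G T \<Omega> \<eta> x"
    and st: "0 \<le> s" "s \<le> t" "t \<le> T"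
  shows "curve_cost L F m \<gamma> absolutely_integrable_on {0..T}"
    and "integral {s..t} (curve_cost L F m \<gamma>) + u t (\<gamma> t) \<le> u s (\<gamma> s)"
proof -
  have \<gamma>: "\<gamma> \<in> Curves T \<Omega>" "\<gamma> 0 = x" using opt by (auto simp: optimal_curves_def)
  have cl: "\<gamma> r \<in> closure \<Omega>" if "r \<in> {0..T}" for r using \<gamma> that by (auto simp: Curves_def)
  let ?f = "curve_cost L F m \<gamma>"
  \<comment> \<open>Optimality refers to \<open>flow \<eta>\<close> and the value function to m.
    They are known to agree only on [0, T], which is all that the cost sees.\<close>
  have "total_cost L F G T (flow \<eta>) 0 \<gamma>' = total_cost L F G T m 0 \<gamma>'" for \<gamma>' :: "real \<Rightarrow> 'a"
  proof -
    have eq: "curve_cost L F (flow \<eta>) \<gamma>' r = curve_cost L F m \<gamma>' r" if "r \<in> {0..T} - {}" for r using m that by simp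
    have "curve_cost L F (flow \<eta>) \<gamma>' absolutely_integrable_on {0..T} \<longleftrightarrow> curve_cost L F m \<gamma>' absolutely_integrable_on {0..T}"
      by (rule absolutely_integrable_spike_eq[of "{}"]) (use eq in auto)
    moreover have "integral {0..T} (curve_cost L F (flow \<eta>) \<gamma>') = integral {0..T} (curve_cost L F m \<gamma>')"
      by (rule integral_spike[of "{}"]) (use eq in auto)
    ultimately show ?thesis using m[of T] T by (simp add: total_cost_def run_cost_altdef)
  qed
  then have opt': "total_cost L F G T m 0 \<gamma> \<le> total_cost L F G T m 0 \<gamma>'" if "\<gamma>' \<in> Curves T \<Omega>" "\<gamma>' 0 = x" for \<gamma>'
    using opt that by (simp add: optimal_curves_def)
  have "total_cost L F G T m 0 \<gamma> \<le> (INF \<gamma>\<in>{\<gamma>\<in>Curves T \<Omega>. \<gamma> 0 = x}. total_cost L F G T m 0 \<gamma>)"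
    by (rule INF_greatest) (use opt' in auto)
  also have "\<dots> = ereal (u 0 x)" using u[of 0 x] cl[of 0] \<gamma> T by simp
  finally show int: "?f absolutely_integrable_on {0..T}"
    by (auto simp: total_cost_def run_cost_altdef split: if_splits)
  have sub: "?f absolutely_integrable_on {a..b}" if "0 \<le> a" "b \<le> T" for a b
    by (rule absolutely_integrable_on_subinterval[OF int]) (use that in auto)
  have comb: "integral {a..T} ?f = integral {a..b} ?f + integral {b..T} ?f" if "0 \<le> a" "a \<le> b" "b \<le> T" for a b
    using Henstock_Kurzweil_Integration.integral_combine[of a b T ?f] that sub[of a T]
    by (simp add: absolutely_integrable_on_def)
  have cost: "total_cost L F G T m r \<gamma> = ereal (integral {r..T} ?f + G (\<gamma> T) (m T))" if "0 \<le> r" for r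
    using sub[of r T] that by (simp add: total_cost_def run_cost_altdef)
  have "ereal (integral {s..T} ?f + G (\<gamma> T) (m T)) \<le> (INF \<gamma>\<in>{\<gamma>'\<in>Curves T \<Omega>. \<gamma>' s = \<gamma> s}. total_cost L F G T m s \<gamma>)"
  proof (rule INF_greatest)
    fix \<gamma>' assume "\<gamma>' \<in> {\<gamma>'\<in>Curves T \<Omega>. \<gamma>' s = \<gamma> s}"
    then have \<gamma>': "\<gamma>' \<in> Curves T \<Omega>" "\<gamma> s = \<gamma>' s" by auto
    have "join_at s \<gamma> \<gamma>' \<in> Curves T \<Omega>" using \<gamma> \<gamma>' st by (intro Curves_join) auto
    moreover have "join_at s \<gamma> \<gamma>' 0 = x" using st \<gamma> by (simp add: join_at_def)
    ultimately have "total_cost L F G T m 0 \<gamma> \<le> total_cost L F G T m 0 (join_at s \<gamma> \<gamma>')" by (rule opt')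
    also have "\<dots> \<le> ereal (integral {0..s} ?f) + total_cost L F G T m s \<gamma>'"
      using st by (intro total_cost_join_le \<gamma>' sub) auto
    finally show "ereal (integral {s..T} ?f + G (\<gamma> T) (m T)) \<le> total_cost L F G T m s \<gamma>'"
      using cost[of 0] comb[of 0 s] st by (cases "total_cost L F G T m s \<gamma>'") auto
  qed
  also have "\<dots> = ereal (u s (\<gamma> s))" using u[of s "\<gamma> s"] cl[of s] st by simp
  finally have "integral {s..T} ?f + G (\<gamma> T) (m T) \<le> u s (\<gamma> s)" by simp
  moreover have "ereal (u t (\<gamma> t)) \<le> total_cost L F G T m t \<gamma>"
    using u[of t "\<gamma> t"] cl[of t] st \<gamma> by (simp add: INF_lower)
  then have "u t (\<gamma> t) \<le> integral {t..T} ?f + G (\<gamma> T) (m T)" using cost[of t] st by simp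
  ultimately show "integral {s..t} ?f + u t (\<gamma> t) \<le> u s (\<gamma> s)" using comb[of s t] st by simp
qed

section \<open>The support of the equilibrium\<close>

text \<open>The sets whose mass is tested in \<open>supp_curves_def\<close>, named so that their
  measurability can be stated.\<close>

definition curve_ball :: "real \<Rightarrow> 'a::euclidean_space set \<Rightarrow> (real \<Rightarrow> 'a) \<Rightarrow> real \<Rightarrow> (real \<Rightarrow> 'a) set" where
  "curve_ball T \<Omega> \<gamma> e = {\<gamma>'\<in>Curves T \<Omega>. (SUP s\<in>{0..T}. norm (\<gamma>' s - \<gamma> s)) < e}"

lemma Curves_continuous_on: "\<gamma> \<in> Curves T \<Omega> \<Longrightarrow> continuous_on {0..T} \<gamma>"
  by (auto simp: Curves_def intro: abs_cont_on_imp_continuous_on)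

lemma Curves_bdd_above_dist:
  assumes "\<gamma> \<in> Curves T \<Omega>" "\<gamma>' \<in> Curves T \<Omega>"
  shows "bdd_above ((\<lambda>s. norm (\<gamma>' s - \<gamma> s)) ` {0..T})"
  using assms[THEN Curves_continuous_on]
  by (intro bounded_imp_bdd_above compact_imp_bounded compact_continuous_image continuous_intros) auto

lemma measurable_eval_curve:
  assumes "sets \<eta> = Curves_sets T \<Omega>"
  shows "(\<lambda>\<gamma>. \<gamma> s) \<in> borel_measurable \<eta>"
proof -
  have "(\<lambda>\<gamma>. \<gamma> s) \<in> borel_measurable (restrict_space (Pi\<^sub>M UNIV (\<lambda>_. borel)) (Curves T \<Omega>))"
    by (intro measurable_restrict_space1 measurable_component_singleton) auto
  then show ?thesis
    using measurable_cong_sets[OF assms[unfolded Curves_sets_def] refl] by blast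
qed

text \<open>The sigma-algebra is generated by evaluations at single times, while the supremum
  involves uncountably many. Continuity reduces it to a countable dense set of times. The margin 1 /
  (k + 1) is needed because strict bounds at all times of that set would bound the supremum only
  weakly.\<close>

lemma curve_ball_measurable:
  fixes \<eta> :: "(real \<Rightarrow> 'a::euclidean_space) measure"
  assumes sp: "space \<eta> = Curves T \<Omega>" and se: "sets \<eta> = Curves_sets T \<Omega>" and "T > 0" and \<gamma>: "\<gamma> \<in> Curves T \<Omega>"
  shows "curve_ball T \<Omega> \<gamma> e \<in> sets \<eta>"
proof -
  obtain S where S: "countable S" "S \<subseteq> {0..T}" "{0..T} \<subseteq> closure S"
    using separable[of "{0..T}"] by blast
  have "curve_ball T \<Omega> \<gamma> e = (\<Union>k::nat. {\<gamma>'\<in>space \<eta>. \<forall>s\<in>S. norm (\<gamma>' s - \<gamma> s) \<le> e - 1 / (real k + 1)})"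
  proof (intro equalityI subsetI)
    fix \<gamma>' assume "\<gamma>' \<in> curve_ball T \<Omega> \<gamma> e"
    then have \<gamma>': "\<gamma>' \<in> Curves T \<Omega>" and less: "(SUP s\<in>{0..T}. norm (\<gamma>' s - \<gamma> s)) < e"
      by (auto simp: curve_ball_def)
    then obtain k :: nat where k: "1 / (real k + 1) < e - (SUP s\<in>{0..T}. norm (\<gamma>' s - \<gamma> s))"
      using reals_Archimedean[of "e - (SUP s\<in>{0..T}. norm (\<gamma>' s - \<gamma> s))"] by (auto simp: inverse_eq_divide add.commute)
    have "norm (\<gamma>' s - \<gamma> s) \<le> e - 1 / (real k + 1)" if "s \<in> S" for s
      using cSUP_upper[OF _ Curves_bdd_above_dist[OF \<gamma> \<gamma>'], of s] that S(2) k by fastforce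
    then show "\<gamma>' \<in> (\<Union>k::nat. {\<gamma>'\<in>space \<eta>. \<forall>s\<in>S. norm (\<gamma>' s - \<gamma> s) \<le> e - 1 / (real k + 1)})"
      using \<gamma>' sp by auto
  next
    fix \<gamma>' assume "\<gamma>' \<in> (\<Union>k::nat. {\<gamma>'\<in>space \<eta>. \<forall>s\<in>S. norm (\<gamma>' s - \<gamma> s) \<le> e - 1 / (real k + 1)})"
    then obtain k :: nat where \<gamma>': "\<gamma>' \<in> Curves T \<Omega>" and k: "\<And>s. s \<in> S \<Longrightarrow> norm (\<gamma>' s - \<gamma> s) \<le> e - 1 / (real k + 1)"
      using sp by auto
    have clS: "closure S = {0..T}"
      using S(2,3) by (simp add: closure_minimal subset_antisym)
    have "norm (\<gamma>' s - \<gamma> s) \<le> e - 1 / (real k + 1)" if "s \<in> {0..T}" for s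
    proof (rule continuous_le_on_closure[where S=S and f="\<lambda>s. norm (\<gamma>' s - \<gamma> s)"])
      show "continuous_on (closure S) (\<lambda>s. norm (\<gamma>' s - \<gamma> s))"
        unfolding clS by (intro continuous_on_norm continuous_on_diff Curves_continuous_on[OF \<gamma>] Curves_continuous_on[OF \<gamma>'])
    qed (use that k clS in auto)
    then have "(SUP s\<in>{0..T}. norm (\<gamma>' s - \<gamma> s)) \<le> e - 1 / (real k + 1)"
      using \<open>T > 0\<close> by (intro cSUP_least) auto
    moreover have "1 / (real k + 1) > 0" by simp
    ultimately have "(SUP s\<in>{0..T}. norm (\<gamma>' s - \<gamma> s)) < e" by linarith
    then show "\<gamma>' \<in> curve_ball T \<Omega> \<gamma> e" using \<gamma>' unfolding curve_ball_def by simp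
  qed
  also have "\<dots> \<in> sets \<eta>"
  proof (rule sets.countable_UN''[OF countableI_type])
    fix k :: nat
    show "{\<gamma>'\<in>space \<eta>. \<forall>s\<in>S. norm (\<gamma>' s - \<gamma> s) \<le> e - 1 / (real k + 1)} \<in> sets \<eta>"
    proof (rule sets.sets_Collect_countable_All'[OF _ S(1)])
      fix s
      have [measurable]: "(\<lambda>\<gamma>. \<gamma> s) \<in> borel_measurable \<eta>" by (rule measurable_eval_curve[OF se])
      show "{\<gamma>'\<in>space \<eta>. norm (\<gamma>' s - \<gamma> s) \<le> e - 1 / (real k + 1)} \<in> sets \<eta>" by measurable
    qed
  qed
  finally show ?thesis .
qed

text \<open>The members of the cover are indexed by a scale, a grid size and grid values in a countable
  dense set; a modulus of continuity at the grid size makes them small.\<close>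
lemma Curves_countable_small_cover:
  fixes \<Omega> :: "'a::euclidean_space set"
  assumes "T > 0"
  obtains \<C> :: "(real \<Rightarrow> 'a) set set" where "countable \<C>"
    "\<And>\<gamma> e. \<gamma> \<in> Curves T \<Omega> \<Longrightarrow> e > 0 \<Longrightarrow> \<exists>C\<in>\<C>. \<gamma> \<in> C \<and> C \<subseteq> curve_ball T \<Omega> \<gamma> e"
proof -
  obtain D :: "'a set" where D: "countable D" "\<And>X. open X \<Longrightarrow> X \<noteq> {} \<Longrightarrow> \<exists>d\<in>D. d \<in> X"
    using countable_dense_exists by blast
  define CC where "CC = (\<lambda>(n::nat, N::nat, zs). {\<gamma>\<in>Curves T \<Omega>.
      (\<forall>s\<in>{0..T}. \<forall>s'\<in>{0..T}. \<bar>s - s'\<bar> \<le> T / (real N + 1) \<longrightarrow> norm (\<gamma> s - \<gamma> s') < 1 / (real n + 1)) \<and>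
      (\<forall>i\<le>N + 1. norm (\<gamma> (real i * (T / (real N + 1))) - zs ! i) < 1 / (real n + 1))})"
  show thesis
  proof (rule that[of "CC ` (UNIV \<times> UNIV \<times> lists D)"])
    show "countable (CC ` (UNIV \<times> UNIV \<times> lists D))" using D(1) by auto
    fix \<gamma> and e :: real assume \<gamma>: "\<gamma> \<in> Curves T \<Omega>" and "e > 0"
    \<comment> \<open>Four errors below 1 / (n + 1) occur later, two from the moduli of continuity
      and two from the grid values.\<close>
    obtain n :: nat where n: "1 / (real n + 1) < e / 5"
      using reals_Archimedean[of "e / 5"] \<open>e > 0\<close> by (auto simp: inverse_eq_divide add.commute)
    have "uniformly_continuous_on {0..T} \<gamma>"
      by (rule compact_uniformly_continuous[OF Curves_continuous_on[OF \<gamma>]]) simp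
    then obtain d where d: "d > 0" "\<And>s s'. s \<in> {0..T} \<Longrightarrow> s' \<in> {0..T} \<Longrightarrow> dist s' s < d \<Longrightarrow> dist (\<gamma> s') (\<gamma> s) < 1 / (real n + 1)"
      unfolding uniformly_continuous_on_def
      by (metis add_nonneg_pos divide_pos_pos of_nat_0_le_iff zero_less_one)
    obtain N :: nat where "1 / (real N + 1) < d / T"
      using reals_Archimedean[of "d / T"] \<open>d > 0\<close> \<open>T > 0\<close> by (auto simp: inverse_eq_divide add.commute)
    then have N: "T / (real N + 1) < d" using \<open>T > 0\<close> by (simp add: field_simps)
    define \<tau> where "\<tau> = T / (real N + 1)"
    have "\<tau> > 0" using \<open>T > 0\<close> by (simp add: \<tau>_def)
    define pt where "pt i = real i * \<tau>" for i
    have "\<exists>z\<in>D. z \<in> ball (\<gamma> (pt i)) (1 / (real n + 1))" for i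
      by (rule D(2)) auto
    then obtain z where z: "\<And>i. z i \<in> D" "\<And>i. z i \<in> ball (\<gamma> (pt i)) (1 / (real n + 1))" by metis
    \<comment> \<open>The indices run from 0 to N + 1, so that the grid contains both 0 and
      T.\<close>
    define zs where "zs = map z [0..<N + 2]"
    have zs: "zs ! i = z i" if "i \<le> N + 1" for i
      using that nth_map_upt[of i "N + 2" 0 z] by (simp add: zs_def del: upt_Suc)
    have "zs \<in> lists D" using z(1) by (auto simp: zs_def)
    have mem: "\<gamma> \<in> CC (n, N, zs)"
      unfolding CC_def using \<gamma> d(2) N z(2) zs
      by (auto simp: dist_norm pt_def \<tau>_def dist_real_def norm_minus_commute)
    moreover have "CC (n, N, zs) \<subseteq> curve_ball T \<Omega> \<gamma> e"
    proof
      fix \<gamma>' assume \<gamma>'C: "\<gamma>' \<in> CC (n, N, zs)"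
      then have \<gamma>': "\<gamma>' \<in> Curves T \<Omega>" by (auto simp: CC_def)
      have "norm (\<gamma>' s - \<gamma> s) \<le> 4 * (1 / (real n + 1))" if s: "s \<in> {0..T}" for s
      proof -
        define i where "i = nat \<lfloor>s / \<tau>\<rfloor>"
        have q: "0 \<le> s / \<tau>" "s / \<tau> \<le> real N + 1"
          using s \<open>\<tau> > 0\<close> \<open>T > 0\<close> mult_right_mono[of s T "real N + 1"] by (auto simp: \<tau>_def field_simps)
        then have "real i = of_int \<lfloor>s / \<tau>\<rfloor>" by (simp add: i_def)
        then have ri: "real i \<le> s / \<tau>" "s / \<tau> < real i + 1" by linarith+
        then have "real i * \<tau> \<le> s" "s < (real i + 1) * \<tau>"
          using \<open>\<tau> > 0\<close> by (simp_all add: pos_le_divide_eq pos_divide_less_eq)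
        then have i: "pt i \<le> s" "s - pt i \<le> \<tau>" by (simp_all add: pt_def distrib_right)
        have "real i \<le> real N + 1" using ri(1) q(2) by linarith
        then have iN: "i \<le> N + 1" by linarith
        have "pt i \<ge> 0" using \<open>\<tau> > 0\<close> by (simp add: pt_def)
        then have pts: "pt i \<in> {0..T}" "\<bar>s - pt i\<bar> \<le> \<tau>" using i s by auto
        have b: "norm (g s - g (pt i)) < 1 / (real n + 1)" "norm (g (pt i) - zs ! i) < 1 / (real n + 1)"
          if "g \<in> CC (n, N, zs)" for g
          using that pts iN s unfolding CC_def pt_def \<tau>_def by auto
        have "\<gamma>' s - \<gamma> s = (\<gamma>' s - \<gamma>' (pt i)) + (\<gamma>' (pt i) - zs ! i) - (\<gamma> (pt i) - zs ! i) - (\<gamma> s - \<gamma> (pt i))" by simp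
        also have "norm \<dots> \<le> norm (\<gamma>' s - \<gamma>' (pt i)) + norm (\<gamma>' (pt i) - zs ! i) + norm (\<gamma> (pt i) - zs ! i) + norm (\<gamma> s - \<gamma> (pt i))"
          by norm
        finally show ?thesis using b[OF mem] b[OF \<gamma>'C] by linarith
      qed
      then have "(SUP s\<in>{0..T}. norm (\<gamma>' s - \<gamma> s)) \<le> 4 * (1 / (real n + 1))"
        using \<open>T > 0\<close> by (intro cSUP_least) auto
      also have "\<dots> < e" using n \<open>e > 0\<close> by linarith
      finally show "\<gamma>' \<in> curve_ball T \<Omega> \<gamma> e" using \<gamma>' by (simp add: curve_ball_def)
    qed
    ultimately show "\<exists>C\<in>CC ` (UNIV \<times> UNIV \<times> lists D). \<gamma> \<in> C \<and> C \<subseteq> curve_ball T \<Omega> \<gamma> e"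
      using \<open>zs \<in> lists D\<close> by (intro bexI[of _ "CC (n, N, zs)"]) auto
  qed
qed

text \<open>If no curve of the support passed near x at time t, every curve that does would have a
  uniform ball of measure zero. By the countable cover, countably many null sets would then contain
  all these curves, although together they carry the positive mass of
  \<open>ball x \<epsilon>\<close> under the flow.\<close>

lemma supp_flow_curve:
  fixes \<eta> :: "(real \<Rightarrow> 'a::euclidean_space) measure"
  assumes sp: "space \<eta> = Curves T \<Omega>" and se: "sets \<eta> = Curves_sets T \<Omega>" and "T > 0"
    and x: "x \<in> supp (flow \<eta> t)" and "\<epsilon> > 0"
  shows "\<exists>\<gamma>\<in>supp_curves T \<Omega> \<eta>. norm (\<gamma> t - x) < \<epsilon>"
proof (rule ccontr)
  assume none: "\<not> (\<exists>\<gamma>\<in>supp_curves T \<Omega> \<eta>. norm (\<gamma> t - x) < \<epsilon>)"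
  define A where "A = {\<gamma>\<in>Curves T \<Omega>. \<gamma> t \<in> ball x \<epsilon>}"
  have meas: "(\<lambda>\<gamma>. \<gamma> t) \<in> borel_measurable \<eta>" by (rule measurable_eval_curve[OF se])
  have "emeasure (flow \<eta> t) (ball x \<epsilon>) = emeasure \<eta> ((\<lambda>\<gamma>. \<gamma> t) -` ball x \<epsilon> \<inter> space \<eta>)"
    unfolding flow_def by (rule emeasure_distr[OF meas]) simp
  also have "(\<lambda>\<gamma>. \<gamma> t) -` ball x \<epsilon> \<inter> space \<eta> = A" by (auto simp: A_def sp)
  finally have eqA: "emeasure (flow \<eta> t) (ball x \<epsilon>) = emeasure \<eta> A" .
  have posA: "emeasure \<eta> A > 0" using x \<open>\<epsilon> > 0\<close> unfolding eqA[symmetric] supp_def by blast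
  obtain \<C> where \<C>: "countable \<C>"
    "\<forall>\<gamma> e. \<gamma> \<in> Curves T \<Omega> \<longrightarrow> e > 0 \<longrightarrow> (\<exists>C\<in>\<C>. \<gamma> \<in> C \<and> C \<subseteq> curve_ball T \<Omega> \<gamma> e)"
    using Curves_countable_small_cover[OF \<open>T > 0\<close>, of \<Omega>] by metis
  \<comment> \<open>Members of the cover are not shown to be measurable, so each is enclosed in a
    null set.\<close>
  define \<N> where "\<N> = {C\<in>\<C>. \<exists>N\<in>null_sets \<eta>. C \<subseteq> N}"
  have "\<forall>C\<in>\<N>. \<exists>N. N \<in> null_sets \<eta> \<and> C \<subseteq> N" by (auto simp: \<N>_def)
  then obtain N where N: "\<And>C. C \<in> \<N> \<Longrightarrow> N C \<in> null_sets \<eta>" "\<And>C. C \<in> \<N> \<Longrightarrow> C \<subseteq> N C"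
    by metis
  have "countable \<N>" using \<C>(1) by (rule countable_subset[rotated]) (auto simp: \<N>_def)
  then have null: "(\<Union>C\<in>\<N>. N C) \<in> null_sets \<eta>" using N(1) by (intro null_sets_UN')
  have "A \<subseteq> (\<Union>C\<in>\<N>. N C)"
  proof
    fix \<gamma> assume "\<gamma> \<in> A"
    then have \<gamma>: "\<gamma> \<in> Curves T \<Omega>" "norm (\<gamma> t - x) < \<epsilon>" by (auto simp: A_def dist_norm norm_minus_commute)
    then have "\<gamma> \<notin> supp_curves T \<Omega> \<eta>" using none by blast
    then obtain e where "e > 0" "emeasure \<eta> (curve_ball T \<Omega> \<gamma> e) = 0"
      using \<gamma>(1) by (auto simp: supp_curves_def curve_ball_def)
    then have "curve_ball T \<Omega> \<gamma> e \<in> null_sets \<eta>"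
      using curve_ball_measurable[OF sp se \<open>T > 0\<close> \<gamma>(1)] by (simp add: null_sets_def)
    moreover obtain C where "C \<in> \<C>" "\<gamma> \<in> C" "C \<subseteq> curve_ball T \<Omega> \<gamma> e" using \<C>(2) \<gamma>(1) \<open>e > 0\<close> by blast
    ultimately have "C \<in> \<N>" by (auto simp: \<N>_def)
    then show "\<gamma> \<in> (\<Union>C\<in>\<N>. N C)" using N(2) \<open>\<gamma> \<in> C\<close> by blast
  qed
  then have "emeasure \<eta> A \<le> emeasure \<eta> (\<Union>C\<in>\<N>. N C)" using null by (intro emeasure_mono) auto
  then show False using posA null by auto
qed

section \<open>The Lagrangian and the Hamiltonian\<close>

text \<open>Second-order Taylor expansion of \<open>L y\<close> along the segment from 0 to v, with
  the remainder bounded below by uniform convexity in the velocity.\<close>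

lemma Lagrangian_coercive:
  fixes L :: "'a::euclidean_space \<Rightarrow> 'a \<Rightarrow> real" and DvL :: "'a \<Rightarrow> 'a \<Rightarrow> 'a"
  assumes L0: "\<And>v. ((\<lambda>z. L (fst z) (snd z)) has_derivative
                      (\<lambda>z. DxL y v \<bullet> fst z + DvL y v \<bullet> snd z)) (at (y, v))"
    and L1: "\<And>v. ((\<lambda>z. DvL (fst z) (snd z)) has_derivative
                      (\<lambda>z. Dvx y v (fst z) + Dvv y v (snd z))) (at (y, v))"
    and Dvx0: "\<And>v. Dvx y v 0 = 0"
    and vv: "\<And>v k. (norm k)\<^sup>2 / \<mu> \<le> k \<bullet> Dvv y v k"
  shows "L y v \<ge> L y 0 + DvL y 0 \<bullet> v + (norm v)\<^sup>2 / (2 * \<mu>)"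
proof -
  have lin: "((\<lambda>r. (y, r *\<^sub>R v)) has_derivative (\<lambda>h. (0, h *\<^sub>R v))) (at r)" for r :: real
    by (auto intro!: derivative_eq_intros)
  \<comment> \<open>Linearity is given for the joint derivative on pairs; \<open>Dvx0\<close>
    transfers it to the second component.\<close>
  have Dvv_scale: "Dvv y w (h *\<^sub>R k) = h *\<^sub>R Dvv y w k" for w k and h :: real
    using linear_scale[OF has_derivative_linear[OF L1[of w]], of h "(0, k)"] by (simp add: Dvx0)
  let ?g = "\<lambda>r. L y (r *\<^sub>R v)"
  let ?g' = "\<lambda>r. DvL y (r *\<^sub>R v) \<bullet> v"
  let ?g'' = "\<lambda>r. Dvv y (r *\<^sub>R v) v \<bullet> v"
  have d1: "(?g has_real_derivative ?g' r) (at r)" for r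
  proof -
    have "(?g has_derivative (\<lambda>h. DxL y (r *\<^sub>R v) \<bullet> 0 + DvL y (r *\<^sub>R v) \<bullet> (h *\<^sub>R v))) (at r)"
      using has_derivative_compose[OF lin L0[of "r *\<^sub>R v"]] by simp
    then show ?thesis by (simp add: has_field_derivative_def mult.commute mult_commute_abs)
  qed
  have d2: "(?g' has_real_derivative ?g'' r) (at r)" for r
  proof -
    have "((\<lambda>r. DvL y (r *\<^sub>R v)) has_derivative (\<lambda>h. Dvx y (r *\<^sub>R v) 0 + Dvv y (r *\<^sub>R v) (h *\<^sub>R v))) (at r)"
      using has_derivative_compose[OF lin L1[of "r *\<^sub>R v"]] by simp
    then have "(?g' has_derivative (\<lambda>h. (h *\<^sub>R Dvv y (r *\<^sub>R v) v) \<bullet> v)) (at r)"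
      by (intro has_derivative_inner_left) (simp add: Dvx0 Dvv_scale)
    then show ?thesis by (simp add: has_field_derivative_def mult_commute_abs)
  qed
  define diff where "diff = (\<lambda>k::nat. if k = 0 then ?g else if k = 1 then ?g' else ?g'')"
  have "\<exists>t. 0 < t \<and> t < 1 \<and> ?g 1 = (\<Sum>k<2. diff k 0 / fact k * 1 ^ k) + diff 2 t / fact 2 * 1 ^ 2"
  proof (rule Maclaurin)
    show "\<forall>k t. k < 2 \<and> 0 \<le> t \<and> t \<le> 1 \<longrightarrow> (diff k has_real_derivative diff (Suc k) t) (at t)"
      using d1 d2 by (auto simp: diff_def less_2_cases_iff)
  qed (auto simp: diff_def)
  then obtain r where "?g 1 = (\<Sum>k<2. diff k 0 / fact k * 1 ^ k) + diff 2 r / fact 2 * 1 ^ 2" by blast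
  then have "L y v = L y 0 + DvL y 0 \<bullet> v + ?g'' r / 2" by (simp add: diff_def numeral_2_eq_2)
  moreover have "(norm v)\<^sup>2 / \<mu> \<le> ?g'' r" using vv[of v "r *\<^sub>R v"] by (simp add: inner_commute)
  ultimately show ?thesis by simp
qed

text \<open>Coercivity beats a linear term of slope K + M. Completing the square gives the second
  bound, the value of the quadratic at its vertex norm v = \<mu> * (K + M); it is uniform in v and
  will bound the running cost along curves.\<close>

lemma Ham_integrand_le:
  fixes q v :: "'a::euclidean_space"
  assumes coer: "L y v \<ge> - M - M * norm v + (norm v)\<^sup>2 / (2 * \<mu>)" and "\<mu> > 0" and "norm q \<le> K"
  shows "- (q \<bullet> v) - L y v \<le> M + (K + M) * norm v - (norm v)\<^sup>2 / (2 * \<mu>)"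
    "- (q \<bullet> v) - L y v \<le> M + \<mu> * (K + M)\<^sup>2 / 2"
proof -
  have "- (q \<bullet> v) \<le> norm q * norm v" using Cauchy_Schwarz_ineq2[of q v] by linarith
  also have "\<dots> \<le> K * norm v" using assms(3) by (intro mult_right_mono) auto
  finally show 1: "- (q \<bullet> v) - L y v \<le> M + (K + M) * norm v - (norm v)\<^sup>2 / (2 * \<mu>)"
    using coer by (simp add: algebra_simps)
  have "0 \<le> (norm v - \<mu> * (K + M))\<^sup>2 / (2 * \<mu>)" using \<open>\<mu> > 0\<close> by simp
  also have "\<dots> = (norm v)\<^sup>2 / (2 * \<mu>) - (K + M) * norm v + \<mu> * (K + M)\<^sup>2 / 2"
    using \<open>\<mu> > 0\<close> by (simp add: power2_eq_square field_simps)
  finally show "- (q \<bullet> v) - L y v \<le> M + \<mu> * (K + M)\<^sup>2 / 2" using 1 by linarith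
qed

text \<open>The supremum in \<open>Ham_def\<close> is a real one and dominates its terms only if
  these are bounded above, which coercivity provides.\<close>

lemma Ham_upper:
  assumes coer: "\<And>v. L y v \<ge> - M - M * norm v + (norm v)\<^sup>2 / (2 * \<mu>)" and "\<mu> > 0"
  shows "- (q \<bullet> v) - L y v \<le> Ham L y q"
  unfolding Ham_def
proof (rule cSUP_upper)
  show "bdd_above (range (\<lambda>v. - (q \<bullet> v) - L y v))"
    by (rule bdd_aboveI2[of _ _ "M + \<mu> * (norm q + M)\<^sup>2 / 2"], rule Ham_integrand_le) (use assms in auto)
qed simp

text \<open>Upper semicontinuity of the Hamiltonian, stated for the integrand of its defining supremum.\<close>
lemma Ham_usc:
  fixes x p :: "'a::euclidean_space"
  assumes U: "open U" "x \<in> U" and coer: "\<And>y v. y \<in> U \<Longrightarrow> L y v \<ge> - M - M * norm v + (norm v)\<^sup>2 / (2 * \<mu>)"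
    and "\<mu> > 0" and "M \<ge> 0" and "\<epsilon> > 0"
    and cont: "continuous_on (U \<times> UNIV) (\<lambda>z. L (fst z) (snd z))"
  obtains \<delta> where "\<delta> > 0"
    "\<And>y q v. norm (y - x) \<le> \<delta> \<Longrightarrow> norm (q - p) \<le> \<delta> \<Longrightarrow> - (q \<bullet> v) - L y v \<le> Ham L x p + \<epsilon>"
proof -
  define K where "K = norm p + 1"
  \<comment> \<open>Beyond the first entry the quadratic term beats the linear one by at least norm
    v; beyond the second, what is left is at most - L x 0, the term v = 0 of the supremum for
    \<open>Ham L x p\<close>. Continuity of L is therefore needed only for velocities in a compact
    ball.\<close>
  define R where "R = max (2 * \<mu> * (K + M + 1)) (M + \<bar>L x 0\<bar>)"
  have "R \<ge> 0" using \<open>M \<ge> 0\<close> by (simp add: R_def max.coboundedI2)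
  have H0: "- L x 0 \<le> Ham L x p" using Ham_upper[where L=L and y=x and q=p and v=0, OF coer[OF U(2)] \<open>\<mu> > 0\<close>] by simp
  obtain r where r: "r > 0" "cball x r \<subseteq> U" using U open_contains_cball by blast
  have "uniformly_continuous_on (cball x r \<times> cball 0 R) (\<lambda>z. L (fst z) (snd z))"
    by (rule compact_uniformly_continuous[OF continuous_on_subset[OF cont]])
      (use r in \<open>auto intro!: compact_Times\<close>)
  moreover have "\<epsilon> / 2 > 0" using \<open>\<epsilon> > 0\<close> by simp
  ultimately obtain d where d: "d > 0" "\<forall>z\<in>cball x r \<times> cball 0 R. \<forall>z'\<in>cball x r \<times> cball 0 R.
      dist z' z < d \<longrightarrow> dist (L (fst z') (snd z')) (L (fst z) (snd z)) < \<epsilon> / 2"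
    unfolding uniformly_continuous_on_def by blast
  define \<delta> where "\<delta> = min (min r (d / 2)) (min 1 (\<epsilon> / (2 * (R + 1))))"
  have \<delta>: "\<delta> > 0" "\<delta> \<le> r" "\<delta> < d" "\<delta> \<le> 1" "\<delta> \<le> \<epsilon> / (2 * (R + 1))"
    using r d \<open>\<epsilon> > 0\<close> \<open>R \<ge> 0\<close> by (auto simp: \<delta>_def)
  show thesis
  proof (rule that[OF \<delta>(1)])
    fix y q v assume y: "norm (y - x) \<le> \<delta>" and q: "norm (q - p) \<le> \<delta>"
    have yU: "y \<in> cball x r" "y \<in> U" using y \<delta>(2) r by (auto simp: dist_norm norm_minus_commute)
    have "norm q \<le> K" using norm_triangle_sub[of q p] q \<delta>(4) by (simp add: K_def)
    show "- (q \<bullet> v) - L y v \<le> Ham L x p + \<epsilon>"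
    proof (cases "norm v \<le> R")
      case True
      have "(p - q) \<bullet> v \<le> norm (p - q) * norm v" by (rule norm_cauchy_schwarz)
      also have "\<dots> \<le> \<epsilon> / (2 * (R + 1)) * R"
        using q \<delta>(5) True \<open>\<epsilon> > 0\<close> \<open>R \<ge> 0\<close> by (intro mult_mono) (auto simp: norm_minus_commute intro: order_trans)
      also have "\<dots> \<le> \<epsilon> / 2" using \<open>\<epsilon> > 0\<close> \<open>R \<ge> 0\<close> by (simp add: field_simps)
      finally have "(p - q) \<bullet> v \<le> \<epsilon> / 2" .
      moreover have "dist (L (fst (y, v)) (snd (y, v))) (L (fst (x, v)) (snd (x, v))) < \<epsilon> / 2"
        using y yU True r(1) \<delta>(3) by (intro d(2)[rule_format]) (auto simp: dist_Pair_Pair dist_norm)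
      then have "\<bar>L y v - L x v\<bar> < \<epsilon> / 2" by (simp add: dist_real_def)
      moreover have "- (p \<bullet> v) - L x v \<le> Ham L x p" by (rule Ham_upper[where L=L and y=x, OF coer[OF U(2)] \<open>\<mu> > 0\<close>])
      ultimately show ?thesis unfolding inner_diff_left by linarith
    next
      case False
      then have v: "norm v \<ge> 2 * \<mu> * (K + M + 1)" "norm v \<ge> M + \<bar>L x 0\<bar>" by (auto simp: R_def)
      have "1 \<le> norm v / (2 * \<mu>) - (K + M)" using v(1) \<open>\<mu> > 0\<close> by (simp add: field_simps)
      then have "norm v * 1 \<le> norm v * (norm v / (2 * \<mu>) - (K + M))" by (intro mult_left_mono) auto
      then have "norm v \<le> (norm v)\<^sup>2 / (2 * \<mu>) - (K + M) * norm v" by (simp add: power2_eq_square algebra_simps)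
      then have "- (q \<bullet> v) - L y v \<le> - L x 0"
        using Ham_integrand_le(1)[where L=L and y=y and v=v and q=q, OF coer[OF yU(2)] \<open>\<mu> > 0\<close> \<open>norm q \<le> K\<close>] v(2) by linarith
      then show ?thesis using H0 \<open>\<epsilon> > 0\<close> by linarith
    qed
  qed
qed

section \<open>Test curves and lower bounds for the running cost\<close>

lemma straight_line_curve:
  fixes x v :: "'a::euclidean_space"
  assumes t: "0 \<le> t" "h > 0" "t + h \<le> T" and seg: "\<And>\<tau>. \<tau> \<in> {0..h} \<Longrightarrow> x + \<tau> *\<^sub>R v \<in> closure \<Omega>"
  defines "\<gamma> \<equiv> \<lambda>r. x + (max t (min (t + h) r) - t) *\<^sub>R v"
  shows "\<gamma> \<in> Curves T \<Omega>" "\<gamma> t = x" "\<gamma> (t + h) = x + h *\<^sub>R v"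
    "\<And>s. s \<in> {t<..<t+h} \<Longrightarrow> vector_derivative \<gamma> (at s) = v"
    "\<And>s. s \<in> {t..t+h} \<Longrightarrow> \<gamma> s = x + (s - t) *\<^sub>R v"
proof -
  have "abs_cont_on 0 T \<gamma>"
  proof (rule abs_cont_on_lipschitz[of _ _ _ "norm v"])
    fix r s :: real assume "r \<le> s"
    have "\<gamma> s - \<gamma> r = (max t (min (t + h) s) - max t (min (t + h) r)) *\<^sub>R v"
      by (simp add: \<gamma>_def flip: scaleR_diff_left)
    then have "norm (\<gamma> s - \<gamma> r) = \<bar>max t (min (t + h) s) - max t (min (t + h) r)\<bar> * norm v" by simp
    also have "\<dots> \<le> (s - r) * norm v" using \<open>r \<le> s\<close> by (intro mult_right_mono) auto
    finally show "norm (\<gamma> s - \<gamma> r) \<le> norm v * (s - r)" by (simp add: mult.commute)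
  qed
  moreover have "\<gamma> r \<in> closure \<Omega>" for r
    unfolding \<gamma>_def using t by (intro seg) auto
  moreover have "\<gamma> r = \<gamma> (min T (max 0 r))" for r
  proof -
    \<comment> \<open>The clamp to [t, t + h] absorbs the clamp to [0, T], because 0 \<le> t and t +
      h \<le> T.\<close>
    have "max t (min (t + h) r) = max t (min (t + h) (min T (max 0 r)))"
      using t by (cases "r < 0"; cases "r > T") (simp_all add: min_def max_def)
    then show ?thesis unfolding \<gamma>_def by (rule arg_cong[where f="\<lambda>a. x + (a - t) *\<^sub>R v"])
  qed
  ultimately show "\<gamma> \<in> Curves T \<Omega>" unfolding Curves_def by simp
  show "\<gamma> t = x" "\<gamma> (t + h) = x + h *\<^sub>R v" using t by (auto simp: \<gamma>_def)
  show \<gamma>_eq: "\<gamma> s = x + (s - t) *\<^sub>R v" if "s \<in> {t..t+h}" for s using that by (auto simp: \<gamma>_def)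
  show "vector_derivative \<gamma> (at s) = v" if s: "s \<in> {t<..<t+h}" for s
  proof (rule vector_derivative_at)
    have "((\<lambda>s. x + (s - t) *\<^sub>R v) has_vector_derivative v) (at s)"
      by (auto intro!: derivative_eq_intros)
    then show "(\<gamma> has_vector_derivative v) (at s)"
      by (rule has_vector_derivative_transform_within_open[OF _ _ s]) (auto simp: \<gamma>_eq)
  qed
qed

text \<open>An affine function of the velocity integrates to a boundary term along an absolutely
  continuous curve, so only the endpoints enter. The slope q is free: a steep one yields
  confinement, one close to p2 the sharp estimate.\<close>

lemma curve_cost_integral_ge:
  fixes \<gamma> :: "real \<Rightarrow> 'a::euclidean_space"
  assumes \<gamma>: "\<gamma> \<in> Curves T \<Omega>" and st: "0 \<le> s" "s \<le> t" "t \<le> T"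
    and int: "curve_cost L F m \<gamma> absolutely_integrable_on {s..t}"
    and ge: "\<And>r v. r \<in> {s..t} \<Longrightarrow> - (q \<bullet> v) + c \<le> L (\<gamma> r) v + F (\<gamma> r) (m r)"
  shows "q \<bullet> (\<gamma> s - \<gamma> t) + c * (t - s) \<le> integral {s..t} (curve_cost L F m \<gamma>)"
proof -
  let ?f = "\<lambda>r. (- q) \<bullet> \<gamma> r"
  have ac: "abs_cont_on s t \<gamma>"
    using \<gamma> st by (intro abs_cont_on_compose[of 0 T \<gamma> s t "\<lambda>r. r"]) (auto simp: Curves_def)
  \<comment> \<open>The endpoints are added because differentiability almost everywhere is stated in
    the open interval only.\<close>
  define N where "N = {r\<in>{s<..<t}. \<not> \<gamma> differentiable (at r)} \<union> {s, t}"
  have "negligible N" unfolding N_def by (intro negligible_Un abs_cont_on_differentiable_ae[OF ac]) auto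
  have "((\<lambda>r. (- q) \<bullet> vector_derivative \<gamma> (at r)) has_integral (?f t - ?f s)) {s..t}"
  proof (rule abs_cont_on_has_integral[OF abs_cont_on_inner[OF ac] st(2) \<open>negligible N\<close>])
    fix r assume "r \<in> {s..t} - N"
    then have "\<gamma> differentiable (at r)" by (auto simp: N_def)
    then have "(\<gamma> has_derivative (\<lambda>h. h *\<^sub>R vector_derivative \<gamma> (at r))) (at r)"
      by (simp add: vector_derivative_works has_vector_derivative_def)
    then have "(?f has_derivative (\<lambda>h. (- q) \<bullet> (h *\<^sub>R vector_derivative \<gamma> (at r)))) (at r)"
      by (rule has_derivative_inner_right)
    moreover have "(\<lambda>h. (- q) \<bullet> (h *\<^sub>R vector_derivative \<gamma> (at r))) = (*) ((- q) \<bullet> vector_derivative \<gamma> (at r))"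
      by (auto simp: fun_eq_iff)
    ultimately show "(?f has_real_derivative (- q) \<bullet> vector_derivative \<gamma> (at r)) (at r)"
      unfolding has_field_derivative_def by (simp only:)
  qed
  then have "((\<lambda>r. (- q) \<bullet> vector_derivative \<gamma> (at r) + c) has_integral (?f t - ?f s + c * (t - s))) {s..t}"
    using has_integral_const_real[of c s t] st(2) by (intro has_integral_add) (auto simp: mult.commute)
  moreover have "(curve_cost L F m \<gamma> has_integral integral {s..t} (curve_cost L F m \<gamma>)) {s..t}"
    using int by (simp add: absolutely_integrable_on_def integrable_integral)
  \<comment> \<open>The bound holds for every v, so the junk values of the derivative on N do no harm.\<close>
  ultimately have "?f t - ?f s + c * (t - s) \<le> integral {s..t} (curve_cost L F m \<gamma>)"
    by (rule has_integral_le) (use ge in auto)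
  then show ?thesis by (simp add: inner_diff_right)
qed

text \<open>With \<open>sgn\<close> as the unit direction the identity also holds at 0, so a curve
  with zero displacement needs no separate treatment.\<close>

lemma sgn_inner_self: "sgn z \<bullet> z = norm z" for z :: "'a::real_inner"
  by (cases "z = 0") (simp_all add: sgn_div_norm dot_square_norm power2_eq_square)

text \<open>The Lipschitz bound in the measure is uniform in the position, so it combines with
  continuity in the position at the single measure \<open>m t\<close>.\<close>

lemma coupling_continuous_on:
  fixes \<Omega> U :: "'a::euclidean_space set" and F :: "'a \<Rightarrow> 'a measure \<Rightarrow> real" and T :: real
  assumes U: "closure \<Omega> \<subseteq> U"
    and lip: "\<And>y m1 m2. y \<in> U \<Longrightarrow> m1 \<in> Prob_cl \<Omega> \<Longrightarrow> m2 \<in> Prob_cl \<Omega> \<Longrightarrow> \<bar>F y m1 - F y m2\<bar> \<le> \<kappa> * d1 m1 m2"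
    and "\<kappa> \<ge> 0"
    and cont: "\<And>n y. n \<in> Prob_cl \<Omega> \<Longrightarrow> y \<in> U \<Longrightarrow> isCont (\<lambda>z. F z n) y"
    and m: "\<And>t. t \<in> {0..T} \<Longrightarrow> m t \<in> Prob_cl \<Omega>"
    and mcont: "\<And>t e. t \<in> {0..T} \<Longrightarrow> e > 0 \<Longrightarrow> \<exists>d>0. \<forall>s\<in>{0..T}. \<bar>s - t\<bar> < d \<longrightarrow> d1 (m s) (m t) < e"
  shows "continuous_on ({0..T} \<times> closure \<Omega>) (\<lambda>z. F (snd z) (m (fst z)))"
  unfolding continuous_on_iff
proof (intro ballI allI impI)
  fix z and e :: real assume z: "z \<in> {0..T} \<times> closure \<Omega>" and "e > 0"
  obtain t y where ty: "z = (t, y)" "t \<in> {0..T}" "y \<in> closure \<Omega>" using z by auto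
  define e1 where "e1 = e / (2 * (\<kappa> + 1))"
  have "e1 > 0" using \<open>e > 0\<close> \<open>\<kappa> \<ge> 0\<close> by (simp add: e1_def)
  have e1: "\<kappa> * e1 \<le> e / 2" using \<open>e > 0\<close> \<open>\<kappa> \<ge> 0\<close> by (simp add: e1_def field_simps)
  obtain da where da: "da > 0" "\<And>s. s \<in> {0..T} \<Longrightarrow> \<bar>s - t\<bar> < da \<Longrightarrow> d1 (m s) (m t) < e1"
    using mcont[OF ty(2) \<open>e1 > 0\<close>] by blast
  have "isCont (\<lambda>z. F z (m t)) y" using cont m ty U by blast
  then obtain db where db: "db > 0" "\<And>y'. dist y' y < db \<Longrightarrow> dist (F y' (m t)) (F y (m t)) < e / 2"
    unfolding continuous_at_eps_delta using half_gt_zero[OF \<open>e > 0\<close>] by blast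
  show "\<exists>d>0. \<forall>z'\<in>{0..T} \<times> closure \<Omega>. dist z' z < d \<longrightarrow> dist (F (snd z') (m (fst z'))) (F (snd z) (m (fst z))) < e"
  proof (intro exI[of _ "min da db"] conjI ballI impI)
    show "min da db > 0" using da db by simp
    fix z' assume z': "z' \<in> {0..T} \<times> closure \<Omega>" "dist z' z < min da db"
    obtain s y' where sy: "z' = (s, y')" "s \<in> {0..T}" "y' \<in> closure \<Omega>" using z' by auto
    have "dist s t < da" "dist y' y < db"
      using dist_fst_le[of z' z] dist_snd_le[of z' z] z'(2) sy ty by auto
    then have "d1 (m s) (m t) < e1" "\<bar>F y' (m t) - F y (m t)\<bar> < e / 2"
      using da(2) db(2) sy by (auto simp: dist_real_def)
    moreover have "\<bar>F y' (m s) - F y' (m t)\<bar> \<le> \<kappa> * d1 (m s) (m t)" using sy ty U m by (intro lip) auto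
    moreover have "\<kappa> * d1 (m s) (m t) \<le> \<kappa> * e1" using \<open>\<kappa> \<ge> 0\<close> \<open>d1 (m s) (m t) < e1\<close> by (intro mult_left_mono) auto
    ultimately have "\<bar>F y' (m s) - F y (m t)\<bar> < e" using e1 by linarith
    then show "dist (F (snd z') (m (fst z'))) (F (snd z) (m (fst z))) < e" using sy ty by (simp add: dist_real_def)
  qed
qed

theorem theorem4p10:
  fixes \<Omega> U :: "'a::euclidean_space set"
    and T \<kappa> M \<mu> :: real
    and L :: "'a \<Rightarrow> 'a \<Rightarrow> real"
    and DxL DvL :: "'a \<Rightarrow> 'a \<Rightarrow> 'a"
    and Dvx Dvv :: "'a \<Rightarrow> 'a \<Rightarrow> 'a \<Rightarrow> 'a"
    and F G :: "'a \<Rightarrow> 'a measure \<Rightarrow> real"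
    and m0 :: "'a measure"
    and u :: "real \<Rightarrow> 'a \<Rightarrow> real"
    and m :: "real \<Rightarrow> 'a measure"
    and t :: real and x :: 'a
  assumes T_pos: "T > 0"
    and Omega: "bounded \<Omega>" "open \<Omega>" "C2_boundary \<Omega>"
    and U: "open U" "closure \<Omega> \<subseteq> U"
    \<comment> \<open>(D1)\<close>
    and D1: "\<forall>y\<in>U. \<forall>m1\<in>Prob_cl \<Omega>. \<forall>m2\<in>Prob_cl \<Omega>.
               \<bar>F y m1 - F y m2\<bar> + \<bar>G y m1 - G y m2\<bar> \<le> \<kappa> * d1 m1 m2"
    \<comment> \<open>(D2)\<close>
    and D2: "\<forall>n\<in>Prob_cl \<Omega>. \<exists>DF DG. bounded ((\<lambda>y. F y n) ` U) \<and> bounded ((\<lambda>y. G y n) ` U) \<and>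
               continuous_on U DF \<and> continuous_on U DG \<and>
               (\<forall>y\<in>U. ((\<lambda>z. F z n) has_derivative (\<lambda>h. DF y \<bullet> h)) (at y) \<and>
                       ((\<lambda>z. G z n) has_derivative (\<lambda>h. DG y \<bullet> h)) (at y) \<and>
                       norm (DF y) + norm (DG y) \<le> \<kappa>)"
    \<comment> \<open>(D3)\<close>
    and D3: "\<exists>C. \<forall>n\<in>Prob_cl \<Omega>. semiconcave_lin C U (\<lambda>y. F y n)"
    \<comment> \<open>(L0)\<close>
    and L0_deriv: "\<forall>y\<in>U. \<forall>v. ((\<lambda>z. L (fst z) (snd z)) has_derivative
                      (\<lambda>z. DxL y v \<bullet> fst z + DvL y v \<bullet> snd z)) (at (y, v))"
    and L0_cont: "continuous_on (U \<times> UNIV) (\<lambda>z. DxL (fst z) (snd z))"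
                 "continuous_on (U \<times> UNIV) (\<lambda>z. DvL (fst z) (snd z))"
    and L0_bound: "\<forall>y\<in>U. \<bar>L y 0\<bar> + norm (DxL y 0) + norm (DvL y 0) \<le> M"
    \<comment> \<open>(L1)\<close>
    and L1_deriv: "\<forall>y\<in>U. \<forall>v. ((\<lambda>z. DvL (fst z) (snd z)) has_derivative
                      (\<lambda>z. Dvx y v (fst z) + Dvv y v (snd z))) (at (y, v))"
    and L1_vv: "\<forall>y\<in>U. \<forall>v k. (norm k)^2 / \<mu> \<le> k \<bullet> Dvv y v k \<and> k \<bullet> Dvv y v k \<le> \<mu> * (norm k)^2"
    and L1_vx: "\<forall>y\<in>U. \<forall>v h. norm (Dvx y v h) \<le> \<mu> * (1 + norm v) * norm h"
    and mu_pos: "\<mu> > 0"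
    \<comment> \<open>(L2)\<close>
    and L2: "\<forall>R. \<exists>C. \<forall>y\<in>U. \<forall>v\<in>cball 0 R. \<forall>w\<in>cball 0 R.
               norm (DxL y v - DxL y w) \<le> C * norm (v - w)"
    \<comment> \<open>(L3)\<close>
    and L3: "\<forall>R. \<exists>C. \<forall>v\<in>cball 0 R. semiconcave_lin C U (\<lambda>y. L y v)"
    \<comment> \<open>the mild solution and the point\<close>
    and m0: "m0 \<in> Prob_cl \<Omega>"
    and mild: "mild_solution L F G T \<Omega> m0 u m"
    and tx: "(t, x) \<in> Qset T \<Omega> m"
  shows "\<forall>(p1, p2)\<in>superdiff T \<Omega> u t x. - p1 + Ham L x p2 = F x (m t)"
proof (rule ballI, clarify)
  fix p1 :: real and p2 :: 'a
  assume p: "(p1, p2) \<in> superdiff T \<Omega> u t x"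
  have t: "0 < t" "t < T" and x: "x \<in> \<Omega>" and xsupp: "x \<in> supp (m t)"
    using tx by (auto simp: Qset_def)
  have xcl: "x \<in> closure \<Omega>" and xU: "x \<in> U" using x U closure_subset by blast+
  have ucont: "continuous_on ({0..T} \<times> closure \<Omega>) (\<lambda>z. u (fst z) (snd z))"
    and mP: "\<And>s. s \<in> {0..T} \<Longrightarrow> m s \<in> Prob_cl \<Omega>"
    and mcont: "\<And>s e. s \<in> {0..T} \<Longrightarrow> e > 0 \<Longrightarrow> \<exists>d>0. \<forall>r\<in>{0..T}. \<bar>r - s\<bar> < d \<longrightarrow> d1 (m r) (m s) < e"
    using mild unfolding mild_solution_def by blast+
  obtain \<eta> where eq: "constrained_equilibrium L F G T \<Omega> m0 \<eta>"
    and m\<eta>: "\<And>s. s \<in> {0..T} \<Longrightarrow> m s = flow \<eta> s"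
    and u: "\<And>s y. s \<in> {0..T} \<Longrightarrow> y \<in> closure \<Omega> \<Longrightarrow>
        ereal (u s y) = (INF \<gamma>\<in>{\<gamma>\<in>Curves T \<Omega>. \<gamma> s = y}. total_cost L F G T m s \<gamma>)"
    using mild unfolding mild_solution_def by blast
  \<comment> \<open>The signs of M and \<kappa> come from the bounds at x, whose left-hand sides are
    nonnegative.\<close>
  have "M \<ge> 0" using L0_bound xU by (meson abs_ge_zero add_nonneg_nonneg norm_ge_zero order_trans)
  obtain DF DG :: "'a \<Rightarrow> 'a" where "norm (DF x) + norm (DG x) \<le> \<kappa>" using D2 mP[of t] t xU by fastforce
  then have "\<kappa> \<ge> 0" by (meson add_nonneg_nonneg norm_ge_zero order_trans)
  have coer: "L y v \<ge> - M - M * norm v + (norm v)\<^sup>2 / (2 * \<mu>)" if "y \<in> U" for y v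
  proof -
    have "Dvx y w 0 = 0" for w using L1_vx[rule_format, OF that, of w 0] by simp
    then have "L y v \<ge> L y 0 + DvL y 0 \<bullet> v + (norm v)\<^sup>2 / (2 * \<mu>)"
      using L0_deriv L1_deriv L1_vv that by (intro Lagrangian_coercive[of L DxL y DvL Dvx Dvv \<mu>]) blast+
    moreover have b: "\<bar>L y 0\<bar> \<le> M" "norm (DvL y 0) \<le> M"
      using L0_bound[rule_format, OF that] norm_ge_zero[of "DxL y 0"] norm_ge_zero[of "DvL y 0"] abs_ge_zero[of "L y 0"]
      by linarith+
    moreover have "\<bar>DvL y 0 \<bullet> v\<bar> \<le> M * norm v"
      using Cauchy_Schwarz_ineq2[of "DvL y 0" v] mult_right_mono[OF b(2), of "norm v"] by simp
    ultimately show ?thesis by linarith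
  qed
  have Lcont: "continuous_on (U \<times> UNIV) (\<lambda>z. L (fst z) (snd z))"
    using L0_deriv by (intro continuous_at_imp_continuous_on) (force intro: has_derivative_continuous)
  have Fcont: "continuous_on ({0..T} \<times> closure \<Omega>) (\<lambda>z. F (snd z) (m (fst z)))"
  proof (rule coupling_continuous_on[OF U(2) _ \<open>\<kappa> \<ge> 0\<close> _ mP mcont])
    show "\<bar>F y m1 - F y m2\<bar> \<le> \<kappa> * d1 m1 m2" if "y \<in> U" "m1 \<in> Prob_cl \<Omega>" "m2 \<in> Prob_cl \<Omega>" for y m1 m2
      using D1[rule_format, OF that] by linarith
    show "isCont (\<lambda>z. F z n) y" if "n \<in> Prob_cl \<Omega>" "y \<in> U" for n y
      using D2[rule_format, OF that(1)] that(2) has_derivative_continuous by blast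
  qed
  have cpt: "compact ({0..T} \<times> closure \<Omega>)" using Omega(1) by (intro compact_Times) (auto simp: compact_closure)
  have super: "\<exists>d>0. \<forall>s y. s \<in> {0<..<T} \<and> y \<in> closure \<Omega> \<and> (s, y) \<noteq> (t, x) \<and> \<bar>s - t\<bar> + norm (y - x) < d \<longrightarrow>
      u s y - u t x - p1 * (s - t) - p2 \<bullet> (y - x) \<le> e * (\<bar>s - t\<bar> + norm (y - x))" if "e > 0" for e
    using p that unfolding superdiff_def by blast

  have "- (p2 \<bullet> v) - L x v \<le> p1 + F x (m t)" for v
  proof (rule field_le_epsilon)
    fix e :: real assume "e > 0"
    \<comment> \<open>With this choice the superdifferential error at (t + h, x + h v) is h * e / 2.
      The other half of e pays for the variation of the running cost.\<close>
    define e0 where "e0 = e / (2 * (1 + norm v))"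
    have "1 + norm v > 0" by (simp add: add_pos_nonneg)
    then have "e0 > 0" and e0: "e0 * (1 + norm v) = e / 2" using \<open>e > 0\<close> by (auto simp: e0_def field_simps)
    obtain d where "d > 0" and d: "\<And>s y. s \<in> {0<..<T} \<Longrightarrow> y \<in> closure \<Omega> \<Longrightarrow> (s, y) \<noteq> (t, x) \<Longrightarrow> \<bar>s - t\<bar> + norm (y - x) < d \<Longrightarrow>
        u s y - u t x - p1 * (s - t) - p2 \<bullet> (y - x) \<le> e0 * (\<bar>s - t\<bar> + norm (y - x))"
      using super[OF \<open>e0 > 0\<close>] by blast
    obtain r where r: "r > 0" "ball x r \<subseteq> \<Omega>" using openE[OF Omega(2) x] by blast
    \<comment> \<open>The three bounds keep t + h0 before T, the segment in the ball around x inside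
      \<Omega>, and the test point within the range d.\<close>
    define h0 where "h0 = min ((T - t) / 2) (min (r / (2 * (1 + norm v))) (d / (2 * (1 + norm v))))"
    have "h0 > 0" using t r \<open>d > 0\<close> \<open>1 + norm v > 0\<close> by (simp add: h0_def)
    have h0: "t + h0 < T" "h0 * (1 + norm v) < r" "h0 * (1 + norm v) < d"
    proof -
      show "t + h0 < T" using t by (simp add: h0_def min_def field_simps)
      have half: "c / (2 * a) * a = c / 2" if "a > 0" for a c :: real using that by simp
      have "h0 * (1 + norm v) \<le> r / (2 * (1 + norm v)) * (1 + norm v)" "h0 * (1 + norm v) \<le> d / (2 * (1 + norm v)) * (1 + norm v)"
        using \<open>1 + norm v > 0\<close> by (intro mult_right_mono; simp add: h0_def)+
      then show "h0 * (1 + norm v) < r" "h0 * (1 + norm v) < d"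
        using r(1) \<open>d > 0\<close> unfolding half[OF \<open>1 + norm v > 0\<close>] by linarith+
    qed
    have seg: "x + \<tau> *\<^sub>R v \<in> closure \<Omega>" if "\<tau> \<in> {0..h0}" for \<tau>
    proof -
      have "norm (\<tau> *\<^sub>R v) \<le> h0 * (1 + norm v)" using that by (auto intro!: mult_mono)
      then have "x + \<tau> *\<^sub>R v \<in> ball x r" using h0(2) by (simp add: dist_norm)
      then show ?thesis using r(2) closure_subset by blast
    qed
    \<comment> \<open>Running cost with the velocity frozen at v. It is continuous up to the
      endpoints, where the two-sided derivative of the stopped line need not be v.\<close>
    define lc where "lc s = L (x + (s - t) *\<^sub>R v) v + F (x + (s - t) *\<^sub>R v) (m s)" for s
    have lccont: "continuous_on {t..t+h0} lc"
    proof -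
      have "continuous_on {t..t+h0} (\<lambda>s. L (fst (x + (s - t) *\<^sub>R v, v)) (snd (x + (s - t) *\<^sub>R v, v)))"
        by (rule continuous_on_compose2[OF Lcont]) (use seg U(2) in \<open>auto intro!: continuous_intros\<close>)
      moreover have "continuous_on {t..t+h0} (\<lambda>s. F (snd (s, x + (s - t) *\<^sub>R v)) (m (fst (s, x + (s - t) *\<^sub>R v))))"
        by (rule continuous_on_compose2[OF Fcont]) (use seg t h0(1) in \<open>auto intro!: continuous_intros\<close>)
      ultimately show ?thesis unfolding lc_def by (intro continuous_on_add) simp_all
    qed
    obtain d' where "d' > 0" and d': "\<And>s. s \<in> {t..t+h0} \<Longrightarrow> dist s t < d' \<Longrightarrow> dist (lc s) (lc t) < e / 2"
      using lccont[unfolded continuous_on_iff, rule_format, of t "e/2"] \<open>e > 0\<close> \<open>h0 > 0\<close> by auto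
    define h where "h = min h0 (d' / 2)"
    have h: "h > 0" "h \<le> h0" "h < d'" using \<open>h0 > 0\<close> \<open>d' > 0\<close> by (auto simp: h_def)
    define \<gamma> where "\<gamma> = (\<lambda>r. x + (max t (min (t + h) r) - t) *\<^sub>R v)"
    have "0 \<le> t" "t + h \<le> T" using t h h0 by auto
    moreover have "x + \<tau> *\<^sub>R v \<in> closure \<Omega>" if "\<tau> \<in> {0..h}" for \<tau> using seg that h by auto
    ultimately have \<gamma>: "\<gamma> \<in> Curves T \<Omega>" "\<gamma> t = x" "\<gamma> (t + h) = x + h *\<^sub>R v"
      "\<And>s. s \<in> {t<..<t+h} \<Longrightarrow> vector_derivative \<gamma> (at s) = v"
      "\<And>s. s \<in> {t..t+h} \<Longrightarrow> \<gamma> s = x + (s - t) *\<^sub>R v"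
      using straight_line_curve[of t h T x v \<Omega>] \<open>h > 0\<close> unfolding \<gamma>_def by blast+
    have neg: "negligible {t, t + h}" by (intro negligible_finite) auto
    have cost_eq: "curve_cost L F m \<gamma> s = lc s" if "s \<in> {t..t+h} - {t, t + h}" for s
      using \<gamma>(4)[of s] \<gamma>(5)[of s] that by (simp add: lc_def)
    have "continuous_on {t..t+h} lc" using lccont h by (elim continuous_on_subset) auto
    then have lcint: "lc absolutely_integrable_on {t..t+h}" by (rule absolutely_integrable_continuous_real)
    have "u t (\<gamma> t) \<le> integral {t..t+h} (curve_cost L F m \<gamma>) + u (t + h) (\<gamma> (t + h))"
    proof (rule value_le_dynamic_programming[OF u \<gamma>(1)])
      show "curve_cost L F m \<gamma> absolutely_integrable_on {t..t+h}"
        by (rule absolutely_integrable_spike[OF lcint neg]) (rule cost_eq)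
    qed (use t h h0 in auto)
    also have "integral {t..t+h} (curve_cost L F m \<gamma>) = integral {t..t+h} lc"
      by (rule integral_spike[OF neg]) (rule cost_eq[symmetric])
    also have "\<dots> \<le> (lc t + e / 2) * h"
    proof (rule has_integral_le)
      show "(lc has_integral integral {t..t+h} lc) {t..t+h}"
        using lcint by (simp add: absolutely_integrable_on_def integrable_integral)
      show "((\<lambda>_. lc t + e / 2) has_integral (lc t + e / 2) * h) {t..t+h}"
        using has_integral_const_real[of "lc t + e / 2" t "t + h"] h(1) by (simp add: mult.commute)
      fix s assume "s \<in> {t..t+h}"
      then have "dist (lc s) (lc t) < e / 2" using h by (intro d') (auto simp: dist_real_def)
      then show "lc s \<le> lc t + e / 2" unfolding dist_real_def by linarith
    qed
    finally have "u t x \<le> (lc t + e / 2) * h + u (t + h) (x + h *\<^sub>R v)" using \<gamma>(2,3) by simp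
    moreover have "u (t + h) (x + h *\<^sub>R v) - u t x - p1 * (t + h - t) - p2 \<bullet> (x + h *\<^sub>R v - x)
        \<le> e0 * (\<bar>t + h - t\<bar> + norm (x + h *\<^sub>R v - x))"
    proof (rule d)
      show "x + h *\<^sub>R v \<in> closure \<Omega>" using seg h by auto
      have "h * (1 + norm v) \<le> h0 * (1 + norm v)" using h \<open>1 + norm v > 0\<close> by (intro mult_right_mono) auto
      then show "\<bar>t + h - t\<bar> + norm (x + h *\<^sub>R v - x) < d" using h(1) h0(3) by (simp add: algebra_simps)
    qed (use t h h0 in auto)
    then have "u (t + h) (x + h *\<^sub>R v) - u t x \<le> (p1 + p2 \<bullet> v + e0 * (1 + norm v)) * h"
      using h(1) by (simp add: algebra_simps)
    ultimately have "0 \<le> (lc t + e / 2 + (p1 + p2 \<bullet> v + e / 2)) * h" unfolding e0 by (simp add: algebra_simps)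
    then have "0 \<le> lc t + e + p1 + p2 \<bullet> v" using h(1) by (simp add: zero_le_mult_iff)
    then show "- (p2 \<bullet> v) - L x v \<le> p1 + F x (m t) + e" by (simp add: lc_def)
  qed
  then have le: "Ham L x p2 \<le> p1 + F x (m t)"
    unfolding Ham_def by (intro cSUP_least) auto

  \<comment> \<open>Of the 4 * \<epsilon>, two come from the lower bound on L and F near (t, x), one
    from the superdifferential error in time, and one from replacing \<gamma> t by x.\<close>
  have ge: "F x (m t) \<le> - p1 + Ham L x p2 + 4 * \<epsilon>" if "\<epsilon> > 0" for \<epsilon>
  proof -
    obtain B where B: "\<And>s y. s \<in> {0..T} \<Longrightarrow> y \<in> closure \<Omega> \<Longrightarrow> \<bar>u s y\<bar> \<le> B"
      using compact_imp_bounded[OF compact_continuous_image[OF ucont cpt]] by (force simp: bounded_iff)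
    obtain CF where CF: "\<And>s y. s \<in> {0..T} \<Longrightarrow> y \<in> closure \<Omega> \<Longrightarrow> \<bar>F y (m s)\<bar> \<le> CF"
      using compact_imp_bounded[OF compact_continuous_image[OF Fcont cpt]] by (force simp: bounded_iff)
    have "B \<ge> 0" "CF \<ge> 0" using B[of t x] CF[of t x] t xcl by auto
    obtain \<delta> where "\<delta> > 0" and \<delta>: "\<And>y q v. norm (y - x) \<le> \<delta> \<Longrightarrow> norm (q - p2) \<le> \<delta> \<Longrightarrow> - (q \<bullet> v) - L y v \<le> Ham L x p2 + \<epsilon>"
      using Ham_usc[where L=L and p=p2, OF U(1) xU coer mu_pos \<open>M \<ge> 0\<close> \<open>\<epsilon> > 0\<close> Lcont] by blast
    obtain \<delta>F where "\<delta>F > 0" and \<delta>F: "\<And>z. z \<in> {0..T} \<times> closure \<Omega> \<Longrightarrow> dist z (t, x) < \<delta>F \<Longrightarrow> dist (F (snd z) (m (fst z))) (F x (m t)) < \<epsilon>"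
      using Fcont[unfolded continuous_on_iff, rule_format, of "(t, x)" \<epsilon>] \<open>\<epsilon> > 0\<close> t xcl by auto
    \<comment> \<open>The bound e \<le> \<delta> keeps the tilted slope q in the range of
      semicontinuity; e \<le> \<epsilon> controls the error in time.\<close>
    define e where "e = min \<epsilon> \<delta>"
    have e: "e > 0" "e \<le> \<epsilon>" "e \<le> \<delta>" using \<open>\<epsilon> > 0\<close> \<open>\<delta> > 0\<close> by (auto simp: e_def)
    obtain d where "d > 0" and d: "\<And>s y. s \<in> {0<..<T} \<Longrightarrow> y \<in> closure \<Omega> \<Longrightarrow> (s, y) \<noteq> (t, x) \<Longrightarrow> \<bar>s - t\<bar> + norm (y - x) < d \<Longrightarrow>
        u s y - u t x - p1 * (s - t) - p2 \<bullet> (y - x) \<le> e * (\<bar>s - t\<bar> + norm (y - x))"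
      using super[OF e(1)] by blast
    \<comment> \<open>The halves leave room for time distances, which will also be below
      \<rho>.\<close>
    define \<rho> where "\<rho> = min \<delta> (min (\<delta>F / 2) (d / 2))"
    have \<rho>: "\<rho> > 0" "\<rho> \<le> \<delta>" "\<rho> \<le> \<delta>F / 2" "\<rho> \<le> d / 2" using \<open>\<delta> > 0\<close> \<open>\<delta>F > 0\<close> \<open>d > 0\<close> by (auto simp: \<rho>_def)
    \<comment> \<open>A displacement of \<rho> / 2 would cost K * \<rho> / 2 = 4 * (B + 1), more
      than the 2 * B + 1 available from the two values of u and from C * h \<le> 1.\<close>
    define K where "K = 8 * (B + 1) / \<rho>"
    have "K > 0" using \<rho> \<open>B \<ge> 0\<close> by (simp add: K_def)
    \<comment> \<open>For every q with norm q \<le> K, the running cost is at least - (q \<bullet>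
      v) - C.\<close>
    define C where "C = M + \<mu> * (K + M)\<^sup>2 / 2 + CF"
    have "C \<ge> 0" using \<open>M \<ge> 0\<close> \<open>CF \<ge> 0\<close> mu_pos by (simp add: C_def)
    \<comment> \<open>No quantity entering here involves a curve, so h can be fixed before the curve
      is selected.\<close>
    define h where "h = min (t / 2) (min (\<rho> / 2) (1 / (C + 1)))"
    have h: "h > 0" "h < t" "h < \<rho>" "h \<le> 1 / (C + 1)" using t \<rho> \<open>C \<ge> 0\<close> by (auto simp: h_def min_def)
    have Ch: "C * h \<le> 1" using h(1,4) \<open>C \<ge> 0\<close> by (simp add: field_simps)
    have "\<epsilon> * h / 2 > 0" using \<open>\<epsilon> > 0\<close> h by simp
    then obtain \<delta>u where "\<delta>u > 0" and \<delta>u: "\<And>z. z \<in> {0..T} \<times> closure \<Omega> \<Longrightarrow> dist z (t, x) < \<delta>u \<Longrightarrow> dist (u (fst z) (snd z)) (u t x) < \<epsilon> * h / 2"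
      using ucont[unfolded continuous_on_iff, rule_format, of "(t, x)" "\<epsilon> * h / 2"] t xcl by auto
    \<comment> \<open>The radius may depend on h: the errors from having \<gamma> t in place of x
      are then at most multiples of \<epsilon> * h and stay of order \<epsilon> after division by h.
      The bound \<rho> / 2 is the share of the endpoint in the confinement radius.\<close>
    define \<sigma> where "\<sigma> = min (\<rho> / 2) (min \<delta>u (\<epsilon> * h / (2 * (norm p2 + e))))"
    have pe: "norm p2 + e > 0" using e by (simp add: add_nonneg_pos)
    have "\<epsilon> * h / (2 * (norm p2 + e)) > 0" using \<open>\<epsilon> > 0\<close> h(1) pe by (intro divide_pos_pos mult_pos_pos) auto
    then have \<sigma>: "\<sigma> > 0" "\<sigma> \<le> \<rho> / 2" "\<sigma> \<le> \<delta>u" "\<sigma> \<le> \<epsilon> * h / (2 * (norm p2 + e))"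
      using \<rho>(1) \<open>\<delta>u > 0\<close> unfolding \<sigma>_def by linarith+
    obtain \<gamma> where \<gamma>s: "\<gamma> \<in> supp_curves T \<Omega> \<eta>" and \<gamma>x: "norm (\<gamma> t - x) < \<sigma>"
      using supp_flow_curve[of \<eta> T \<Omega> x t \<sigma>] eq T_pos \<sigma>(1) xsupp m\<eta>[of t] t
      unfolding constrained_equilibrium_def by auto
    obtain x0 where opt: "\<gamma> \<in> optimal_curves L F G T \<Omega> \<eta> x0"
      using \<gamma>s eq unfolding constrained_equilibrium_def by blast
    then have \<gamma>: "\<gamma> \<in> Curves T \<Omega>" by (simp add: optimal_curves_def)
    have cl: "\<gamma> r \<in> closure \<Omega>" if "r \<in> {0..T}" for r using \<gamma> that by (auto simp: Curves_def)
    have int: "curve_cost L F m \<gamma> absolutely_integrable_on {r..t}" if "0 \<le> r" for r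
      by (rule absolutely_integrable_on_subinterval[OF optimal_curve_value(1)[OF u T_pos m\<eta> opt, of 0 0]]) (use t that in auto)
    have val: "integral {r..t} (curve_cost L F m \<gamma>) + u t (\<gamma> t) \<le> u r (\<gamma> r)" if "0 \<le> r" "r \<le> t" for r
      using optimal_curve_value(2)[OF u T_pos m\<eta> opt, of r t] that t by auto
    have near: "norm (\<gamma> r - x) < \<rho>" if r: "r \<in> {t - h..t}" for r
    proof -
      have r0: "0 \<le> r" "r \<le> t" "t - r \<le> h" using r h by auto
      \<comment> \<open>Pointing q along the displacement turns the boundary term into K times its
        length.\<close>
      define q where "q = K *\<^sub>R sgn (\<gamma> r - \<gamma> t)"
      have nq: "norm q \<le> K" using \<open>K > 0\<close> by (simp add: q_def norm_sgn)
      have "q \<bullet> (\<gamma> r - \<gamma> t) + (- C) * (t - r) \<le> integral {r..t} (curve_cost L F m \<gamma>)"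
      proof (rule curve_cost_integral_ge[OF \<gamma>])
        fix s v assume s: "s \<in> {r..t}"
        then have "\<gamma> s \<in> closure \<Omega>" "\<bar>F (\<gamma> s) (m s)\<bar> \<le> CF" using cl CF r0 t by auto
        moreover have "- (q \<bullet> v) - L (\<gamma> s) v \<le> M + \<mu> * (K + M)\<^sup>2 / 2"
          using U(2) \<open>\<gamma> s \<in> closure \<Omega>\<close> by (intro Ham_integrand_le(2) coer mu_pos nq) auto
        ultimately show "- (q \<bullet> v) + - C \<le> L (\<gamma> s) v + F (\<gamma> s) (m s)" unfolding C_def by linarith
      qed (use r0 t int in auto)
      moreover have "q \<bullet> (\<gamma> r - \<gamma> t) = K * norm (\<gamma> r - \<gamma> t)"
        by (simp add: q_def sgn_inner_self)
      moreover have "C * (t - r) \<le> C * h" using r0 \<open>C \<ge> 0\<close> by (intro mult_left_mono) auto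
      moreover have "\<bar>u r (\<gamma> r)\<bar> \<le> B" "\<bar>u t (\<gamma> t)\<bar> \<le> B" using B cl r0 t by auto
      ultimately have "K * norm (\<gamma> r - \<gamma> t) \<le> 2 * B + 1" using val[OF r0(1,2)] Ch by (simp add: algebra_simps)
      also have "\<dots> < 4 * (B + 1)" using \<open>B \<ge> 0\<close> by simp
      also have "\<dots> = K * (\<rho> / 2)" using \<rho> by (simp add: K_def)
      finally have "norm (\<gamma> r - \<gamma> t) < \<rho> / 2" using \<open>K > 0\<close> by simp
      then show ?thesis using \<gamma>x \<sigma>(2) norm_triangle_ineq[of "\<gamma> r - \<gamma> t" "\<gamma> t - x"] by simp
    qed
    define y where "y = \<gamma> (t - h)"
    have ycl: "y \<in> closure \<Omega>" using cl[of "t - h"] h t by (simp add: y_def)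
    define q where "q = p2 + e *\<^sub>R sgn (y - \<gamma> t)"
    have nq: "norm (q - p2) \<le> \<delta>" using e by (simp add: q_def norm_sgn)
    have "q \<bullet> (\<gamma> (t - h) - \<gamma> t) + (F x (m t) - Ham L x p2 - 2 * \<epsilon>) * (t - (t - h)) \<le> integral {t - h..t} (curve_cost L F m \<gamma>)"
    proof (rule curve_cost_integral_ge[OF \<gamma>])
      fix r v assume r: "r \<in> {t - h..t}"
      have "norm (\<gamma> r - x) < \<rho>" by (rule near[OF r])
      then have "- (q \<bullet> v) - L (\<gamma> r) v \<le> Ham L x p2 + \<epsilon>" using \<rho>(2) by (intro \<delta> nq) auto
      moreover have "dist (F (snd (r, \<gamma> r)) (m (fst (r, \<gamma> r)))) (F x (m t)) < \<epsilon>"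
      proof (rule \<delta>F)
        show "(r, \<gamma> r) \<in> {0..T} \<times> closure \<Omega>" using r h t cl by auto
        have "dist (r, \<gamma> r) (t, x) \<le> dist r t + dist (\<gamma> r) x"
          unfolding dist_Pair_Pair by (rule sqrt_sum_squares_le_sum) auto
        also have "\<dots> < \<delta>F" using r h(3) near[OF r] \<rho>(3) by (simp add: dist_real_def dist_norm)
        finally show "dist (r, \<gamma> r) (t, x) < \<delta>F" .
      qed
      then have "F (\<gamma> r) (m r) \<ge> F x (m t) - \<epsilon>" by (simp add: dist_real_def)
      ultimately show "- (q \<bullet> v) + (F x (m t) - Ham L x p2 - 2 * \<epsilon>) \<le> L (\<gamma> r) v + F (\<gamma> r) (m r)" by linarith
    qed (use h t int in auto)
    then have low: "q \<bullet> (y - \<gamma> t) + (F x (m t) - Ham L x p2 - 2 * \<epsilon>) * h + u t (\<gamma> t) \<le> u (t - h) y"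
      using val[of "t - h"] h by (simp add: y_def)
    \<comment> \<open>The tilt contributes e * norm (y - \<gamma> t), which cancels the same term in
      \<open>n1\<close>; only the distance from \<gamma> t to x remains to be estimated.\<close>
    have qy: "q \<bullet> (y - \<gamma> t) = p2 \<bullet> (y - \<gamma> t) + e * norm (y - \<gamma> t)"
      by (simp add: q_def inner_add_left sgn_inner_self)
    have "u (t - h) y - u t x - p1 * (t - h - t) - p2 \<bullet> (y - x) \<le> e * (\<bar>t - h - t\<bar> + norm (y - x))"
    proof (rule d[OF _ ycl])
      have "norm (y - x) < \<rho>" using near[of "t - h"] h by (simp add: y_def)
      then show "\<bar>t - h - t\<bar> + norm (y - x) < d" using h(1,3) \<rho>(4) by simp
    qed (use h t in auto)
    then have up: "u (t - h) y \<le> u t x - p1 * h + p2 \<bullet> (y - x) + e * h + e * norm (y - x)"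
      using h(1) by (simp add: algebra_simps)
    have "norm (y - x) \<le> norm (y - \<gamma> t) + norm (\<gamma> t - x)" using norm_triangle_ineq[of "y - \<gamma> t" "\<gamma> t - x"] by simp
    then have n1: "e * norm (y - x) \<le> e * norm (y - \<gamma> t) + e * norm (\<gamma> t - x)"
      using e(1) by (simp flip: distrib_left)
    have n2: "p2 \<bullet> (y - x) - p2 \<bullet> (y - \<gamma> t) \<le> norm p2 * norm (\<gamma> t - x)"
      using norm_cauchy_schwarz[of p2 "\<gamma> t - x"] by (simp add: inner_diff_right)
    have "(norm p2 + e) * norm (\<gamma> t - x) \<le> (norm p2 + e) * (\<epsilon> * h / (2 * (norm p2 + e)))"
      using \<gamma>x \<sigma>(4) pe by (intro mult_left_mono) auto
    also have "\<dots> = \<epsilon> * h / 2"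
    proof -
      have "a * (c / (2 * a)) = c / 2" if "a > 0" for a c :: real using that by simp
      then show ?thesis using pe by blast
    qed
    finally have n3: "norm p2 * norm (\<gamma> t - x) + e * norm (\<gamma> t - x) \<le> \<epsilon> * h / 2" by (simp add: distrib_right)
    have "dist (u (fst (t, \<gamma> t)) (snd (t, \<gamma> t))) (u t x) < \<epsilon> * h / 2"
      using \<gamma>x \<sigma>(3) cl[of t] t by (intro \<delta>u) (auto simp: dist_Pair_Pair dist_norm)
    then have n4: "u t x - u t (\<gamma> t) < \<epsilon> * h / 2" unfolding dist_real_def fst_conv snd_conv by linarith
    have n5: "e * h \<le> \<epsilon> * h" using e(2) h(1) by simp
    have "(F x (m t) - Ham L x p2 - 2 * \<epsilon>) * h \<le> - p1 * h + \<epsilon> * h + \<epsilon> * h"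
      using low[unfolded qy] up n1 n2 n3 n4 n5 by linarith
    then have "(F x (m t) - Ham L x p2 - 2 * \<epsilon>) * h \<le> (- p1 + 2 * \<epsilon>) * h" by (simp add: algebra_simps)
    then have "F x (m t) - Ham L x p2 - 2 * \<epsilon> \<le> - p1 + 2 * \<epsilon>" using h(1) by simp
    then show ?thesis by simp
  qed
  have "F x (m t) \<le> - p1 + Ham L x p2"
  proof (rule field_le_epsilon)
    fix e :: real assume "e > 0"
    then show "F x (m t) \<le> - p1 + Ham L x p2 + e" using ge[of "e / 4"] by simp
  qed
  then show "- p1 + Ham L x p2 = F x (m t)" using le by linarith
qed

end
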